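(* Let $\Phi:\mathcal H\to\mathbb R$ satisfy Assumption (G) of the context. Then there exists a piecewise deterministic Markov process in $\mathcal H\times\mathcal V$ with (formal) generator $$\mathcal Lf(x,v)=\langle\nabla_x f(x,v),v\rangle+\sum_{i=1}^\infty\lambda_i(x,v)\bigl(f(x,F_iv)-f(x,v)\bigr),\qquad (x,v)\in\mathcal H\times\mathcal V,$$ where $\lambda_i(x,v)=\bigl(v_i(\tfrac{x_i}{\gamma_i^2}+\partial_i\Phi(x))\bigr)^+$. Moreover, for any $a\in\mathcal V$ the probability measure $\mu$ on $\mathcal H\times\mathcal V$ given by $$\frac{d\mu}{d\mu_0}(x,v)=\frac{e^{-\Phi(x)}}{\int e^{-\Phi}\,d\mu_0},\qquad \mu_0=\pi_0\times\nu_a,$$ is invariant for such a process.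
   Context: $(\mathcal H,\langle\cdot,\cdot\rangle,\|\cdot\|)$ is an infinite dimensional separable real Hilbert space. $\Sigma$ is a positive definite, self-adjoint, trace class operator on $\mathcal H$ with orthonormal eigenbasis $\{e_j\}$, $\Sigma e_j=\gamma_j^2e_j$. Write $x_j=\langle x,e_j\rangle$, $v_j=\langle v,e_j\rangle$, $\partial_j\Phi(x)=\langle\nabla\Phi(x),e_j\rangle$, $a^+=\max(a,0)$. $\pi_0=\mathcal N(0,\Sigma)$. $\mathcal V=\{v\in\mathcal H:\Sigma^{-1}v\in\mathcal H\}$ with inner product $\langle\Sigma^{-1}v,\Sigma^{-1}w\rangle$, a Hilbert space. For $a=\sum_i a_ie_i\in\mathcal V$, $\nu_a=\bigotimes_{i=1}^\infty(\tfrac12\delta_{-a_i}+\tfrac12\delta_{a_i})$ is the law of the velocity with independent components $v_i=\pm a_i$. $F_i$ flips the sign of the $i$-th coordinate of $v$: $F_iv=v-2v_ie_i$. Assumption (G) on $\Phi$ ($\Phi$ is everywhere Fréchet differentiable, its derivative being identified with $\nabla\Phi(x)\in\mathcal H$): (1) $\Phi$ is defined everywhere on $\mathcal H$ and $0\le\Phi(x)\le K(1+\|x\|^2)$ for some constant $K$. (2) $\nabla\Phi$ is Lipschitz on bounded sets and $\|\nabla\Phi(x)\|\le K(1+\|x\|)$ for some constant $K$. (3) $\Phi=\Phi_1+\Phi_2$ with $\Phi_1$ convex and bounded from below, and $\Phi_2$ bounded with bounded first and second order derivatives. Piecewise deterministic Markov process with this generator: the process $(X_t,V_t)$ which follows the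 flow $\varphi_t(x,v)=(x+tv,v)$ between jumps, has jump rate $\lambda(x,v)=\sum_i\lambda_i(x,v)$ (so that, from $(x,v)$, the next jump time $T$ satisfies $\mathbb P(T>t)=\exp(-\int_0^t\lambda(\varphi_s(x,v))ds)$), and at a jump from $(x,v)$ moves to $(x,F_iv)$ with probability $\lambda_i(x,v)/\lambda(x,v)$; it is defined for all $t\ge0$. *)

theory Defs
  imports "HOL-Probability.Probability"
begin

section \<open>Piecewise deterministic Markov processes\<close>

definition natural_filtration ::
    "'w measure \<Rightarrow> 's measure \<Rightarrow> (real \<Rightarrow> 'w \<Rightarrow> 's) \<Rightarrow> real \<Rightarrow> 'w measure" where
  "natural_filtration N E Z t =
     sigma (space N) {Z r -` A \<inter> space N | r A. 0 \<le> r \<and> r \<le> t \<and> A \<in> sets E}"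

text \<open>A time-homogeneous Markov process with state space \<open>E\<close>, as a measurable family of laws
  \<open>P z\<close> (start in \<open>z\<close>) on one sample space \<open>N\<close>.\<close>

definition markov_process ::
    "'s measure \<Rightarrow> 'w measure \<Rightarrow> ('s \<Rightarrow> 'w measure) \<Rightarrow> (real \<Rightarrow> 'w \<Rightarrow> 's) \<Rightarrow> bool" where
  "markov_process E N P Z \<longleftrightarrow>
     P \<in> E \<rightarrow>\<^sub>M prob_algebra N \<and>
     (\<forall>t\<ge>0. Z t \<in> N \<rightarrow>\<^sub>M E) \<and>
     (\<forall>z\<in>space E. AE w in P z. Z 0 w = z) \<and>
     (\<forall>z\<in>space E. \<forall>s\<ge>0. \<forall>t\<ge>0. \<forall>A\<in>sets E.
        AE w in P z.
          real_cond_exp (P z) (natural_filtration N E Z s)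
            (indicator {w \<in> space N. Z (s + t) w \<in> A}) w
          = measure (P (Z s w)) {w' \<in> space N. Z t w' \<in> A})"

text \<open>The information carried by the jump times \<open>T 0, \<dots>, T m\<close> and by the states
  \<open>Y 0, \<dots>, Y n\<close>.\<close>

definition jump_history ::
    "'w measure \<Rightarrow> 's measure \<Rightarrow> (nat \<Rightarrow> 'w \<Rightarrow> ereal) \<Rightarrow> (nat \<Rightarrow> 'w \<Rightarrow> 's) \<Rightarrow> nat \<Rightarrow> nat
      \<Rightarrow> 'w measure" where
  "jump_history M E T Y m n =
     sigma (space M)
       ({T k -` B \<inter> space M | k B. k \<le> m \<and> B \<in> sets borel} \<union>
        {Y k -` A \<inter> space M | k A. k \<le> n \<and> A \<in> sets E})"

text \<open>\<open>Z\<close> follows the flow \<open>\<phi>\<close> between jumps, has jump rate \<open>rate\<close>, and jumps from \<open>y\<close> into the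
  set \<open>A\<close> with probability \<open>Q y A\<close>.  \<open>T n\<close> is the time of the \<open>n\<close>-th jump (\<open>T 0 = 0\<close>), with
  value \<open>\<infinity>\<close> if there are fewer than \<open>n\<close> jumps, in which case \<open>Y n\<close> is irrelevant; otherwise
  \<open>Y n\<close> is the state right after that jump.  The jump times tend to \<open>\<infinity>\<close>, so the process is defined
  for all times.\<close>

definition follows_jump_dynamics ::
    "'s measure \<Rightarrow> (real \<Rightarrow> 's \<Rightarrow> 's) \<Rightarrow> ('s \<Rightarrow> real) \<Rightarrow> ('s \<Rightarrow> 's set \<Rightarrow> real) \<Rightarrow> 's
      \<Rightarrow> 'w measure \<Rightarrow> (real \<Rightarrow> 'w \<Rightarrow> 's) \<Rightarrow> bool" where
  "follows_jump_dynamics E \<phi> rate Q z M Z \<longleftrightarrow>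
     (\<exists>T :: nat \<Rightarrow> 'w \<Rightarrow> ereal. \<exists>Y :: nat \<Rightarrow> 'w \<Rightarrow> 's.
        (\<forall>n. T n \<in> borel_measurable M) \<and> (\<forall>n. Y n \<in> M \<rightarrow>\<^sub>M E) \<and>
        (AE w in M. T 0 w = 0 \<and> Y 0 w = z) \<and>
        (AE w in M. \<forall>n. if T n w < \<infinity> then T n w < T (Suc n) w else T (Suc n) w = \<infinity>) \<and>
        (AE w in M. (\<lambda>n. T n w) \<longlonglongrightarrow> \<infinity>) \<and>
        (AE w in M. \<forall>n t. T n w \<le> ereal t \<and> ereal t < T (Suc n) w \<longrightarrow>
           Z t w = \<phi> (t - real_of_ereal (T n w)) (Y n w)) \<and>
        (\<forall>n. \<forall>t\<ge>0. AE w in M. T n w < \<infinity> \<longrightarrow>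
           real_cond_exp M (jump_history M E T Y n n)
             (indicator {w \<in> space M. T (Suc n) w > T n w + ereal t}) w
           = exp (- integral {0..t} (\<lambda>s. rate (\<phi> s (Y n w))))) \<and>
        (\<forall>n. \<forall>A\<in>sets E. AE w in M. T (Suc n) w < \<infinity> \<longrightarrow>
           real_cond_exp M (jump_history M E T Y (Suc n) n)
             (indicator {w \<in> space M. Y (Suc n) w \<in> A}) w
           = Q (\<phi> (real_of_ereal (T (Suc n) w) - real_of_ereal (T n w)) (Y n w)) A))"

definition pdmp ::
    "'s measure \<Rightarrow> (real \<Rightarrow> 's \<Rightarrow> 's) \<Rightarrow> ('s \<Rightarrow> real) \<Rightarrow> ('s \<Rightarrow> 's set \<Rightarrow> real)
      \<Rightarrow> 'w measure \<Rightarrow> ('s \<Rightarrow> 'w measure) \<Rightarrow> (real \<Rightarrow> 'w \<Rightarrow> 's) \<Rightarrow> bool" where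
  "pdmp E \<phi> rate Q N P Z \<longleftrightarrow>
     markov_process E N P Z \<and>
     (\<forall>z\<in>space E. follows_jump_dynamics E \<phi> rate Q z (P z) Z)"

text \<open>\<open>\<mu> \<bind> P\<close> is the law on \<open>N\<close> of the process with initial distribution \<open>\<mu>\<close>.\<close>

definition invariant_prob ::
    "'s measure \<Rightarrow> ('s \<Rightarrow> 'w measure) \<Rightarrow> (real \<Rightarrow> 'w \<Rightarrow> 's) \<Rightarrow> 's measure \<Rightarrow> bool" where
  "invariant_prob E P Z \<mu> \<longleftrightarrow>
     prob_space \<mu> \<and> sets \<mu> = sets E \<and> (\<forall>t\<ge>0. distr (\<mu> \<bind> P) E (Z t) = \<mu>)"

section \<open>The Hilbert space setting\<close>

definition orthonormal_basis :: "(nat \<Rightarrow> 'h::real_inner) \<Rightarrow> bool" where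
  "orthonormal_basis e \<longleftrightarrow>
     (\<forall>i j. e i \<bullet> e j = (if i = j then 1 else 0)) \<and> closure (span (range e)) = UNIV"

text \<open>For a positive operator, being trace class means having a finite trace.\<close>

definition covariance_operator ::
    "('h::real_inner \<Rightarrow> 'h) \<Rightarrow> (nat \<Rightarrow> 'h) \<Rightarrow> (nat \<Rightarrow> real) \<Rightarrow> bool" where
  "covariance_operator \<Sigma> e \<gamma> \<longleftrightarrow>
     bounded_linear \<Sigma> \<and>
     (\<forall>x y. \<Sigma> x \<bullet> y = x \<bullet> \<Sigma> y) \<and>
     (\<forall>x. x \<noteq> 0 \<longrightarrow> \<Sigma> x \<bullet> x > 0) \<and>
     orthonormal_basis e \<and>
     (\<forall>j. \<Sigma> (e j) = (\<gamma> j)\<^sup>2 *\<^sub>R e j) \<and>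
     summable (\<lambda>j. \<Sigma> (e j) \<bullet> e j)"

definition velocities :: "('h::real_inner \<Rightarrow> 'h) \<Rightarrow> 'h set" where
  "velocities \<Sigma> = range \<Sigma>"

text \<open>The inner product of \<open>velocities \<Sigma>\<close> is the one making \<open>\<Sigma>\<^sup>-\<^sup>1\<close> a unitary map onto the whole
  space, so the Borel sets of that Hilbert space are the preimages of Borel sets under \<open>\<Sigma>\<^sup>-\<^sup>1\<close>.\<close>

definition velocity_borel :: "('h::real_inner \<Rightarrow> 'h) \<Rightarrow> 'h measure" where
  "velocity_borel \<Sigma> = vimage_algebra (velocities \<Sigma>) (inv \<Sigma>) borel"

definition state_space :: "('h::real_inner \<Rightarrow> 'h) \<Rightarrow> ('h \<times> 'h) measure" where
  "state_space \<Sigma> = borel \<Otimes>\<^sub>M velocity_borel \<Sigma>"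

definition gaussian_law :: "('h::real_inner \<Rightarrow> 'h) \<Rightarrow> 'h measure \<Rightarrow> bool" where
  "gaussian_law \<Sigma> \<pi>\<^sub>0 \<longleftrightarrow>
     prob_space \<pi>\<^sub>0 \<and> sets \<pi>\<^sub>0 = sets borel \<and>
     (\<forall>h. h \<noteq> 0 \<longrightarrow>
        distributed \<pi>\<^sub>0 lborel (\<lambda>x. x \<bullet> h) (\<lambda>r. ennreal (normal_density 0 (sqrt (\<Sigma> h \<bullet> h)) r)))"

text \<open>The law of \<open>\<Sum>\<^sub>i \<plusminus>a\<^sub>i e\<^sub>i\<close> with independent fair signs.\<close>

definition velocity_law ::
    "('h::real_inner \<Rightarrow> 'h) \<Rightarrow> (nat \<Rightarrow> 'h) \<Rightarrow> 'h \<Rightarrow> 'h measure" where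
  "velocity_law \<Sigma> e a =
     distr (\<Pi>\<^sub>M i\<in>UNIV. measure_pmf (bernoulli_pmf (1/2))) (velocity_borel \<Sigma>)
       (\<lambda>b. \<Sum>i. (if b i then a \<bullet> e i else - (a \<bullet> e i)) *\<^sub>R e i)"

section \<open>The potential\<close>

text \<open>Meaningful only where the gradient exists.\<close>

definition gradient :: "('h::real_inner \<Rightarrow> real) \<Rightarrow> 'h \<Rightarrow> 'h" where
  "gradient f x = (THE D. GDERIV f x :> D)"

definition bounded_C2 :: "('h::real_inner \<Rightarrow> real) \<Rightarrow> bool" where
  "bounded_C2 f \<longleftrightarrow>
     bounded (range f) \<and>
     (\<forall>x. GDERIV f x :> gradient f x) \<and> bounded (range (gradient f)) \<and>
     (\<exists>H :: 'h \<Rightarrow> 'h \<Rightarrow>\<^sub>L 'h.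
        (\<forall>x. (gradient f has_derivative blinfun_apply (H x)) (at x)) \<and> bounded (range H))"

definition assumption_G :: "('h::real_inner \<Rightarrow> real) \<Rightarrow> bool" where
  "assumption_G \<Phi> \<longleftrightarrow>
     (\<forall>x. GDERIV \<Phi> x :> gradient \<Phi> x) \<and>
     (\<exists>K. \<forall>x. 0 \<le> \<Phi> x \<and> \<Phi> x \<le> K * (1 + (norm x)\<^sup>2)) \<and>
     (\<forall>B. bounded B \<longrightarrow> (\<exists>L. L-lipschitz_on B (gradient \<Phi>))) \<and>
     (\<exists>K. \<forall>x. norm (gradient \<Phi> x) \<le> K * (1 + norm x)) \<and>
     (\<exists>\<Phi>\<^sub>1 \<Phi>\<^sub>2. (\<forall>x. \<Phi> x = \<Phi>\<^sub>1 x + \<Phi>\<^sub>2 x) \<and>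
        convex_on UNIV \<Phi>\<^sub>1 \<and> bdd_below (range \<Phi>\<^sub>1) \<and> bounded_C2 \<Phi>\<^sub>2)"

section \<open>The dynamics\<close>

text \<open>The process with formal generator
  \<open>L f (x, v) = \<nabla>\<^sub>x f (x, v) \<bullet> v + (\<Sum>i. flip_rate i (x, v) * (f (x, F\<^sub>i v) - f (x, v)))\<close>:
  the transport term is the derivative along \<open>free_flow\<close>, and the jump part is
  \<open>total_rate\<close> times the integral of \<open>f\<close> - \<open>f (x, v)\<close> against \<open>flip_kernel\<close>.\<close>

definition free_flow :: "real \<Rightarrow> 'h::real_inner \<times> 'h \<Rightarrow> 'h \<times> 'h" where
  "free_flow t = (\<lambda>(x, v). (x + t *\<^sub>R v, v))"

definition flip :: "(nat \<Rightarrow> 'h::real_inner) \<Rightarrow> nat \<Rightarrow> 'h \<Rightarrow> 'h" where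
  "flip e i v = v - (2 * (v \<bullet> e i)) *\<^sub>R e i"

definition flip_rate ::
    "(nat \<Rightarrow> 'h::real_inner) \<Rightarrow> (nat \<Rightarrow> real) \<Rightarrow> ('h \<Rightarrow> real) \<Rightarrow> nat \<Rightarrow> 'h \<times> 'h \<Rightarrow> real" where
  "flip_rate e \<gamma> \<Phi> i =
     (\<lambda>(x, v). max ((v \<bullet> e i) * ((x \<bullet> e i) / (\<gamma> i)\<^sup>2 + gradient \<Phi> x \<bullet> e i)) 0)"

definition total_rate ::
    "(nat \<Rightarrow> 'h::real_inner) \<Rightarrow> (nat \<Rightarrow> real) \<Rightarrow> ('h \<Rightarrow> real) \<Rightarrow> 'h \<times> 'h \<Rightarrow> real" where
  "total_rate e \<gamma> \<Phi> z = (\<Sum>i. flip_rate e \<gamma> \<Phi> i z)"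

text \<open>Used only at states with positive total rate: the process almost surely does not jump at a
  state where the rate vanishes.\<close>

definition flip_kernel ::
    "(nat \<Rightarrow> 'h::real_inner) \<Rightarrow> (nat \<Rightarrow> real) \<Rightarrow> ('h \<Rightarrow> real) \<Rightarrow> 'h \<times> 'h \<Rightarrow> ('h \<times> 'h) set \<Rightarrow> real"
  where
  "flip_kernel e \<gamma> \<Phi> =
     (\<lambda>(x, v) A. \<Sum>i. flip_rate e \<gamma> \<Phi> i (x, v) / total_rate e \<gamma> \<Phi> (x, v) * indicator A (x, flip e i v))"

definition zigzag_process ::
    "('h::real_inner \<Rightarrow> 'h) \<Rightarrow> (nat \<Rightarrow> 'h) \<Rightarrow> (nat \<Rightarrow> real) \<Rightarrow> ('h \<Rightarrow> real)
      \<Rightarrow> 'w measure \<Rightarrow> ('h \<times> 'h \<Rightarrow> 'w measure) \<Rightarrow> (real \<Rightarrow> 'w \<Rightarrow> 'h \<times> 'h) \<Rightarrow> bool" where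
  "zigzag_process \<Sigma> e \<gamma> \<Phi> N P Z \<longleftrightarrow>
     pdmp (state_space \<Sigma>) free_flow (total_rate e \<gamma> \<Phi>) (flip_kernel e \<gamma> \<Phi>) N P Z"

definition gibbs_measure ::
    "('h::real_inner \<Rightarrow> 'h) \<Rightarrow> (nat \<Rightarrow> 'h) \<Rightarrow> 'h measure \<Rightarrow> 'h \<Rightarrow> ('h \<Rightarrow> real) \<Rightarrow> ('h \<times> 'h) measure"
  where
  "gibbs_measure \<Sigma> e \<pi>\<^sub>0 a \<Phi> =
     (let \<mu>\<^sub>0 = \<pi>\<^sub>0 \<Otimes>\<^sub>M velocity_law \<Sigma> e a in
      density \<mu>\<^sub>0 (\<lambda>(x, v). ennreal (exp (- \<Phi> x) / (\<integral>(x, v). exp (- \<Phi> x) \<partial>\<mu>\<^sub>0))))"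

end

theory Submission
  imports Defs
begin

text \<open>
  Existence: the process is built from an i.i.d. sequence of pairs of an exponential clock (the
  integrated rate spent until the next jump) and a uniform variable (selecting the flipped
  coordinate). Flips preserve \<open>\<parallel>v\<parallel>\<close> and \<open>\<parallel>\<Sigma>\<^sup>-\<^sup>1 v\<parallel>\<close>, so the rate is bounded along
  all trajectories up to a fixed time; since the clocks have infinite sum, jumps do not accumulate. The
  Markov property follows by induction on the number of jumps before the present time, the base case
  being the lack of memory of the clock.

  Invariance: for any process with the given dynamics, \<open>E\<^sub>z f(Z\<^sub>t) = (\<Sum>n. G\<^sub>n f t z)\<close>, where \<open>G\<^sub>n\<close>
  collects the trajectories with exactly \<open>n\<close> jumps and is an iterated time convolution of the killed
  flow and the jump operator. By the Cameron--Martin formula and the invariance of \<open>\<mu>\<close> under single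
  flips, the \<open>\<mu>\<close>-adjoints of these two operators are their conjugates by velocity reversal \<open>S\<close>, and
  hence so are the adjoints of all \<open>G\<^sub>n\<close>. Therefore
  \<open>\<integral> E\<^sub>z f(Z\<^sub>t) d\<mu> = \<integral> f (\<Sum>n. G\<^sub>n 1 t \<circ> S) d\<mu> = \<integral> f d\<mu>\<close>, as \<open>\<Sum>n. G\<^sub>n 1 t = 1\<close>.
  Only nonnegative functions occur, so no integrability or domain questions arise.
\<close>

section \<open>Exponential clocks and integrated rates\<close>

text \<open>Invariance is claimed for every process with these dynamics, on any sample space, so it
  has to be extracted from the two conditional laws alone; they are first turned into identities
  between nonnegative integrals. The adjoint computation closes because \<open>G_n\<close>
  alternates \<open>n + 1\<close> killed flows with \<open>n\<close> jumps: taking adjoints reverses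
  the order of the factors, and the reversed word has the same shape. Only the end from which it is
  read changes, which is the difference between \<open>first_jump\<close> and
  \<open>last_jump\<close>. Writing velocities as \<open>v = \<Sigma> w\<close> removes the apparent
  singularity of the rates: \<open>v_i x_i / \<gamma>_i^2\<close> becomes \<open>w_i x_i\<close>, so
  the rates have a finite sum at every state by Cauchy-Schwarz, and every displacement
  \<open>s v\<close> is an admissible shift of the Gaussian measure. Along the flow the rates of
  \<open>v\<close> and \<open>- v\<close> differ by the derivative of the Gaussian exponent plus the
  potential, which is exactly what the Cameron-Martin density has to be balanced with.\<close>

definition unit_exponential :: "real measure" where
  "unit_exponential = density lborel (exponential_density 1)"

lemma prob_space_unit_exponential: "prob_space unit_exponential"
  unfolding unit_exponential_def by (rule prob_space_exponential_density) simp

lemma sets_unit_exponential [measurable_cong, simp]: "sets unit_exponential = sets borel"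
  by (simp add: unit_exponential_def)

lemma space_unit_exponential [simp]: "space unit_exponential = UNIV"
  by (simp add: unit_exponential_def)

lemma emeasure_unit_exponential_UNIV [simp]: "emeasure unit_exponential UNIV = 1"
  using prob_space.emeasure_space_1[OF prob_space_unit_exponential] by simp

lemma emeasure_unit_exponential_greaterThan:
  assumes "0 \<le> c"
  shows "emeasure unit_exponential {c<..} = ennreal (exp (- c))"
proof -
  interpret prob_space unit_exponential by (rule prob_space_unit_exponential)
  have "distributed unit_exponential lborel (\<lambda>x. x) (exponential_density 1)"
    unfolding distributed_def unit_exponential_def
    by (auto intro!: distr_id2)
  from exponential_distributedD_gt[OF this assms]
  show ?thesis
    by (simp add: emeasure_eq_measure greaterThan_def)
qed

lemma AE_unit_exponential_pos: "AE c in unit_exponential. 0 < c"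
proof -
  interpret prob_space unit_exponential by (rule prob_space_unit_exponential)
  have "emeasure unit_exponential {0<..} = 1"
    using emeasure_unit_exponential_greaterThan[of 0] by simp
  then have "prob {0<..} = 1"
    by (simp add: measure_def)
  then have "AE c in unit_exponential. c \<in> {0<..}"
    by (subst prob_eq_1[symmetric]) auto
  then show ?thesis
    by simp
qed

text \<open>Lack of memory in integrated form: the excess of the clock over \<open>a\<close> is
  again a unit exponential, and surviving \<open>a\<close> costs the factor
  \<open>exp (- a)\<close>.\<close>

lemma nn_integral_unit_exponential_shift:
  assumes [measurable]: "g \<in> borel_measurable borel" and "0 \<le> a"
  shows "(\<integral>\<^sup>+c. (if a < c then g (c - a) else 0) \<partial>unit_exponential)
    = ennreal (exp (- a)) * (\<integral>\<^sup>+c. g c \<partial>unit_exponential)"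
proof -
  have "(\<integral>\<^sup>+c. (if a < c then g (c - a) else 0) \<partial>unit_exponential)
    = (\<integral>\<^sup>+c. ennreal (exponential_density 1 c) * (if a < c then g (c - a) else 0) \<partial>lborel)"
    unfolding unit_exponential_def by (subst nn_integral_density) auto
  also have "\<dots> = (\<integral>\<^sup>+c. ennreal (exponential_density 1 (a + c)) * (if a < a + c then g (a + 1 * c - a) else 0) \<partial>lborel)"
    by (subst nn_integral_real_affine[where c = 1 and t = a]) (simp_all cong: if_cong)
  also have "\<dots> = (\<integral>\<^sup>+c. ennreal (exp (- a)) * (ennreal (exponential_density 1 c) * g c) \<partial>lborel)"
  proof (rule nn_integral_cong_AE)
    \<comment> \<open>At \<open>c = 0\<close> the strict test \<open>a < a + c\<close> fails while
      the density is \<open>1\<close>; a single point is negligible.\<close>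
    have "AE c in lborel. c \<noteq> (0::real)"
      by (rule AE_lborel_singleton)
    then show "AE c in lborel. ennreal (exponential_density 1 (a + c)) * (if a < a + c then g (a + 1 * c - a) else 0)
        = ennreal (exp (- a)) * (ennreal (exponential_density 1 c) * g c)"
    proof eventually_elim
      case (elim c)
      show ?case
        using elim \<open>0 \<le> a\<close>
        by (auto simp: exponential_density_def mult.assoc[symmetric] ennreal_mult[symmetric] exp_add[symmetric])
    qed
  qed
  also have "\<dots> = ennreal (exp (- a)) * (\<integral>\<^sup>+c. ennreal (exponential_density 1 c) * g c \<partial>lborel)"
    by (rule nn_integral_cmult) auto
  also have "(\<integral>\<^sup>+c. ennreal (exponential_density 1 c) * g c \<partial>lborel) = (\<integral>\<^sup>+c. g c \<partial>unit_exponential)"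
    unfolding unit_exponential_def by (subst nn_integral_density) auto
  finally show ?thesis .
qed

lemma measure_eqI_rectangles:
  assumes fin: "finite_measure M1" and sets1: "sets M1 = sets (A \<Otimes>\<^sub>M B)" and sets2: "sets M2 = sets (A \<Otimes>\<^sub>M B)"
    and eq: "\<And>X Y. X \<in> sets A \<Longrightarrow> Y \<in> sets B \<Longrightarrow> emeasure M1 (X \<times> Y) = emeasure M2 (X \<times> Y)"
  shows "M1 = M2"
proof (rule measure_eqI_generator_eq)
  show "Int_stable {a \<times> b |a b. a \<in> sets A \<and> b \<in> sets B}"
    by (rule Int_stable_pair_measure_generator)
  show "{a \<times> b |a b. a \<in> sets A \<and> b \<in> sets B} \<subseteq> Pow (space A \<times> space B)"
    by (rule pair_measure_closed)
  show "sets M1 = sigma_sets (space A \<times> space B) {a \<times> b |a b. a \<in> sets A \<and> b \<in> sets B}"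
    "sets M2 = sigma_sets (space A \<times> space B) {a \<times> b |a b. a \<in> sets A \<and> b \<in> sets B}"
    by (simp_all add: sets1 sets2 sets_pair_measure)
  show "range (\<lambda>n::nat. space A \<times> space B) \<subseteq> {a \<times> b |a b. a \<in> sets A \<and> b \<in> sets B}"
    by auto
  show "(\<Union>i::nat. space A \<times> space B) = space A \<times> space B" by simp
  show "emeasure M1 (space A \<times> space B) \<noteq> \<infinity>" for i :: nat
    using finite_measure.emeasure_finite[OF fin] by simp
qed (use eq in auto)

text \<open>Jumps come in countably many types: type \<open>i\<close> applies the map
  \<open>F i\<close> at rate \<open>r i\<close>. Continuity of the total rate along trajectories
  makes the integrated rate differentiable, which yields a density for the jump times.\<close>

locale pdmp_setup =
  fixes E :: "'s measure" and \<phi> :: "real \<Rightarrow> 's \<Rightarrow> 's"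
    and r :: "nat \<Rightarrow> 's \<Rightarrow> real" and F :: "nat \<Rightarrow> 's \<Rightarrow> 's"
  assumes flow_measurable: "(\<lambda>(t, z). \<phi> t z) \<in> borel \<Otimes>\<^sub>M E \<rightarrow>\<^sub>M E"
    and flow_zero: "z \<in> space E \<Longrightarrow> \<phi> 0 z = z"
    and flow_add: "z \<in> space E \<Longrightarrow> \<phi> (s + t) z = \<phi> t (\<phi> s z)"
    and rate_measurable [measurable]: "r i \<in> borel_measurable E"
    and rate_nonneg: "0 \<le> r i z"
    and rate_summable: "z \<in> space E \<Longrightarrow> summable (\<lambda>i. r i z)"
    and jump_measurable [measurable]: "F i \<in> E \<rightarrow>\<^sub>M E"
    and rate_continuous: "z \<in> space E \<Longrightarrow> continuous_on UNIV (\<lambda>t. \<Sum>i. r i (\<phi> t z))"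
begin

lemma flow_measurable2 [measurable (raw)]:
  assumes "f \<in> borel_measurable M" "g \<in> M \<rightarrow>\<^sub>M E"
  shows "(\<lambda>x. \<phi> (f x) (g x)) \<in> M \<rightarrow>\<^sub>M E"
  using measurable_compose[OF measurable_Pair[OF assms] flow_measurable] by simp

lemma flow_in_space [simp]: "z \<in> space E \<Longrightarrow> \<phi> t z \<in> space E"
  using measurable_space[OF flow_measurable, of "(t, z)"] by (simp add: space_pair_measure)

lemma jump_in_space [simp]: "z \<in> space E \<Longrightarrow> F i z \<in> space E"
  by (rule measurable_space[OF jump_measurable])

definition rate :: "'s \<Rightarrow> real" where "rate z = (\<Sum>i. r i z)"

lemma total_rate_measurable [measurable]: "rate \<in> borel_measurable E"
  unfolding rate_def[abs_def] by measurable

lemma total_rate_nonneg: "z \<in> space E \<Longrightarrow> 0 \<le> rate z"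
  unfolding rate_def by (intro suminf_nonneg rate_summable rate_nonneg)

lemma total_rate_continuous: "z \<in> space E \<Longrightarrow> continuous_on A (\<lambda>t. rate (\<phi> t z))"
  unfolding rate_def using rate_continuous continuous_on_subset by blast

definition Lam :: "real \<Rightarrow> 's \<Rightarrow> real" where "Lam t z = integral {0..t} (\<lambda>s. rate (\<phi> s z))"

lemma Lam_set_integrable:
  assumes "z \<in> space E"
  shows "set_integrable lborel {a..b} (\<lambda>s. rate (\<phi> s z))"
  using borel_integrable_atLeastAtMost'[OF total_rate_continuous[OF assms, of "{a..b}"]] .

lemma rate_integrable_on: "z \<in> space E \<Longrightarrow> (\<lambda>s. rate (\<phi> s z)) integrable_on {a..b}"
  by (intro integrable_continuous_interval total_rate_continuous)

text \<open>The dynamics are stated with the Henstock-Kurzweil integral; the Lebesgue form gives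
  joint measurability in time and state.\<close>

lemma Lam_eq_lebesgue:
  assumes "z \<in> space E"
  shows "Lam t z = (\<integral>s. indicator {0..t} s * rate (\<phi> s z) \<partial>lborel)"
  using set_borel_integral_eq_integral(2)[OF Lam_set_integrable[OF assms, of 0 t]]
  by (simp add: Lam_def set_lebesgue_integral_def)

lemma Lam_measurable: "(\<lambda>(t, z). Lam t z) \<in> borel_measurable (borel \<Otimes>\<^sub>M E)"
proof -
  have "(\<lambda>p. \<integral>s. indicator {0..fst p} s * rate (\<phi> s (snd p)) \<partial>lborel) \<in> borel_measurable (borel \<Otimes>\<^sub>M E)"
  proof (rule lborel.borel_measurable_lebesgue_integral)
    have "(\<lambda>q::(real \<times> 's) \<times> real. (if 0 \<le> snd q \<and> snd q \<le> fst (fst q) then 1 else 0) * rate (\<phi> (snd q) (snd (fst q))))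
      \<in> borel_measurable ((borel \<Otimes>\<^sub>M E) \<Otimes>\<^sub>M lborel)"
      by measurable
    then show "(\<lambda>(p, s). indicator {0..fst p} s * rate (\<phi> s (snd p))) \<in> borel_measurable ((borel \<Otimes>\<^sub>M E) \<Otimes>\<^sub>M lborel)"
      by (rule measurable_cong[THEN iffD1, rotated]) (auto simp: indicator_def)
  qed
  then show ?thesis
    by (rule measurable_cong[THEN iffD1, rotated]) (auto simp: space_pair_measure Lam_eq_lebesgue)
qed

lemma Lam_measurable2 [measurable (raw)]:
  assumes "f \<in> borel_measurable M" "g \<in> M \<rightarrow>\<^sub>M E"
  shows "(\<lambda>x. Lam (f x) (g x)) \<in> borel_measurable M"
  using measurable_compose[OF measurable_Pair[OF assms] Lam_measurable] by simp

lemma Lam_nonpos [simp]: "t \<le> 0 \<Longrightarrow> Lam t z = 0"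
  unfolding Lam_def by (cases "t = 0") auto

lemma Lam_add:
  assumes "z \<in> space E" "0 \<le> s" "0 \<le> t"
  shows "Lam (s + t) z = Lam s z + Lam t (\<phi> s z)"
proof -
  have "Lam (s + t) z = integral {0..s} (\<lambda>s. rate (\<phi> s z)) + integral {s..s+t} (\<lambda>s. rate (\<phi> s z))"
    unfolding Lam_def using assms
    by (intro Henstock_Kurzweil_Integration.integral_combine[symmetric] rate_integrable_on) auto
  also have "integral {s..s+t} (\<lambda>s. rate (\<phi> s z)) = integral {0..t} (\<lambda>u. rate (\<phi> (u + s) z))"
    using integral_shift_real_ivl[of s s "s + t" "\<lambda>s. rate (\<phi> s z)"] by simp
  also have "\<dots> = Lam t (\<phi> s z)"
    unfolding Lam_def using assms(1) by (simp add: flow_add[symmetric] add.commute)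
  finally show ?thesis by (simp add: Lam_def)
qed

lemma Lam_nonneg: "z \<in> space E \<Longrightarrow> 0 \<le> Lam t z"
  unfolding Lam_def by (intro Henstock_Kurzweil_Integration.integral_nonneg rate_integrable_on) (auto intro: total_rate_nonneg)

lemma Lam_mono:
  assumes "z \<in> space E" "s \<le> t"
  shows "Lam s z \<le> Lam t z"
proof (cases "0 \<le> s")
  case True
  then show ?thesis
    using Lam_add[of z s "t - s"] Lam_nonneg[of "\<phi> s z" "t - s"] assms by simp
qed (use assms Lam_nonneg in auto)

lemma Lam_deriv:
  assumes "z \<in> space E" "0 \<le> t" "t \<le> b"
  shows "((\<lambda>t. Lam t z) has_real_derivative rate (\<phi> t z)) (at t within {0..b})"
  unfolding Lam_def
  by (rule integral_has_real_derivative) (use assms in \<open>auto intro: total_rate_continuous\<close>)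

lemma Lam_continuous:
  assumes "z \<in> space E"
  shows "continuous_on {0..b} (\<lambda>t. Lam t z)"
  using Lam_deriv[OF assms] by (meson DERIV_continuous_on atLeastAtMost_iff)

text \<open>The generalised inverse of the integrated rate, infinite if the level \<open>c\<close>
  is never reached. Fed with a unit exponential clock it becomes a holding time with the prescribed
  hazard rate.\<close>

definition wait :: "'s \<Rightarrow> real \<Rightarrow> ereal" where
  "wait z c = Inf {ereal t | t. 0 \<le> t \<and> c \<le> Lam t z}"

lemma wait_nonneg: "0 \<le> wait z c"
  unfolding wait_def by (rule Inf_greatest) auto

text \<open>Continuity of \<open>Lam\<close> keeps the inequality strict: a level not reached at
  \<open>t\<close> is not reached immediately afterwards either. The law of \<open>wait\<close>
  under an exponential clock is read off from this equivalence.\<close>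

lemma less_wait_iff:
  assumes z: "z \<in> space E" and t: "0 \<le> t"
  shows "ereal t < wait z c \<longleftrightarrow> Lam t z < c"
proof
  assume "ereal t < wait z c"
  show "Lam t z < c"
  proof (rule ccontr)
    assume "\<not> Lam t z < c"
    then have "wait z c \<le> ereal t"
      unfolding wait_def using t by (intro Inf_lower) auto
    with \<open>ereal t < wait z c\<close> show False by simp
  qed
next
  assume less: "Lam t z < c"
  have "continuous_on {0..t+1} (\<lambda>t. Lam t z)"
    by (rule Lam_continuous[OF z])
  then obtain d where d: "d > 0" "\<And>x. x \<in> {0..t+1} \<Longrightarrow> dist x t < d \<Longrightarrow> dist (Lam x z) (Lam t z) < c - Lam t z"
    unfolding continuous_on_iff using less t by (metis atLeastAtMost_iff diff_gt_0_iff_gt le_add_same_cancel1 zero_le_one)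
  \<comment> \<open>The cap \<open>1\<close> keeps \<open>u\<close> in the interval of continuity,
    and \<open>d / 2\<close> keeps it strictly inside the ball.\<close>
  define u where "u = t + min 1 (d / 2)"
  have u: "t < u" "u \<in> {0..t+1}" "dist u t < d"
    using \<open>d > 0\<close> t by (auto simp: u_def dist_real_def)
  have "Lam u z < c"
    using d(2)[OF u(2,3)] by (auto simp: dist_real_def)
  have "ereal u \<le> wait z c"
    unfolding wait_def
  proof (rule Inf_greatest)
    fix x assume "x \<in> {ereal t |t. 0 \<le> t \<and> c \<le> Lam t z}"
    then obtain s where s: "x = ereal s" "c \<le> Lam s z" by auto
    then have "u \<le> s"
      using Lam_mono[OF z, of s u] \<open>Lam u z < c\<close> by (cases "u \<le> s") auto
    then show "ereal u \<le> x" using s by simp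
  qed
  with u show "ereal t < wait z c"
    using less_le_trans[of "ereal t" "ereal u"] by simp
qed

lemma wait_measurable: "(\<lambda>(z, c). wait z c) \<in> borel_measurable (E \<Otimes>\<^sub>M borel)"
proof (rule borel_measurableI_greater)
  fix a :: ereal
  show "{x \<in> space (E \<Otimes>\<^sub>M borel). a < (case x of (z, c) \<Rightarrow> wait z c)} \<in> sets (E \<Otimes>\<^sub>M borel)"
  proof (cases "a < 0")
    case True
    then have "{x \<in> space (E \<Otimes>\<^sub>M borel). a < (case x of (z, c) \<Rightarrow> wait z c)} = space (E \<Otimes>\<^sub>M borel)"
      using less_le_trans[OF True wait_nonneg] by (auto split: prod.splits)
    then show ?thesis by simp
  next
    case False
    then consider "a = \<infinity>" | t where "a = ereal t" "0 \<le> t"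
      by (cases a) auto
    then show ?thesis
    proof cases
      case 1
      then show ?thesis by simp
    next
      case 2
      then have "{x \<in> space (E \<Otimes>\<^sub>M borel). a < (case x of (z, c) \<Rightarrow> wait z c)}
        = {x \<in> space (E \<Otimes>\<^sub>M borel). Lam t (fst x) < snd x}"
        by (auto simp: less_wait_iff space_pair_measure)
      also have "\<dots> \<in> sets (E \<Otimes>\<^sub>M borel)" by measurable
      finally show ?thesis .
    qed
  qed
qed

lemma wait_measurable2 [measurable (raw)]:
  assumes "f \<in> M \<rightarrow>\<^sub>M E" "g \<in> borel_measurable M"
  shows "(\<lambda>x. wait (f x) (g x)) \<in> borel_measurable M"
  using measurable_compose[OF measurable_Pair[OF assms] wait_measurable] by simp

lemma wait_pos: "z \<in> space E \<Longrightarrow> 0 < c \<Longrightarrow> 0 < wait z c"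
  using less_wait_iff[of z 0 c] by (simp add: zero_ereal_def)

lemma Lam_wait_ge:
  assumes "z \<in> space E" "wait z c = ereal t"
  shows "c \<le> Lam t z"
proof -
  have "0 \<le> t" using wait_nonneg[of z c] assms by simp
  then show ?thesis using less_wait_iff[of z t c] assms by simp
qed

text \<open>By additivity of \<open>Lam\<close>, a clock not exhausted at time \<open>s\<close> goes
  on from \<open>\<phi> s z\<close> with the rest \<open>c - Lam s z\<close>. This is the pathwise
  half of the Markov property before the first jump.\<close>

lemma wait_shift:
  assumes z: "z \<in> space E" and s: "0 \<le> s" and c: "Lam s z < c"
  shows "wait z c = ereal s + wait (\<phi> s z) (c - Lam s z)"
proof -
  \<comment> \<open>Two extended reals agree if they have the same strict lower bounds; at
    nonnegative real levels these are described by \<open>less_wait_iff\<close>.\<close>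
  have "x < wait z c \<longleftrightarrow> x < ereal s + wait (\<phi> s z) (c - Lam s z)" for x
  proof (cases "x < ereal s")
    case True
    have "ereal s < wait z c" using less_wait_iff[OF z s] c by simp
    moreover have "ereal s + 0 \<le> ereal s + wait (\<phi> s z) (c - Lam s z)"
      by (intro add_left_mono wait_nonneg)
    ultimately show ?thesis using True by (auto intro: less_trans less_le_trans)
  next
    case False
    then consider "x = \<infinity>" | t where "x = ereal (s + t)" "0 \<le> t"
    proof (cases x)
      case (real u)
      with False that(2)[of "u - s"] show ?thesis by auto
    qed auto
    then show ?thesis
    proof cases
      case 2
      have "ereal (s + t) < ereal s + wait (\<phi> s z) (c - Lam s z) \<longleftrightarrow> ereal t < wait (\<phi> s z) (c - Lam s z)"
        by (cases "wait (\<phi> s z) (c - Lam s z)") auto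
      also have "\<dots> \<longleftrightarrow> Lam t (\<phi> s z) < c - Lam s z"
        using z 2 by (intro less_wait_iff) auto
      also have "\<dots> \<longleftrightarrow> Lam (s + t) z < c"
        using Lam_add[OF z s, of t] 2 by auto
      also have "\<dots> \<longleftrightarrow> ereal (s + t) < wait z c"
        using z s 2 by (intro less_wait_iff[symmetric]) auto
      finally show ?thesis using 2 by simp
    qed simp
  qed
  then show ?thesis by (meson less_irrefl linorder_neqE)
qed

lemma emeasure_less_wait:
  assumes z: "z \<in> space E" and t: "0 \<le> t"
  shows "emeasure unit_exponential {c. ereal t < wait z c} = ennreal (exp (- Lam t z))"
proof -
  have "{c. ereal t < wait z c} = {Lam t z<..}"
    by (auto simp: less_wait_iff z t)
  then show ?thesis
    by (simp add: emeasure_unit_exponential_greaterThan Lam_nonneg z)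
qed

lemma nn_integral_rate_exp:
  assumes z: "z \<in> space E" and t: "0 \<le> t"
  shows "(\<integral>\<^sup>+s. ennreal (rate (\<phi> s z) * exp (- Lam s z)) * indicator {0..t} s \<partial>lborel)
    = ennreal (1 - exp (- Lam t z))"
proof -
  have "((\<lambda>s. rate (\<phi> s z) * exp (- Lam s z)) has_integral (- exp (- Lam t z)) - (- exp (- Lam 0 z))) {0..t}"
  proof (rule fundamental_theorem_of_calculus[OF t])
    fix s assume s: "s \<in> {0..t}"
    show "((\<lambda>s. - exp (- Lam s z)) has_vector_derivative rate (\<phi> s z) * exp (- Lam s z)) (at s within {0..t})"
      unfolding has_real_derivative_iff_has_vector_derivative[symmetric]
      using s by (auto intro!: derivative_eq_intros Lam_deriv[OF z])
  qed
  then have "(\<integral>\<^sup>+s. ennreal (rate (\<phi> s z) * exp (- Lam s z)) * indicator {0..t} s \<partial>lborel)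
    = ennreal ((- exp (- Lam t z)) - (- exp (- Lam 0 z)))"
    by (intro nn_integral_has_integral_lebesgue') (simp_all add: z total_rate_nonneg)
  then show ?thesis by simp
qed

text \<open>The density is minus the derivative of the survival function
  \<open>exp (- Lam s z)\<close>. The mass at infinity is cut off on the left, so two measures of
  mass at most one are compared on the half-lines up to \<open>x\<close>.\<close>

lemma nn_integral_wait:
  assumes z: "z \<in> space E" and [measurable]: "h \<in> borel_measurable borel"
  shows "(\<integral>\<^sup>+c. (if wait z c < \<infinity> then h (real_of_ereal (wait z c)) else 0) \<partial>unit_exponential)
    = (\<integral>\<^sup>+s. ennreal (rate (\<phi> s z) * exp (- Lam s z)) * indicator {0..} s * h s \<partial>lborel)"
proof -
  interpret X: prob_space unit_exponential by (rule prob_space_unit_exponential)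
  have [measurable]: "wait z \<in> borel_measurable borel" "(\<lambda>s. rate (\<phi> s z) * exp (- Lam s z)) \<in> borel_measurable borel"
    using z by measurable
  define m1 where "m1 = distr (density unit_exponential (indicator {c. wait z c < \<infinity>})) borel (\<lambda>c. real_of_ereal (wait z c))"
  define m2 where "m2 = density lborel (\<lambda>s. ennreal (rate (\<phi> s z) * exp (- Lam s z)) * indicator {0..} s)"
  have m2: "emeasure m2 {..x} = ennreal (1 - exp (- Lam x z))" for x
  proof (cases "0 \<le> x")
    case True
    have "emeasure m2 {..x} = (\<integral>\<^sup>+s. ennreal (rate (\<phi> s z) * exp (- Lam s z)) * indicator {0..} s * indicator {..x} s \<partial>lborel)"
      unfolding m2_def by (subst emeasure_density) auto
    also have "\<dots> = (\<integral>\<^sup>+s. ennreal (rate (\<phi> s z) * exp (- Lam s z)) * indicator {0..x} s \<partial>lborel)"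
      by (intro nn_integral_cong) (auto simp: indicator_def)
    finally show ?thesis using nn_integral_rate_exp[OF z True] by simp
  next
    case False
    have "emeasure m2 {..x} = (\<integral>\<^sup>+s. ennreal (rate (\<phi> s z) * exp (- Lam s z)) * indicator {0..} s * indicator {..x} s \<partial>lborel)"
      unfolding m2_def by (subst emeasure_density) auto
    also have "\<dots> = (\<integral>\<^sup>+s. 0 \<partial>(lborel::real measure))"
      using False by (intro nn_integral_cong) (auto simp: indicator_def)
    finally show ?thesis using False by simp
  qed
  have m1: "emeasure m1 {..x} = ennreal (1 - exp (- Lam x z))" for x
  proof -
    have "emeasure m1 {..x} = emeasure (density unit_exponential (indicator {c. wait z c < \<infinity>})) {c. real_of_ereal (wait z c) \<le> x}"
      unfolding m1_def by (subst emeasure_distr) (auto intro!: arg_cong2[where f = emeasure])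
    also have "\<dots> = emeasure unit_exponential ({c. real_of_ereal (wait z c) \<le> x} \<inter> {c. wait z c < \<infinity>})"
      by (subst emeasure_restricted) (auto simp: Int_commute)
    also have "{c. real_of_ereal (wait z c) \<le> x} \<inter> {c. wait z c < \<infinity>} = {c. wait z c \<le> ereal x}"
    proof (intro set_eqI)
      fix c show "c \<in> {c. real_of_ereal (wait z c) \<le> x} \<inter> {c. wait z c < \<infinity>} \<longleftrightarrow> c \<in> {c. wait z c \<le> ereal x}"
        using wait_nonneg[of z c] by (cases "wait z c") auto
    qed
    also have "emeasure unit_exponential {c. wait z c \<le> ereal x} = ennreal (1 - exp (- Lam x z))"
    proof (cases "0 \<le> x")
      case True
      have "{c. wait z c \<le> ereal x} = space unit_exponential - {c. ereal x < wait z c}"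
        by auto
      also have "emeasure unit_exponential \<dots> = 1 - ennreal (exp (- Lam x z))"
        using emeasure_less_wait[OF z True]
        by (subst emeasure_compl) (auto simp: X.emeasure_space_1)
      finally show ?thesis by (simp add: ennreal_minus[symmetric] flip: ennreal_1)
    next
      case False
      then have "{c. wait z c \<le> ereal x} = {}"
        using order_trans[OF wait_nonneg[of z], of _ "ereal x"] by auto
      then show ?thesis using False by simp
    qed
    finally show ?thesis .
  qed
  have "m1 = m2"
  proof (rule measure_eqI_generator_eq)
    show "Int_stable (range (atMost :: real \<Rightarrow> _))"
      by (auto simp: Int_stable_def)
    show "range (atMost :: real \<Rightarrow> _) \<subseteq> Pow UNIV" by auto
    show "sets m1 = sigma_sets UNIV (range (atMost :: real \<Rightarrow> _))" "sets m2 = sigma_sets UNIV (range (atMost :: real \<Rightarrow> _))"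
      by (auto simp: m1_def m2_def borel_eq_atMost)
    show "range (\<lambda>n. {..real n}) \<subseteq> range atMost" by auto
    show "(\<Union>n. {..real n}) = UNIV" by (auto simp: real_arch_simple)
    show "emeasure m1 {..real n} \<noteq> \<infinity>" for n by (simp add: m1)
  qed (auto simp: m1 m2)
  have "(\<integral>\<^sup>+c. (if wait z c < \<infinity> then h (real_of_ereal (wait z c)) else 0) \<partial>unit_exponential) = (\<integral>\<^sup>+s. h s \<partial>m1)"
    unfolding m1_def by (subst nn_integral_distr, simp, simp, subst nn_integral_density)
      (auto intro!: nn_integral_cong simp: indicator_def)
  also have "\<dots> = (\<integral>\<^sup>+s. h s \<partial>m2)" by (simp add: \<open>m1 = m2\<close>)
  also have "\<dots> = (\<integral>\<^sup>+s. ennreal (rate (\<phi> s z) * exp (- Lam s z)) * indicator {0..} s * h s \<partial>lborel)"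
    unfolding m2_def by (subst nn_integral_density) auto
  finally show ?thesis .
qed

end

section \<open>Law of the jumps\<close>

text \<open>The dynamics prescribe a conditional probability only on an event such as
  \<open>T n w < \<infinity>\<close>. Testing it with sets \<open>H\<close> of the history inside
  that event gives an identity for measures, free of versions of conditional expectations.\<close>

lemma (in prob_space) emeasure_Int_real_cond_exp:
  assumes F: "subalgebra M F" and A: "A \<in> sets M" and H: "H \<in> sets F"
    and eq: "AE w in M. w \<in> H \<longrightarrow> real_cond_exp M F (indicator A) w = g w"
    and [measurable]: "g \<in> borel_measurable M"
  shows "emeasure M (H \<inter> A) = (\<integral>\<^sup>+w. indicator H w * ennreal (g w) \<partial>M)"
proof -
  interpret finite_measure_subalgebra M F
    by standard (rule F)
  have HM [measurable]: "H \<in> sets M" using F H by (auto simp: subalgebra_def)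
  have int: "integrable M (indicator A :: 'a \<Rightarrow> real)"
    by (rule integrable_real_indicator[OF A]) (simp add: emeasure_eq_measure)
  have int': "integrable M (\<lambda>w. indicator H w * real_cond_exp M F (indicator A) w)"
    using integrable_mult_indicator[OF HM real_cond_exp_int(1)[OF int]] by simp
  have pos: "AE w in M. 0 \<le> real_cond_exp M F (indicator A) w"
    by (rule real_cond_exp_pos) (use A in auto)
  have "measure M (H \<inter> A) = (\<integral>w. indicator H w * indicator A w \<partial>M)"
    using HM A by (simp add: indicator_inter_arith[symmetric])
  also have "\<dots> = (\<integral>w. indicator H w * real_cond_exp M F (indicator A) w \<partial>M)"
    using real_cond_exp_intA[OF int H] by (simp add: set_lebesgue_integral_def)
  finally have "emeasure M (H \<inter> A) = ennreal (\<integral>w. indicator H w * real_cond_exp M F (indicator A) w \<partial>M)"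
    by (simp add: emeasure_eq_measure)
  also have "\<dots> = (\<integral>\<^sup>+w. ennreal (indicator H w * real_cond_exp M F (indicator A) w) \<partial>M)"
    by (rule nn_integral_eq_integral[symmetric, OF int']) (use pos in \<open>auto simp: indicator_def\<close>)
  also have "\<dots> = (\<integral>\<^sup>+w. indicator H w * ennreal (g w) \<partial>M)"
    by (rule nn_integral_cong_AE) (use eq in \<open>auto simp: indicator_def\<close>)
  finally show ?thesis .
qed

text \<open>The open half-lines never contain \<open>- \<infinity>\<close>, so they cannot exhaust
  the extended reals; hence the whole space joins the generator.\<close>

lemma measure_eqI_greaterThan_ereal:
  fixes M1 M2 :: "ereal measure"
  assumes "finite_measure M1" "sets M1 = sets borel" "sets M2 = sets borel"
    and "\<And>x. emeasure M1 {x<..} = emeasure M2 {x<..}" "emeasure M1 UNIV = emeasure M2 UNIV"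
  shows "M1 = M2"
proof (rule measure_eqI_generator_eq)
  show "Int_stable (insert UNIV (range (greaterThan :: ereal \<Rightarrow> _)))"
  proof -
    have "{a<..} \<inter> {b<..} = {max a b<..}" for a b :: ereal by auto
    then show ?thesis by (auto simp: Int_stable_def)
  qed
  show "insert UNIV (range (greaterThan :: ereal \<Rightarrow> _)) \<subseteq> Pow UNIV" by auto
  have "sigma_sets UNIV (insert UNIV (range (greaterThan :: ereal \<Rightarrow> _))) = sigma_sets UNIV (range greaterThan)"
    by (rule sigma_sets_eqI) (auto intro: sigma_sets_top)
  then have "sets (borel :: ereal measure) = sigma_sets UNIV (insert UNIV (range greaterThan))"
    by (simp add: borel_Ioi)
  then show "sets M1 = sigma_sets UNIV (insert UNIV (range greaterThan))"
    "sets M2 = sigma_sets UNIV (insert UNIV (range greaterThan))"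
    using assms by simp_all
  show "range (\<lambda>n::nat. UNIV) \<subseteq> insert UNIV (range (greaterThan :: ereal \<Rightarrow> _))" by auto
  show "(\<Union>n::nat. UNIV) = (UNIV :: ereal set)" by auto
  show "emeasure M1 UNIV \<noteq> \<infinity>" for n :: nat
    using finite_measure.emeasure_finite[OF assms(1)] by simp
qed (use assms in auto)

lemma sets_jump_history:
  "sets (jump_history M E T Y m n) = sigma_sets (space M)
       ({T k -` B \<inter> space M | k B. k \<le> m \<and> B \<in> sets borel} \<union>
        {Y k -` A \<inter> space M | k A. k \<le> n \<and> A \<in> sets E})"
  unfolding jump_history_def by (rule sets_measure_of) auto

lemma space_jump_history [simp]: "space (jump_history M E T Y m n) = space M"
  unfolding jump_history_def by (rule space_measure_of) auto

lemma subalgebra_jump_history: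
  assumes "\<And>n. T n \<in> borel_measurable M" "\<And>n. Y n \<in> M \<rightarrow>\<^sub>M E"
  shows "subalgebra M (jump_history M E T Y m n)"
  unfolding subalgebra_def sets_jump_history
  by (auto intro!: sets.sigma_sets_subset measurable_sets[OF assms(1)] measurable_sets[OF assms(2)])

lemma jump_history_measurable_T:
  "k \<le> m \<Longrightarrow> T k \<in> borel_measurable (jump_history M E T Y m n)"
  by (rule measurableI) (simp, unfold sets_jump_history space_jump_history, rule sigma_sets.Basic, blast)

lemma jump_history_measurable_Y:
  assumes "Y k \<in> M \<rightarrow>\<^sub>M E" "k \<le> n"
  shows "Y k \<in> jump_history M E T Y m n \<rightarrow>\<^sub>M E"
proof (rule measurableI)
  fix A assume "A \<in> sets E"
  then show "Y k -` A \<inter> space (jump_history M E T Y m n) \<in> sets (jump_history M E T Y m n)"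
    unfolding sets_jump_history space_jump_history using assms(2) by (intro sigma_sets.Basic) blast
qed (use measurable_space[OF assms(1)] in simp)

section \<open>Operators of the first-jump expansion\<close>

context pdmp_setup
begin

text \<open>Unnormalised form of the jump kernel, rate times mean after the jump: no quotient
  appears, so states of rate zero need no exception.\<close>

definition jump_op :: "('s \<Rightarrow> ennreal) \<Rightarrow> 's \<Rightarrow> ennreal" where
  "jump_op f z = (\<Sum>i. ennreal (r i z) * f (F i z))"

text \<open>The flow weighted by the probability of no jump up to \<open>t\<close>, a Feynman-Kac
  semigroup.\<close>

definition killed_flow :: "('s \<Rightarrow> ennreal) \<Rightarrow> real \<Rightarrow> 's \<Rightarrow> ennreal" where
  "killed_flow f t z = ennreal (exp (- Lam t z)) * f (\<phi> t z)"

text \<open>Decomposition at a first jump at time \<open>s\<close>, as in Duhamel's formula: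
  \<open>g (t - s)\<close> is the contribution of the rest of the trajectory.\<close>

definition first_jump :: "(real \<Rightarrow> 's \<Rightarrow> ennreal) \<Rightarrow> real \<Rightarrow> 's \<Rightarrow> ennreal" where
  "first_jump g t z =
    (\<integral>\<^sup>+s. indicator {0..t} s * killed_flow (jump_op (g (t - s))) s z \<partial>lborel)"

definition jump_kernel :: "'s \<Rightarrow> 's set \<Rightarrow> real" where
  "jump_kernel z A = (\<Sum>i. r i z / rate z * indicator A (F i z))"

lemma jump_op_measurable:
  assumes "case_prod g \<in> borel_measurable (M \<Otimes>\<^sub>M E)" and [measurable]: "k \<in> M \<rightarrow>\<^sub>M E"
  shows "(\<lambda>x. jump_op (g x) (k x)) \<in> borel_measurable M"
proof -
  have [measurable]: "(\<lambda>x. g x (F i (k x))) \<in> borel_measurable M" for i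
    using measurable_compose[OF _ assms(1), of "\<lambda>x. (x, F i (k x))" M] by simp
  show ?thesis unfolding jump_op_def by measurable
qed

lemma killed_flow_measurable:
  assumes "case_prod g \<in> borel_measurable (M \<Otimes>\<^sub>M E)" and [measurable]: "s \<in> borel_measurable M" "k \<in> M \<rightarrow>\<^sub>M E"
  shows "(\<lambda>x. killed_flow (g x) (s x) (k x)) \<in> borel_measurable M"
proof -
  have [measurable]: "(\<lambda>x. g x (\<phi> (s x) (k x))) \<in> borel_measurable M"
    using measurable_compose[OF _ assms(1), of "\<lambda>x. (x, \<phi> (s x) (k x))" M] by simp
  show ?thesis unfolding killed_flow_def by measurable
qed

lemma first_jump_measurable:
  assumes g: "case_prod g \<in> borel_measurable (borel \<Otimes>\<^sub>M E)"
  shows "case_prod (first_jump g) \<in> borel_measurable (borel \<Otimes>\<^sub>M E)"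
proof -
  have g2: "(\<lambda>x. g (a x) (b x)) \<in> borel_measurable M"
    if "a \<in> borel_measurable M" "b \<in> M \<rightarrow>\<^sub>M E" for a b and M :: "'x measure"
    using measurable_compose[OF measurable_Pair[OF that] g] by simp
  have "(\<lambda>x. killed_flow (jump_op (g (fst (fst x) - snd x))) (snd x) (snd (fst x)))
      \<in> borel_measurable ((borel \<Otimes>\<^sub>M E) \<Otimes>\<^sub>M borel)"
  proof (rule killed_flow_measurable)
    have "(\<lambda>y. jump_op (g (fst (fst (fst y)) - snd (fst y))) (snd y)) \<in> borel_measurable (((borel \<Otimes>\<^sub>M E) \<Otimes>\<^sub>M borel) \<Otimes>\<^sub>M E)"
    proof (rule jump_op_measurable)
      show "(\<lambda>(y, b). g (fst (fst (fst y)) - snd (fst y)) b) \<in> borel_measurable ((((borel \<Otimes>\<^sub>M E) \<Otimes>\<^sub>M borel) \<Otimes>\<^sub>M E) \<Otimes>\<^sub>M E)"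
        unfolding split_beta' by (rule g2) measurable
    qed measurable
    then show "(\<lambda>(x, y). jump_op (g (fst (fst x) - snd x)) y) \<in> borel_measurable (((borel \<Otimes>\<^sub>M E) \<Otimes>\<^sub>M borel) \<Otimes>\<^sub>M E)"
      by (simp add: split_beta')
  qed measurable
  then have "(\<lambda>(p, s). (if 0 \<le> s \<and> s \<le> fst p then 1 else 0) * killed_flow (jump_op (g (fst p - s))) s (snd p))
      \<in> borel_measurable ((borel \<Otimes>\<^sub>M E) \<Otimes>\<^sub>M lborel)"
    unfolding split_beta' by measurable
  then have "(\<lambda>p. \<integral>\<^sup>+s. (if 0 \<le> s \<and> s \<le> fst p then 1 else 0) * killed_flow (jump_op (g (fst p - s))) s (snd p) \<partial>lborel)
      \<in> borel_measurable (borel \<Otimes>\<^sub>M E)"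
    by (rule lborel.borel_measurable_nn_integral)
  also have "(\<lambda>p. \<integral>\<^sup>+s. (if 0 \<le> s \<and> s \<le> fst p then 1 else 0) * killed_flow (jump_op (g (fst p - s))) s (snd p) \<partial>lborel)
    = case_prod (first_jump g)"
    by (auto simp: first_jump_def fun_eq_iff indicator_def intro!: nn_integral_cong)
  finally show ?thesis .
qed

lemma killed_flow_measurable1:
  assumes [measurable]: "f \<in> borel_measurable E"
  shows "case_prod (killed_flow f) \<in> borel_measurable (borel \<Otimes>\<^sub>M E)"
  unfolding split_beta' by (rule killed_flow_measurable) measurable

lemma first_jump_iter_measurable:
  "case_prod g \<in> borel_measurable (borel \<Otimes>\<^sub>M E) \<Longrightarrow>
    case_prod ((first_jump ^^ n) g) \<in> borel_measurable (borel \<Otimes>\<^sub>M E)"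
  by (induction n) (auto intro: first_jump_measurable)

lemma ennreal_jump_kernel:
  assumes z: "z \<in> space E"
  shows "ennreal (jump_kernel z A) = (\<Sum>i. ennreal (r i z / rate z) * indicator A (F i z))"
proof -
  have nonneg: "0 \<le> r i z / rate z" for i
    using rate_nonneg total_rate_nonneg[OF z] by simp
  have "summable (\<lambda>i. r i z / rate z * indicator A (F i z))"
    by (rule summable_comparison_test'[OF summable_divide[OF rate_summable[OF z], of "rate z"], of 0])
      (use nonneg in \<open>auto simp: indicator_def abs_if\<close>)
  then have "ennreal (jump_kernel z A) = (\<Sum>i. ennreal (r i z / rate z * indicator A (F i z)))"
    unfolding jump_kernel_def by (intro suminf_ennreal2[symmetric]) (use nonneg in \<open>auto simp: indicator_def\<close>)
  also have "\<dots> = (\<Sum>i. ennreal (r i z / rate z) * indicator A (F i z))"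
    by (intro suminf_cong) (auto simp: indicator_def)
  finally show ?thesis .
qed

text \<open>At total rate zero every \<open>r i z\<close> vanishes, so the value given to the
  quotient is harmless; otherwise the total rate cancels.\<close>

lemma total_rate_mult_jump:
  assumes z: "z \<in> space E"
  shows "ennreal (rate z) * (\<Sum>i. ennreal (r i z / rate z) * f (F i z)) = jump_op f z"
proof (cases "rate z = 0")
  case True
  have "r i z = 0" for i
    using suminf_eq_zero_iff[OF rate_summable[OF z]] True rate_nonneg by (auto simp: rate_def)
  then show ?thesis by (simp add: True jump_op_def)
next
  case False
  then have pos: "0 < rate z" using total_rate_nonneg[OF z] by simp
  show ?thesis unfolding jump_op_def ennreal_suminf_cmult[symmetric] mult.assoc[symmetric]
    using pos rate_nonneg by (intro suminf_cong) (simp add: ennreal_mult[symmetric])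
qed

end

text \<open>The witnesses \<open>T\<close> and \<open>Y\<close> of
  \<open>follows_jump_dynamics\<close> are fixed for one start \<open>z\<close>. Nothing is assumed
  about how they arise, so the results apply to any realisation of the dynamics.\<close>

locale jump_dynamics = pdmp_setup E \<phi> r F + prob_space M
  for E :: "'s measure" and \<phi> r F and M :: "'w measure" +
  fixes z :: 's and Z :: "real \<Rightarrow> 'w \<Rightarrow> 's" and T :: "nat \<Rightarrow> 'w \<Rightarrow> ereal" and Y :: "nat \<Rightarrow> 'w \<Rightarrow> 's"
  assumes z: "z \<in> space E"
    and Z_measurable: "0 \<le> t \<Longrightarrow> Z t \<in> M \<rightarrow>\<^sub>M E"
    and T_measurable [measurable]: "T n \<in> borel_measurable M"
    and Y_measurable [measurable]: "Y n \<in> M \<rightarrow>\<^sub>M E"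
    and start: "AE w in M. T 0 w = 0 \<and> Y 0 w = z"
    and T_increasing: "AE w in M. \<forall>n. if T n w < \<infinity> then T n w < T (Suc n) w else T (Suc n) w = \<infinity>"
    and T_unbounded: "AE w in M. (\<lambda>n. T n w) \<longlonglongrightarrow> \<infinity>"
    and Z_between: "AE w in M. \<forall>n t. T n w \<le> ereal t \<and> ereal t < T (Suc n) w \<longrightarrow>
           Z t w = \<phi> (t - real_of_ereal (T n w)) (Y n w)"
    and T_law: "0 \<le> t \<Longrightarrow> AE w in M. T n w < \<infinity> \<longrightarrow>
           real_cond_exp M (jump_history M E T Y n n)
             (indicator {w \<in> space M. T (Suc n) w > T n w + ereal t}) w
           = exp (- integral {0..t} (\<lambda>s. rate (\<phi> s (Y n w))))"
    and Y_law: "A \<in> sets E \<Longrightarrow> AE w in M. T (Suc n) w < \<infinity> \<longrightarrow>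
           real_cond_exp M (jump_history M E T Y (Suc n) n)
             (indicator {w \<in> space M. Y (Suc n) w \<in> A}) w
           = jump_kernel (\<phi> (real_of_ereal (T (Suc n) w) - real_of_ereal (T n w)) (Y n w)) A"
begin

lemma T_nonneg: "AE w in M. \<forall>n. 0 \<le> T n w"
  using start T_increasing
proof eventually_elim
  case (elim w)
  show ?case
  proof
    fix n show "0 \<le> T n w"
    proof (induction n)
      case (Suc n)
      then show ?case using elim(2)[rule_format, of n] by (auto split: if_splits)
    qed (use elim in simp)
  qed
qed

text \<open>The conditional survival function determines the joint law of the present
  \<open>(T n, Y n)\<close> and the holding time, so the latter may be replaced by
  \<open>wait\<close> of a fresh exponential clock. Separating events \<open>A\<close> of the
  present from values of the holding time reduces this to half-lines.\<close>

lemma wait_law: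
  assumes h: "h \<in> borel_measurable ((borel \<Otimes>\<^sub>M E) \<Otimes>\<^sub>M borel)"
  shows "(\<integral>\<^sup>+w. (if T n w < \<infinity> then h ((real_of_ereal (T n w), Y n w), T (Suc n) w - T n w) else 0) \<partial>M)
    = (\<integral>\<^sup>+w. (if T n w < \<infinity> then \<integral>\<^sup>+c. h ((real_of_ereal (T n w), Y n w), wait (Y n w) c) \<partial>unit_exponential else 0) \<partial>M)"
proof -
  interpret X: prob_space unit_exponential by (rule prob_space_unit_exponential)
  note h [measurable]
  \<comment> \<open>Restriction to an event \<open>A\<close> of the present turns the conditional
    statement into an equality of two finite measures on the holding times, \<open>D1 A\<close> and
    \<open>D2 A\<close>.\<close>
  define M' where "M' A = density M (indicator {w \<in> space M. T n w < \<infinity> \<and> (real_of_ereal (T n w), Y n w) \<in> A})" for A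
  have sets_M' [measurable_cong, simp]: "sets (M' A) = sets M" for A by (simp add: M'_def)
  have space_M' [simp]: "space (M' A) = space M" for A by (simp add: M'_def)
  have H [measurable]: "{w \<in> space M. T n w < \<infinity> \<and> (real_of_ereal (T n w), Y n w) \<in> A} \<in> sets M"
    if [measurable]: "A \<in> sets (borel \<Otimes>\<^sub>M E)" for A
    by measurable
  have fin: "finite_measure (M' A)" if "A \<in> sets (borel \<Otimes>\<^sub>M E)" for A
    unfolding M'_def by (rule finite_measure_restricted) (use H[OF that] in simp)
  define D1 where "D1 A = distr (M' A) borel (\<lambda>w. T (Suc n) w - T n w)" for A
  define D2 where "D2 A = distr (M' A \<Otimes>\<^sub>M unit_exponential) borel (\<lambda>(w, c). wait (Y n w) c)" for A
  have D2: "emeasure (D2 A) B = (\<integral>\<^sup>+w. indicator {w \<in> space M. T n w < \<infinity> \<and> (real_of_ereal (T n w), Y n w) \<in> A} w *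
      emeasure unit_exponential {c. wait (Y n w) c \<in> B} \<partial>M)"
    if A [measurable]: "A \<in> sets (borel \<Otimes>\<^sub>M E)" and [measurable]: "B \<in> sets borel" for A B
  proof -
    have [measurable]: "(\<lambda>(w, c). wait (Y n w) c) -` B \<inter> space (M \<Otimes>\<^sub>M unit_exponential) \<in> sets (M \<Otimes>\<^sub>M unit_exponential)"
      by (rule measurable_sets[where A = borel]) measurable
    have "emeasure (D2 A) B = emeasure (M' A \<Otimes>\<^sub>M unit_exponential) ((\<lambda>(w, c). wait (Y n w) c) -` B \<inter> space (M' A \<Otimes>\<^sub>M unit_exponential))"
      unfolding D2_def by (rule emeasure_distr) measurable
    also have "\<dots> = (\<integral>\<^sup>+w. emeasure unit_exponential (Pair w -` ((\<lambda>(w, c). wait (Y n w) c) -` B \<inter> space (M' A \<Otimes>\<^sub>M unit_exponential))) \<partial>M' A)"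
      by (rule X.emeasure_pair_measure_alt) (simp add: space_pair_measure sets_pair_measure_cong[OF sets_M' refl])
    also have "\<dots> = (\<integral>\<^sup>+w. emeasure unit_exponential {c. wait (Y n w) c \<in> B} \<partial>M' A)"
      by (intro nn_integral_cong arg_cong2[where f = emeasure]) (auto simp: space_pair_measure)
    also have "\<dots> = (\<integral>\<^sup>+w. indicator {w \<in> space M. T n w < \<infinity> \<and> (real_of_ereal (T n w), Y n w) \<in> A} w *
      emeasure unit_exponential {c. wait (Y n w) c \<in> B} \<partial>M)"
      unfolding M'_def
    proof (rule nn_integral_density)
      have "(\<lambda>w. emeasure unit_exponential (Pair w -` ((\<lambda>(w, c). wait (Y n w) c) -` B \<inter> space (M \<Otimes>\<^sub>M unit_exponential)))) \<in> borel_measurable M"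
        by (rule X.measurable_emeasure_Pair) measurable
      then show "(\<lambda>w. emeasure unit_exponential {c. wait (Y n w) c \<in> B}) \<in> borel_measurable M"
        by (rule measurable_cong[THEN iffD1, rotated]) (auto simp: space_pair_measure intro!: arg_cong2[where f = emeasure])
    qed measurable
    finally show ?thesis .
  qed
  have D1: "emeasure (D1 A) B = emeasure M ({w \<in> space M. T n w < \<infinity> \<and> (real_of_ereal (T n w), Y n w) \<in> A} \<inter> {w \<in> space M. T (Suc n) w - T n w \<in> B})"
    if A [measurable]: "A \<in> sets (borel \<Otimes>\<^sub>M E)" and [measurable]: "B \<in> sets borel" for A B
  proof -
    have "emeasure (D1 A) B = emeasure (M' A) {w \<in> space M. T (Suc n) w - T n w \<in> B}"
      unfolding D1_def by (subst emeasure_distr) (auto intro!: arg_cong2[where f = emeasure])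
    then show ?thesis
      unfolding M'_def by (subst (asm) emeasure_restricted) auto
  qed
  have D_eq: "D1 A = D2 A" if A [measurable]: "A \<in> sets (borel \<Otimes>\<^sub>M E)" for A
  proof (rule measure_eqI_greaterThan_ereal)
    let ?H = "{w \<in> space M. T n w < \<infinity> \<and> (real_of_ereal (T n w), Y n w) \<in> A}"
    show "finite_measure (D1 A)"
      unfolding D1_def by (rule finite_measure.finite_measure_distr[OF fin[OF A]]) measurable
    show "sets (D1 A) = sets borel" "sets (D2 A) = sets borel" by (simp_all add: D1_def D2_def)
    show tot: "emeasure (D1 A) UNIV = emeasure (D2 A) UNIV"
      using X.emeasure_space_1 by (simp add: D1 D2 Int_absorb2 subset_eq)
    have HF: "?H \<in> sets (jump_history M E T Y n n)"
    proof -
      have [measurable]: "T n \<in> borel_measurable (jump_history M E T Y n n)" "Y n \<in> jump_history M E T Y n n \<rightarrow>\<^sub>M E"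
        by (auto intro!: jump_history_measurable_T jump_history_measurable_Y Y_measurable)
      have "{w \<in> space (jump_history M E T Y n n). T n w < \<infinity> \<and> (real_of_ereal (T n w), Y n w) \<in> A} \<in> sets (jump_history M E T Y n n)"
        by measurable
      then show ?thesis by simp
    qed
    fix x :: ereal
    have Ioi: "{x<..} \<in> sets borel" by simp
    \<comment> \<open>Only nonnegative real thresholds use the conditional law: holding times are
      never negative, and nothing exceeds \<open>\<infinity>\<close>.\<close>
    consider "x < 0" | "x = \<infinity>" | t where "x = ereal t" "0 \<le> t"
    proof (cases x)
      case (real t)
      then show ?thesis using that(1) that(3)[of t] by (cases "t < 0") auto
    qed auto
    then show "emeasure (D1 A) {x<..} = emeasure (D2 A) {x<..}"
    proof cases
      case 1
      have "emeasure (D1 A) {x<..} = emeasure M ?H"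
        unfolding D1[OF A Ioi]
      proof (rule emeasure_eq_AE)
        show "AE w in M. (w \<in> ?H \<inter> {w \<in> space M. T (Suc n) w - T n w \<in> {x<..}}) = (w \<in> ?H)"
          using T_increasing T_nonneg
        proof eventually_elim
          case (elim w)
          have "x < T (Suc n) w - T n w" if "T n w < \<infinity>"
            using elim(1)[rule_format, of n] elim(2)[rule_format, of n] that 1
            by (intro less_le_trans[OF 1]) (cases "T n w"; cases "T (Suc n) w"; auto)
          then show ?case by auto
        qed
      qed measurable
      moreover have "{c. wait (Y n w) c \<in> {x<..}} = UNIV" for w
        using less_le_trans[OF 1 wait_nonneg] by auto
      ultimately show ?thesis
        using X.emeasure_space_1 by (simp add: D2)
    next
      case 2
      then have "{x<..} = {}" by auto
      then show ?thesis by simp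
    next
      case (3 t)
      have "emeasure (D1 A) {x<..} = emeasure M (?H \<inter> {w \<in> space M. T (Suc n) w > T n w + ereal t})"
        unfolding D1[OF A Ioi]
      proof (rule emeasure_eq_AE)
        show "AE w in M. (w \<in> ?H \<inter> {w \<in> space M. T (Suc n) w - T n w \<in> {x<..}})
            = (w \<in> ?H \<inter> {w \<in> space M. T (Suc n) w > T n w + ereal t})"
          using T_nonneg
        proof eventually_elim
          case (elim w)
          have "x < T (Suc n) w - T n w \<longleftrightarrow> T (Suc n) w > T n w + ereal t" if "T n w < \<infinity>"
            using elim[rule_format, of n] that 3 by (cases "T n w"; cases "T (Suc n) w"; auto)
          then show ?case by auto
        qed
      qed measurable
      also have "\<dots> = (\<integral>\<^sup>+w. indicator ?H w * ennreal (exp (- Lam t (Y n w))) \<partial>M)"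
      proof (rule emeasure_Int_real_cond_exp[OF subalgebra_jump_history[OF T_measurable Y_measurable] _ HF])
        show "AE w in M. w \<in> ?H \<longrightarrow> real_cond_exp M (jump_history M E T Y n n)
            (indicator {w \<in> space M. T (Suc n) w > T n w + ereal t}) w = exp (- Lam t (Y n w))"
          using T_law[OF 3(2), of n] by (auto simp: Lam_def)
      qed measurable
      also have "\<dots> = emeasure (D2 A) {x<..}"
        unfolding D2[OF A Ioi]
      proof (rule nn_integral_cong)
        fix w assume "w \<in> space M"
        then have "Y n w \<in> space E" by (rule measurable_space[OF Y_measurable])
        then show "indicator ?H w * ennreal (exp (- Lam t (Y n w))) = indicator ?H w * emeasure unit_exponential {c. wait (Y n w) c \<in> {x<..}}"
          using emeasure_less_wait[of "Y n w" t] 3 by simp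
      qed
      finally show ?thesis .
    qed
  qed
  let ?N = "(borel \<Otimes>\<^sub>M E) \<Otimes>\<^sub>M (borel :: ereal measure)"
  \<comment> \<open>\<open>D1 A\<close> and \<open>D2 A\<close> are slices of two joint laws, which
    therefore agree on rectangles and hence everywhere.\<close>
  define M0 where "M0 = density M (indicator {w \<in> space M. T n w < \<infinity>})"
  have sets_M0 [measurable_cong, simp]: "sets M0 = sets M" by (simp add: M0_def)
  have space_M0 [simp]: "space M0 = space M" by (simp add: M0_def)
  have finM0: "finite_measure M0"
    unfolding M0_def by (rule finite_measure_restricted) measurable
  interpret M0: finite_measure M0 by fact
  interpret M0X: pair_sigma_finite M0 unit_exponential ..
  define m1 where "m1 = distr M0 ?N (\<lambda>w. ((real_of_ereal (T n w), Y n w), T (Suc n) w - T n w))"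
  define m2 where "m2 = distr (M0 \<Otimes>\<^sub>M unit_exponential) ?N (\<lambda>(w, c). ((real_of_ereal (T n w), Y n w), wait (Y n w) c))"
  have "m1 = m2"
  proof (rule measure_eqI_rectangles)
    show "finite_measure m1"
      unfolding m1_def by (rule finite_measure.finite_measure_distr[OF finM0]) measurable
    show "sets m1 = sets ?N" "sets m2 = sets ?N" by (simp_all add: m1_def m2_def)
    fix A :: "(real \<times> 's) set" and B :: "ereal set" assume A [measurable]: "A \<in> sets (borel \<Otimes>\<^sub>M E)" and B [measurable]: "B \<in> sets borel"
    have "emeasure m1 (A \<times> B) = emeasure M0 {w \<in> space M. (real_of_ereal (T n w), Y n w) \<in> A \<and> T (Suc n) w - T n w \<in> B}"
      unfolding m1_def by (subst emeasure_distr) (auto intro!: arg_cong2[where f = emeasure])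
    also have "\<dots> = emeasure (D1 A) B"
      unfolding M0_def D1[OF A B] by (subst emeasure_restricted) (auto intro!: arg_cong2[where f = emeasure])
    also have "\<dots> = emeasure (D2 A) B" by (simp add: D_eq)
    also have "\<dots> = emeasure m2 (A \<times> B)"
    proof -
      have "(\<lambda>(w, c). ((real_of_ereal (T n w), Y n w), wait (Y n w) c)) -` (A \<times> B) \<inter> space (M \<Otimes>\<^sub>M unit_exponential) \<in> sets (M \<Otimes>\<^sub>M unit_exponential)"
        by (rule measurable_sets[where A = ?N]) measurable
      have "emeasure m2 (A \<times> B) = emeasure (M0 \<Otimes>\<^sub>M unit_exponential) ((\<lambda>(w, c). ((real_of_ereal (T n w), Y n w), wait (Y n w) c)) -` (A \<times> B) \<inter> space (M0 \<Otimes>\<^sub>M unit_exponential))"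
        unfolding m2_def by (rule emeasure_distr) measurable
      also have "\<dots> = (\<integral>\<^sup>+w. emeasure unit_exponential (Pair w -` ((\<lambda>(w, c). ((real_of_ereal (T n w), Y n w), wait (Y n w) c)) -` (A \<times> B) \<inter> space (M0 \<Otimes>\<^sub>M unit_exponential))) \<partial>M0)"
        by (rule X.emeasure_pair_measure_alt) (simp add: space_pair_measure sets_pair_measure_cong[OF sets_M0 refl])
      also have "\<dots> = (\<integral>\<^sup>+w. indicator {w \<in> space M. T n w < \<infinity>} w * emeasure unit_exponential (Pair w -` ((\<lambda>(w, c). ((real_of_ereal (T n w), Y n w), wait (Y n w) c)) -` (A \<times> B) \<inter> space (M \<Otimes>\<^sub>M unit_exponential))) \<partial>M)"
      proof -
        have sp: "space (M0 \<Otimes>\<^sub>M unit_exponential) = space (M \<Otimes>\<^sub>M unit_exponential)"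
          by (simp add: space_pair_measure)
        show ?thesis
          unfolding sp unfolding M0_def
        proof (rule nn_integral_density)
          show "(\<lambda>w. emeasure unit_exponential (Pair w -` ((\<lambda>(w, c). ((real_of_ereal (T n w), Y n w), wait (Y n w) c)) -` (A \<times> B) \<inter> space (M \<Otimes>\<^sub>M unit_exponential)))) \<in> borel_measurable M"
            by (rule X.measurable_emeasure_Pair) fact
        qed measurable
      qed
      also have "\<dots> = emeasure (D2 A) B"
        unfolding D2[OF A B]
      proof (rule nn_integral_cong)
        fix w assume w: "w \<in> space M"
        have "Pair w -` ((\<lambda>(w, c). ((real_of_ereal (T n w), Y n w), wait (Y n w) c)) -` (A \<times> B) \<inter> space (M \<Otimes>\<^sub>M unit_exponential))
            = (if (real_of_ereal (T n w), Y n w) \<in> A then {c. wait (Y n w) c \<in> B} else {})"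
          using w by (auto simp: space_pair_measure)
        then show "indicator {w \<in> space M. T n w < \<infinity>} w * emeasure unit_exponential (Pair w -` ((\<lambda>(w, c). ((real_of_ereal (T n w), Y n w), wait (Y n w) c)) -` (A \<times> B) \<inter> space (M \<Otimes>\<^sub>M unit_exponential)))
          = indicator {w \<in> space M. T n w < \<infinity> \<and> (real_of_ereal (T n w), Y n w) \<in> A} w * emeasure unit_exponential {c. wait (Y n w) c \<in> B}"
          by (simp add: indicator_def)
      qed
      finally show ?thesis by simp
    qed
    finally show "emeasure m1 (A \<times> B) = emeasure m2 (A \<times> B)" .
  qed
  have "(\<integral>\<^sup>+w. (if T n w < \<infinity> then h ((real_of_ereal (T n w), Y n w), T (Suc n) w - T n w) else 0) \<partial>M) = (\<integral>\<^sup>+x. h x \<partial>m1)"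
    unfolding m1_def by (subst nn_integral_distr, measurable, unfold M0_def, subst nn_integral_density)
      (auto intro!: nn_integral_cong simp: indicator_def)
  also have "\<dots> = (\<integral>\<^sup>+x. h x \<partial>m2)" by (simp add: \<open>m1 = m2\<close>)
  also have "\<dots> = (\<integral>\<^sup>+x. h ((real_of_ereal (T n (fst x)), Y n (fst x)), wait (Y n (fst x)) (snd x)) \<partial>(M0 \<Otimes>\<^sub>M unit_exponential))"
    unfolding m2_def by (subst nn_integral_distr) (auto simp: split_beta')
  also have "\<dots> = (\<integral>\<^sup>+w. \<integral>\<^sup>+c. h ((real_of_ereal (T n w), Y n w), wait (Y n w) c) \<partial>unit_exponential \<partial>M0)"
    by (subst X.nn_integral_fst[symmetric]) auto
  also have "\<dots> = (\<integral>\<^sup>+w. (if T n w < \<infinity> then \<integral>\<^sup>+c. h ((real_of_ereal (T n w), Y n w), wait (Y n w) c) \<partial>unit_exponential else 0) \<partial>M)"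
    unfolding M0_def by (subst nn_integral_density)
      (auto intro!: nn_integral_cong X.borel_measurable_nn_integral simp: indicator_def)
  finally show ?thesis .
qed

text \<open>The kernel is prescribed set by set; on rectangles of jump time and new state this
  identifies two joint laws. So under any test function \<open>g\<close> the new state may be
  replaced by \<open>F i\<close> of the state before the jump, averaged with the weights
  \<open>r i / rate\<close>.\<close>

lemma jump_law:
  assumes g: "g \<in> borel_measurable (borel \<Otimes>\<^sub>M E)"
  shows "(\<integral>\<^sup>+w. (if T (Suc n) w < \<infinity> then g (real_of_ereal (T (Suc n) w), Y (Suc n) w) else 0) \<partial>M)
    = (\<integral>\<^sup>+w. (if T (Suc n) w < \<infinity> then
        (\<Sum>i. ennreal (r i (\<phi> (real_of_ereal (T (Suc n) w) - real_of_ereal (T n w)) (Y n w))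
            / rate (\<phi> (real_of_ereal (T (Suc n) w) - real_of_ereal (T n w)) (Y n w)))
          * g (real_of_ereal (T (Suc n) w), F i (\<phi> (real_of_ereal (T (Suc n) w) - real_of_ereal (T n w)) (Y n w)))) else 0) \<partial>M)"
proof -
  note g [measurable]
  define X where "X w = \<phi> (real_of_ereal (T (Suc n) w) - real_of_ereal (T n w)) (Y n w)" for w
  have X [measurable]: "X \<in> M \<rightarrow>\<^sub>M E" unfolding X_def by measurable
  have XE: "X w \<in> space E" if "w \<in> space M" for w
    using measurable_space[OF X that] .
  define H where "H = {w \<in> space M. T (Suc n) w < \<infinity>}"
  have [measurable]: "H \<in> sets M" unfolding H_def by measurable
  have HI: "(if T (Suc n) w < \<infinity> then a else 0) = indicator H w * a" if "w \<in> space M" for w and a :: ennreal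
    using that by (auto simp: H_def)
  define m1 where "m1 = distr (density M (indicator H)) (borel \<Otimes>\<^sub>M E) (\<lambda>w. (real_of_ereal (T (Suc n) w), Y (Suc n) w))"
  have fin: "finite_measure (density M (indicator H))"
    by (rule finite_measure_restricted) measurable
  \<comment> \<open>The sum over jump types becomes an integral over counting measure, which makes
    the right side the integral against the law \<open>m2\<close> of a single measurable
    map.\<close>
  let ?C = "count_space (UNIV :: nat set)"
  interpret C: sigma_finite_measure ?C by (rule sigma_finite_measure_count_space)
  define D where "D = density (M \<Otimes>\<^sub>M ?C) (\<lambda>(w, i). indicator H w * ennreal (r i (X w) / rate (X w)))"
  define m2 where "m2 = distr D (borel \<Otimes>\<^sub>M E) (\<lambda>(w, i). (real_of_ereal (T (Suc n) w), F i (X w)))"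
  have m [measurable]: "(\<lambda>x. r (snd x) (X (fst x))) \<in> borel_measurable (M \<Otimes>\<^sub>M ?C)"
    "(\<lambda>x. F (snd x) (X (fst x))) \<in> M \<Otimes>\<^sub>M ?C \<rightarrow>\<^sub>M E"
    by (rule measurable_compose_countable'[where I = UNIV and g = snd]; measurable)+
  have m2: "(\<integral>\<^sup>+x. f x \<partial>m2) = (\<integral>\<^sup>+w. indicator H w * (\<Sum>i. ennreal (r i (X w) / rate (X w)) * f (real_of_ereal (T (Suc n) w), F i (X w))) \<partial>M)"
    if [measurable]: "f \<in> borel_measurable (borel \<Otimes>\<^sub>M E)" for f
  proof -
    have "(\<integral>\<^sup>+x. f x \<partial>m2) = (\<integral>\<^sup>+x. f (real_of_ereal (T (Suc n) (fst x)), F (snd x) (X (fst x))) \<partial>D)"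
      unfolding m2_def split_beta' by (rule nn_integral_distr) (simp_all add: D_def)
    also have "\<dots> = (\<integral>\<^sup>+x. (indicator H (fst x) * ennreal (r (snd x) (X (fst x)) / rate (X (fst x)))) * f (real_of_ereal (T (Suc n) (fst x)), F (snd x) (X (fst x))) \<partial>(M \<Otimes>\<^sub>M ?C))"
      unfolding D_def split_beta' by (rule nn_integral_density) measurable
    also have "\<dots> = (\<integral>\<^sup>+w. \<integral>\<^sup>+i. (indicator H w * ennreal (r i (X w) / rate (X w))) * f (real_of_ereal (T (Suc n) w), F i (X w)) \<partial>?C \<partial>M)"
      by (subst C.nn_integral_fst[symmetric]) auto
    also have "\<dots> = (\<integral>\<^sup>+w. indicator H w * (\<Sum>i. ennreal (r i (X w) / rate (X w)) * f (real_of_ereal (T (Suc n) w), F i (X w))) \<partial>M)"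
      by (simp add: nn_integral_count_space_nat mult.assoc ennreal_suminf_cmult)
    finally show ?thesis .
  qed
  have "m1 = m2"
  proof (rule measure_eqI_rectangles)
    show "finite_measure m1"
      unfolding m1_def by (rule finite_measure.finite_measure_distr[OF fin]) measurable
    show "sets m1 = sets (borel \<Otimes>\<^sub>M E)" "sets m2 = sets (borel \<Otimes>\<^sub>M E)" by (simp_all add: m1_def m2_def)
    fix A :: "real set" and B assume A [measurable]: "A \<in> sets borel" and B [measurable]: "B \<in> sets E"
    let ?H = "{w \<in> space M. T (Suc n) w < \<infinity> \<and> real_of_ereal (T (Suc n) w) \<in> A}"
    have HF: "?H \<in> sets (jump_history M E T Y (Suc n) n)"
    proof -
      have [measurable]: "T (Suc n) \<in> borel_measurable (jump_history M E T Y (Suc n) n)"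
        by (rule jump_history_measurable_T) simp
      have "{w \<in> space (jump_history M E T Y (Suc n) n). T (Suc n) w < \<infinity> \<and> real_of_ereal (T (Suc n) w) \<in> A}
          \<in> sets (jump_history M E T Y (Suc n) n)"
        by measurable
      then show ?thesis by simp
    qed
    have kern: "ennreal (jump_kernel (X w) B) = (\<Sum>i. ennreal (r i (X w) / rate (X w)) * indicator B (F i (X w)))"
      if "w \<in> space M" for w
      by (rule ennreal_jump_kernel) (rule XE[OF that])
    have "emeasure m1 (A \<times> B) = emeasure (density M (indicator H)) {w \<in> space M. real_of_ereal (T (Suc n) w) \<in> A \<and> Y (Suc n) w \<in> B}"
      unfolding m1_def by (subst emeasure_distr) (auto intro!: arg_cong2[where f = emeasure])
    also have "\<dots> = emeasure M (?H \<inter> {w \<in> space M. Y (Suc n) w \<in> B})"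
      by (subst emeasure_restricted) (auto simp: H_def intro!: arg_cong2[where f = emeasure])
    also have "\<dots> = (\<integral>\<^sup>+w. indicator ?H w * ennreal (jump_kernel (X w) B) \<partial>M)"
    proof (rule emeasure_Int_real_cond_exp[OF subalgebra_jump_history[OF T_measurable Y_measurable] _ HF])
      show "AE w in M. w \<in> ?H \<longrightarrow> real_cond_exp M (jump_history M E T Y (Suc n) n)
            (indicator {w \<in> space M. Y (Suc n) w \<in> B}) w = jump_kernel (X w) B"
        using Y_law[OF B, of n] by (auto simp: X_def)
      show "(\<lambda>w. jump_kernel (X w) B) \<in> borel_measurable M"
        unfolding jump_kernel_def by measurable
    qed measurable
    also have "\<dots> = (\<integral>\<^sup>+w. indicator H w * (\<Sum>i. ennreal (r i (X w) / rate (X w)) * indicator (A \<times> B) (real_of_ereal (T (Suc n) w), F i (X w))) \<partial>M)"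
      by (intro nn_integral_cong) (auto simp: kern H_def indicator_def)
    also have "\<dots> = emeasure m2 (A \<times> B)"
      using m2[of "indicator (A \<times> B)"] by (simp add: m2_def)
    finally show "emeasure m1 (A \<times> B) = emeasure m2 (A \<times> B)" .
  qed
  have "(\<integral>\<^sup>+w. (if T (Suc n) w < \<infinity> then g (real_of_ereal (T (Suc n) w), Y (Suc n) w) else 0) \<partial>M) = (\<integral>\<^sup>+x. g x \<partial>m1)"
    unfolding m1_def by (subst nn_integral_distr, measurable, subst nn_integral_density)
      (auto intro!: nn_integral_cong simp: indicator_def H_def)
  also have "\<dots> = (\<integral>\<^sup>+x. g x \<partial>m2)" by (simp add: \<open>m1 = m2\<close>)
  also have "\<dots> = (\<integral>\<^sup>+w. (if T (Suc n) w < \<infinity> then (\<Sum>i. ennreal (r i (X w) / rate (X w)) * g (real_of_ereal (T (Suc n) w), F i (X w))) else 0) \<partial>M)"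
    unfolding m2[OF g] by (intro nn_integral_cong) (simp add: H_def indicator_def)
  finally show ?thesis unfolding X_def .
qed

text \<open>The waiting density contributes the factor \<open>rate\<close> and the kernel the
  quotient \<open>r i / rate\<close>; together they form \<open>jump_op\<close>, and the survival
  factor turns it into a \<open>killed_flow\<close>.\<close>

lemma next_jump_law:
  assumes g: "g \<in> borel_measurable (borel \<Otimes>\<^sub>M E)"
  shows "(\<integral>\<^sup>+w. (if T (Suc n) w < \<infinity> then g (real_of_ereal (T (Suc n) w), Y (Suc n) w) else 0) \<partial>M)
    = (\<integral>\<^sup>+w. (if T n w < \<infinity> then
        \<integral>\<^sup>+s. indicator {0..} s * killed_flow (jump_op (\<lambda>y. g (real_of_ereal (T n w) + s, y))) s (Y n w) \<partial>lborel else 0) \<partial>M)"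
proof -
  note g [measurable]
  define q where "q a y = (\<Sum>i. ennreal (r i y / rate y) * g (a, F i y))" for a y
  have q [measurable]: "(\<lambda>x. q (a x) (b x)) \<in> borel_measurable N"
    if [measurable]: "a \<in> borel_measurable N" "b \<in> N \<rightarrow>\<^sub>M E" for a b and N :: "'x measure"
    unfolding q_def by measurable
  \<comment> \<open>An infinite holding time means that the next jump does not happen, so it gets
    the value \<open>0\<close>.\<close>
  define h where "h x = (if snd x < \<infinity> then q (fst (fst x) + real_of_ereal (snd x)) (\<phi> (real_of_ereal (snd x)) (snd (fst x))) else 0)"
    for x :: "(real \<times> 's) \<times> ereal"
  have h: "h \<in> borel_measurable ((borel \<Otimes>\<^sub>M E) \<Otimes>\<^sub>M borel)"
    unfolding h_def by measurable
  have "(\<integral>\<^sup>+w. (if T (Suc n) w < \<infinity> then g (real_of_ereal (T (Suc n) w), Y (Suc n) w) else 0) \<partial>M)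
    = (\<integral>\<^sup>+w. (if T (Suc n) w < \<infinity> then q (real_of_ereal (T (Suc n) w)) (\<phi> (real_of_ereal (T (Suc n) w) - real_of_ereal (T n w)) (Y n w)) else 0) \<partial>M)"
    unfolding jump_law[OF g] q_def ..
  also have "\<dots> = (\<integral>\<^sup>+w. (if T n w < \<infinity> then h ((real_of_ereal (T n w), Y n w), T (Suc n) w - T n w) else 0) \<partial>M)"
  proof (rule nn_integral_cong_AE)
    show "AE w in M. (if T (Suc n) w < \<infinity> then q (real_of_ereal (T (Suc n) w)) (\<phi> (real_of_ereal (T (Suc n) w) - real_of_ereal (T n w)) (Y n w)) else 0)
      = (if T n w < \<infinity> then h ((real_of_ereal (T n w), Y n w), T (Suc n) w - T n w) else 0)"
      using T_nonneg T_increasing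
    proof eventually_elim
      case (elim w)
      show ?case
        using elim(1)[rule_format, of n] elim(2)[rule_format, of n]
        by (cases "T n w"; cases "T (Suc n) w") (auto simp: h_def)
    qed
  qed
  also have "\<dots> = (\<integral>\<^sup>+w. (if T n w < \<infinity> then \<integral>\<^sup>+c. h ((real_of_ereal (T n w), Y n w), wait (Y n w) c) \<partial>unit_exponential else 0) \<partial>M)"
    by (rule wait_law[OF h])
  also have "\<dots> = (\<integral>\<^sup>+w. (if T n w < \<infinity> then
        \<integral>\<^sup>+s. indicator {0..} s * killed_flow (jump_op (\<lambda>y. g (real_of_ereal (T n w) + s, y))) s (Y n w) \<partial>lborel else 0) \<partial>M)"
  proof (intro nn_integral_cong if_cong refl)
    fix w assume "w \<in> space M"
    then have Yw: "Y n w \<in> space E" by (rule measurable_space[OF Y_measurable])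
    have "(\<integral>\<^sup>+c. h ((real_of_ereal (T n w), Y n w), wait (Y n w) c) \<partial>unit_exponential)
      = (\<integral>\<^sup>+c. (if wait (Y n w) c < \<infinity> then q (real_of_ereal (T n w) + real_of_ereal (wait (Y n w) c)) (\<phi> (real_of_ereal (wait (Y n w) c)) (Y n w)) else 0) \<partial>unit_exponential)"
      by (intro nn_integral_cong) (auto simp: h_def)
    also have "\<dots> = (\<integral>\<^sup>+s. ennreal (rate (\<phi> s (Y n w)) * exp (- Lam s (Y n w))) * indicator {0..} s * q (real_of_ereal (T n w) + s) (\<phi> s (Y n w)) \<partial>lborel)"
      using Yw by (intro nn_integral_wait) measurable
    also have "\<dots> = (\<integral>\<^sup>+s. indicator {0..} s * killed_flow (jump_op (\<lambda>y. g (real_of_ereal (T n w) + s, y))) s (Y n w) \<partial>lborel)"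
    proof (intro nn_integral_cong)
      fix s
      have E: "\<phi> s (Y n w) \<in> space E" using Yw by simp
      have "ennreal (rate (\<phi> s (Y n w)) * exp (- Lam s (Y n w))) = ennreal (exp (- Lam s (Y n w))) * ennreal (rate (\<phi> s (Y n w)))"
        using total_rate_nonneg[OF E] by (simp add: ennreal_mult mult.commute)
      then show "ennreal (rate (\<phi> s (Y n w)) * exp (- Lam s (Y n w))) * indicator {0..} s * q (real_of_ereal (T n w) + s) (\<phi> s (Y n w))
        = indicator {0..} s * killed_flow (jump_op (\<lambda>y. g (real_of_ereal (T n w) + s, y))) s (Y n w)"
        unfolding killed_flow_def total_rate_mult_jump[OF E, symmetric] q_def by (simp add: ac_simps)
    qed
    finally show "(\<integral>\<^sup>+c. h ((real_of_ereal (T n w), Y n w), wait (Y n w) c) \<partial>unit_exponential)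
      = (\<integral>\<^sup>+s. indicator {0..} s * killed_flow (jump_op (\<lambda>y. g (real_of_ereal (T n w) + s, y))) s (Y n w) \<partial>lborel)" .
  qed
  finally show ?thesis .
qed

text \<open>Each use of \<open>next_jump_law\<close> removes the last jump and replaces
  \<open>g\<close> by \<open>first_jump g\<close>; the induction therefore keeps \<open>g\<close>
  arbitrary and moves the extra factor through the iterate at the end.\<close>

lemma nth_jump_law:
  assumes g: "case_prod g \<in> borel_measurable (borel \<Otimes>\<^sub>M E)" and t: "0 \<le> t"
  shows "(\<integral>\<^sup>+w. (if T n w \<le> ereal t then g (t - real_of_ereal (T n w)) (Y n w) else 0) \<partial>M)
    = (first_jump ^^ n) g t z"
  using g
proof (induction n arbitrary: g)
  case 0
  have "(\<integral>\<^sup>+w. (if T 0 w \<le> ereal t then g (t - real_of_ereal (T 0 w)) (Y 0 w) else 0) \<partial>M) = (\<integral>\<^sup>+w. g t z \<partial>M)"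
  proof (rule nn_integral_cong_AE)
    show "AE w in M. (if T 0 w \<le> ereal t then g (t - real_of_ereal (T 0 w)) (Y 0 w) else 0) = g t z"
      using start by eventually_elim (use t in simp)
  qed
  then show ?case by (simp add: emeasure_space_1)
next
  case (Suc n)
  note g = Suc.prems
  \<comment> \<open>\<open>next_jump_law\<close> works in absolute time whereas \<open>g\<close>
    takes the remaining time; the cut-off discards jumps after \<open>t\<close>.\<close>
  define g' where "g' x = (if fst x \<le> t then g (t - fst x) (snd x) else 0)" for x
  have "(\<lambda>x. g (t - fst x) (snd x)) \<in> borel_measurable (borel \<Otimes>\<^sub>M E)"
    using measurable_compose[OF _ g, of "\<lambda>x. (t - fst x, snd x)"] by simp
  then have g': "g' \<in> borel_measurable (borel \<Otimes>\<^sub>M E)"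
    unfolding g'_def by measurable
  have "(\<integral>\<^sup>+w. (if T (Suc n) w \<le> ereal t then g (t - real_of_ereal (T (Suc n) w)) (Y (Suc n) w) else 0) \<partial>M)
    = (\<integral>\<^sup>+w. (if T (Suc n) w < \<infinity> then g' (real_of_ereal (T (Suc n) w), Y (Suc n) w) else 0) \<partial>M)"
  proof (rule nn_integral_cong_AE)
    show "AE w in M. (if T (Suc n) w \<le> ereal t then g (t - real_of_ereal (T (Suc n) w)) (Y (Suc n) w) else 0)
      = (if T (Suc n) w < \<infinity> then g' (real_of_ereal (T (Suc n) w), Y (Suc n) w) else 0)"
      using T_nonneg
    proof eventually_elim
      case (elim w)
      then show ?case using elim[rule_format, of "Suc n"] by (cases "T (Suc n) w") (auto simp: g'_def)
    qed
  qed
  also have "\<dots> = (\<integral>\<^sup>+w. (if T n w < \<infinity> then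
        \<integral>\<^sup>+s. indicator {0..} s * killed_flow (jump_op (\<lambda>y. g' (real_of_ereal (T n w) + s, y))) s (Y n w) \<partial>lborel else 0) \<partial>M)"
    by (rule next_jump_law[OF g'])
  also have "\<dots> = (\<integral>\<^sup>+w. (if T n w \<le> ereal t then first_jump g (t - real_of_ereal (T n w)) (Y n w) else 0) \<partial>M)"
  proof (rule nn_integral_cong_AE)
    show "AE w in M. (if T n w < \<infinity> then
        \<integral>\<^sup>+s. indicator {0..} s * killed_flow (jump_op (\<lambda>y. g' (real_of_ereal (T n w) + s, y))) s (Y n w) \<partial>lborel else 0)
      = (if T n w \<le> ereal t then first_jump g (t - real_of_ereal (T n w)) (Y n w) else 0)"
      using T_nonneg
    proof eventually_elim
      case (elim w)
      show ?case
      proof (cases "T n w < \<infinity>")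
        case True
        then obtain u where u: "T n w = ereal u" "0 \<le> u"
          using elim[rule_format, of n] by (cases "T n w") auto
        \<comment> \<open>With the \<open>n\<close>-th jump at \<open>u\<close>, a next jump at
          \<open>u + s\<close> counts only if \<open>s\<close> is at most \<open>t - u\<close>,
          which truncates the integral.\<close>
        have *: "indicator {0..} s * killed_flow (jump_op (\<lambda>y. g' (u + s, y))) s (Y n w)
            = indicator {0..t - u} s * killed_flow (jump_op (g (t - u - s))) s (Y n w)" for s
        proof (cases "u + s \<le> t")
          case True
          then have "(\<lambda>y. g' (u + s, y)) = g (t - u - s)"
            by (auto simp: g'_def fun_eq_iff algebra_simps)
          then show ?thesis using True by (auto simp: indicator_def)
        next
          case False
          then have "(\<lambda>y. g' (u + s, y)) = (\<lambda>y. 0)"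
            by (auto simp: g'_def fun_eq_iff)
          then show ?thesis using False by (auto simp: indicator_def killed_flow_def jump_op_def)
        qed
        show ?thesis
        proof (cases "u \<le> t")
          case True
          then show ?thesis by (simp add: u * first_jump_def)
        next
          case False
          then have "indicator {0..t - u} s = (0 :: ennreal)" for s by (simp add: indicator_def)
          then show ?thesis using False by (simp add: u *)
        qed
      qed auto
    qed
  qed
  also have "\<dots> = (first_jump ^^ n) (first_jump g) t z"
    by (rule Suc.IH[OF first_jump_measurable[OF g]])
  finally show ?case by (simp add: funpow_swap1)
qed

text \<open>Almost surely exactly one \<open>n\<close> satisfies
  \<open>T n \<le> t < T (Suc n)\<close>, because the jump times increase to infinity. On that event
  the process is on its flow line after the \<open>n\<close>-th jump, and survival of the last
  stretch produces \<open>killed_flow f\<close>.\<close>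

lemma expectation_expansion:
  assumes f [measurable]: "f \<in> borel_measurable E" and t: "0 \<le> t"
  shows "(\<integral>\<^sup>+w. f (Z t w) \<partial>M) = (\<Sum>n. (first_jump ^^ n) (killed_flow f) t z)"
proof -
  interpret X: prob_space unit_exponential by (rule prob_space_unit_exponential)
  have [measurable]: "Z t \<in> M \<rightarrow>\<^sub>M E" by (rule Z_measurable[OF t])
  let ?f = "\<lambda>n w. (if T n w \<le> ereal t \<and> ereal t < T (Suc n) w then f (\<phi> (t - real_of_ereal (T n w)) (Y n w)) else 0)"
  have "(\<integral>\<^sup>+w. f (Z t w) \<partial>M) = (\<integral>\<^sup>+w. (\<Sum>n. ?f n w) \<partial>M)"
  proof (rule nn_integral_cong_AE)
    show "AE w in M. f (Z t w) = (\<Sum>n. ?f n w)"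
      using start T_increasing T_unbounded Z_between
    proof eventually_elim
      case (elim w)
      have mono: "T n w \<le> T m w" if "n \<le> m" for n m
      proof (rule lift_Suc_mono_le[of "\<lambda>n. T n w", OF _ that])
        fix n show "T n w \<le> T (Suc n) w"
          using elim(2)[rule_format, of n] by (auto split: if_splits)
      qed
      have "\<forall>\<^sub>F n in sequentially. ereal t < T n w"
        by (rule order_tendstoD[OF elim(3)]) simp
      then have ex: "\<exists>n. ereal t < T (Suc n) w"
        unfolding eventually_sequentially by (meson le_SucI order_refl)
      define n where "n = (LEAST n. ereal t < T (Suc n) w)"
      have n1: "ereal t < T (Suc n) w"
        unfolding n_def by (rule LeastI_ex[OF ex])
      have n2: "T n w \<le> ereal t"
      proof (cases n)
        case 0
        then show ?thesis using elim(1) t by (simp add: zero_ereal_def)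
      next
        case (Suc k)
        then have "\<not> ereal t < T (Suc k) w"
          using not_less_Least[of k "\<lambda>n. ereal t < T (Suc n) w"] by (simp add: n_def)
        then show ?thesis using Suc by simp
      qed
      have "?f m w = (if m = n then f (Z t w) else 0)" for m
      proof (cases "m = n")
        case True
        then show ?thesis using n1 n2 elim(4) by simp
      next
        case False
        have "\<not> (T m w \<le> ereal t \<and> ereal t < T (Suc m) w)"
        proof
          assume m: "T m w \<le> ereal t \<and> ereal t < T (Suc m) w"
          consider "Suc m \<le> n" | "Suc n \<le> m" using False by linarith
          then show False
          proof cases
            case 1 then show ?thesis using mono[OF 1] m n2 by auto
          next
            case 2 then show ?thesis using mono[OF 2] m n1 by auto
          qed
        qed
        then show ?thesis using False by auto
      qed
      then show ?case
        using suminf_finite[of "{n}" "\<lambda>m. ?f m w"] by simp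
    qed
  qed
  also have "\<dots> = (\<Sum>n. \<integral>\<^sup>+w. ?f n w \<partial>M)"
    by (rule nn_integral_suminf) measurable
  also have "\<dots> = (\<Sum>n. (first_jump ^^ n) (killed_flow f) t z)"
  proof (rule suminf_cong)
    fix n
    define h where "h x = (if fst (fst x) \<le> t \<and> ereal (t - fst (fst x)) < snd x then f (\<phi> (t - fst (fst x)) (snd (fst x))) else 0)"
      for x :: "(real \<times> 's) \<times> ereal"
    have h: "h \<in> borel_measurable ((borel \<Otimes>\<^sub>M E) \<Otimes>\<^sub>M borel)"
      unfolding h_def by measurable
    have "(\<integral>\<^sup>+w. ?f n w \<partial>M) = (\<integral>\<^sup>+w. (if T n w < \<infinity> then h ((real_of_ereal (T n w), Y n w), T (Suc n) w - T n w) else 0) \<partial>M)"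
    proof (rule nn_integral_cong_AE)
      show "AE w in M. ?f n w = (if T n w < \<infinity> then h ((real_of_ereal (T n w), Y n w), T (Suc n) w - T n w) else 0)"
        using T_nonneg T_increasing
      proof eventually_elim
        case (elim w)
        show ?case
          using elim(1)[rule_format, of n] elim(2)[rule_format, of n]
          by (cases "T n w"; cases "T (Suc n) w") (auto simp: h_def)
      qed
    qed
    also have "\<dots> = (\<integral>\<^sup>+w. (if T n w < \<infinity> then \<integral>\<^sup>+c. h ((real_of_ereal (T n w), Y n w), wait (Y n w) c) \<partial>unit_exponential else 0) \<partial>M)"
      by (rule wait_law[OF h])
    also have "\<dots> = (\<integral>\<^sup>+w. (if T n w \<le> ereal t then killed_flow f (t - real_of_ereal (T n w)) (Y n w) else 0) \<partial>M)"
    proof (rule nn_integral_cong_AE)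
      show "AE w in M. (if T n w < \<infinity> then \<integral>\<^sup>+c. h ((real_of_ereal (T n w), Y n w), wait (Y n w) c) \<partial>unit_exponential else 0)
        = (if T n w \<le> ereal t then killed_flow f (t - real_of_ereal (T n w)) (Y n w) else 0)"
        using T_nonneg AE_space
      proof eventually_elim
        case (elim w)
        have Yw: "Y n w \<in> space E" by (rule measurable_space[OF Y_measurable elim(2)])
        show ?case
        proof (cases "T n w \<le> ereal t")
          case True
          then obtain u where u: "T n w = ereal u" "0 \<le> u" "u \<le> t"
            using elim(1)[rule_format, of n] by (cases "T n w") auto
          have [measurable]: "wait (Y n w) \<in> borel_measurable borel" using Yw by measurable
          have "(\<integral>\<^sup>+c. h ((u, Y n w), wait (Y n w) c) \<partial>unit_exponential)
            = (\<integral>\<^sup>+c. f (\<phi> (t - u) (Y n w)) * indicator {c. ereal (t - u) < wait (Y n w) c} c \<partial>unit_exponential)"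
            using u by (intro nn_integral_cong) (auto simp: h_def indicator_def)
          also have "\<dots> = f (\<phi> (t - u) (Y n w)) * emeasure unit_exponential {c. ereal (t - u) < wait (Y n w) c}"
            by (rule nn_integral_cmult_indicator) simp
          also have "\<dots> = killed_flow f (t - u) (Y n w)"
            using emeasure_less_wait[OF Yw, of "t - u"] u by (simp add: killed_flow_def mult.commute)
          finally show ?thesis using u by simp
        next
          case False
          then show ?thesis using elim(1)[rule_format, of n] by (cases "T n w") (auto simp: h_def)
        qed
      qed
    qed
    also have "\<dots> = (first_jump ^^ n) (killed_flow f) t z"
      by (rule nth_jump_law[OF killed_flow_measurable1[OF f] t])
    finally show "(\<integral>\<^sup>+w. ?f n w \<partial>M) = (first_jump ^^ n) (killed_flow f) t z" .
  qed
  finally show ?thesis .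
qed

end

text \<open>The right side refers only to flow, rates and jump maps: the law of the process at a
  fixed time is determined by the dynamics.\<close>

lemma (in pdmp_setup) follows_jump_dynamics_expansion:
  assumes "follows_jump_dynamics E \<phi> rate jump_kernel z M Z" "prob_space M" "z \<in> space E"
    and "\<And>t. 0 \<le> t \<Longrightarrow> Z t \<in> M \<rightarrow>\<^sub>M E" "f \<in> borel_measurable E" "0 \<le> t"
  shows "(\<integral>\<^sup>+w. f (Z t w) \<partial>M) = (\<Sum>n. (first_jump ^^ n) (killed_flow f) t z)"
proof -
  interpret M: prob_space M by fact
  obtain T Y where
    H: "\<forall>n. T n \<in> borel_measurable M" "\<forall>n. Y n \<in> M \<rightarrow>\<^sub>M E" "AE w in M. T 0 w = 0 \<and> Y 0 w = z"
      "AE w in M. \<forall>n. if T n w < \<infinity> then T n w < T (Suc n) w else T (Suc n) w = \<infinity>"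
      "AE w in M. (\<lambda>n. T n w) \<longlonglongrightarrow> \<infinity>"
      "AE w in M. \<forall>n t. T n w \<le> ereal t \<and> ereal t < T (Suc n) w \<longrightarrow>
           Z t w = \<phi> (t - real_of_ereal (T n w)) (Y n w)"
      "\<forall>n. \<forall>t\<ge>0. AE w in M. T n w < \<infinity> \<longrightarrow>
           real_cond_exp M (jump_history M E T Y n n)
             (indicator {w \<in> space M. T (Suc n) w > T n w + ereal t}) w
           = exp (- integral {0..t} (\<lambda>s. rate (\<phi> s (Y n w))))"
      "\<forall>n. \<forall>A\<in>sets E. AE w in M. T (Suc n) w < \<infinity> \<longrightarrow>
           real_cond_exp M (jump_history M E T Y (Suc n) n)
             (indicator {w \<in> space M. Y (Suc n) w \<in> A}) w
           = jump_kernel (\<phi> (real_of_ereal (T (Suc n) w) - real_of_ereal (T n w)) (Y n w)) A"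
    using assms(1) unfolding follows_jump_dynamics_def by (elim exE conjE) (rule that)
  have "jump_dynamics E \<phi> r F M z Z T Y"
  proof unfold_locales
    show "z \<in> space E" by fact
    show "T n \<in> borel_measurable M" "Y n \<in> M \<rightarrow>\<^sub>M E" for n using H(1,2) by auto
  qed (fact H(3-6) assms(4) | rule H(7)[rule_format] H(8)[rule_format], assumption)+
  then show ?thesis
    using assms(5,6) by (rule jump_dynamics.expectation_expansion)
qed

section \<open>Invariance from time reversal\<close>

lemma measurable_indicator_Icc [measurable (raw)]:
  fixes f g h :: "'a \<Rightarrow> real"
  assumes [measurable]: "f \<in> borel_measurable M" "g \<in> borel_measurable M" "h \<in> borel_measurable M"
  shows "(\<lambda>x. indicator {f x..g x} (h x) :: ennreal) \<in> borel_measurable M"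
  unfolding indicator_def atLeastAtMost_iff by measurable

lemma (in pdmp_setup) jump_op_measurable' [measurable (raw)]:
  assumes "(\<lambda>x. g (fst x) (snd x)) \<in> borel_measurable (M \<Otimes>\<^sub>M E)" "k \<in> M \<rightarrow>\<^sub>M E"
  shows "(\<lambda>x. jump_op (g x) (k x)) \<in> borel_measurable M"
  using assms by (intro jump_op_measurable) (simp_all add: split_beta')

lemma (in pdmp_setup) killed_flow_measurable' [measurable (raw)]:
  assumes "(\<lambda>x. g (fst x) (snd x)) \<in> borel_measurable (M \<Otimes>\<^sub>M E)" "s \<in> borel_measurable M" "k \<in> M \<rightarrow>\<^sub>M E"
  shows "(\<lambda>x. killed_flow (g x) (s x) (k x)) \<in> borel_measurable M"
  using assms by (intro killed_flow_measurable) (simp_all add: split_beta')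

text \<open>\<open>S\<close> stands for velocity reversal. Both duality rules say that the adjoint
  in \<open>\<mu>\<close> is the conjugate by \<open>S\<close>: for the killed flow this is time
  reversal of one deterministic stretch, for each jump type a skew form of detailed balance.\<close>

locale reversible_pdmp = pdmp_setup E \<phi> r F + prob_space \<mu>
  for E :: "'s measure" and \<phi> r F and \<mu> :: "'s measure" +
  fixes S :: "'s \<Rightarrow> 's"
  assumes sets_\<mu> [measurable_cong, simp]: "sets \<mu> = sets E"
    and S_measurable [measurable]: "S \<in> E \<rightarrow>\<^sub>M E"
    and S_S [simp]: "z \<in> space E \<Longrightarrow> S (S z) = z"
    and jump_S: "z \<in> space E \<Longrightarrow> F i (S z) = S (F i z)"
    and flow_dual: "0 \<le> s \<Longrightarrow> f \<in> borel_measurable E \<Longrightarrow> g \<in> borel_measurable E \<Longrightarrow>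
      (\<integral>\<^sup>+z. g z * killed_flow f s z \<partial>\<mu>) = (\<integral>\<^sup>+z. killed_flow (\<lambda>z. g (S z)) s (S z) * f z \<partial>\<mu>)"
    and rate_dual: "f \<in> borel_measurable E \<Longrightarrow> g \<in> borel_measurable E \<Longrightarrow>
      (\<integral>\<^sup>+z. g z * (ennreal (r i z) * f (F i z)) \<partial>\<mu>) = (\<integral>\<^sup>+z. (ennreal (r i (S z)) * g (F i z)) * f z \<partial>\<mu>)"
begin

lemma space_\<mu> [simp]: "space \<mu> = space E"
  by (rule sets_eq_imp_space_eq) simp

lemma S_in_space [simp]: "z \<in> space E \<Longrightarrow> S z \<in> space E"
  by (rule measurable_space[OF S_measurable])

lemma jump_dual:
  assumes [measurable]: "f \<in> borel_measurable E" "g \<in> borel_measurable E"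
  shows "(\<integral>\<^sup>+z. g z * jump_op f z \<partial>\<mu>) = (\<integral>\<^sup>+z. jump_op (\<lambda>z. g (S z)) (S z) * f z \<partial>\<mu>)"
proof -
  have "(\<integral>\<^sup>+z. g z * jump_op f z \<partial>\<mu>) = (\<integral>\<^sup>+z. (\<Sum>i. g z * (ennreal (r i z) * f (F i z))) \<partial>\<mu>)"
    by (simp add: jump_op_def ennreal_suminf_cmult)
  also have "\<dots> = (\<Sum>i. \<integral>\<^sup>+z. g z * (ennreal (r i z) * f (F i z)) \<partial>\<mu>)"
    by (rule nn_integral_suminf) measurable
  also have "\<dots> = (\<Sum>i. \<integral>\<^sup>+z. (ennreal (r i (S z)) * g (F i z)) * f z \<partial>\<mu>)"
    by (simp add: rate_dual)
  also have "\<dots> = (\<integral>\<^sup>+z. (\<Sum>i. (ennreal (r i (S z)) * g (F i z)) * f z) \<partial>\<mu>)"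
    by (rule nn_integral_suminf[symmetric]) measurable
  also have "\<dots> = (\<integral>\<^sup>+z. jump_op (\<lambda>z. g (S z)) (S z) * f z \<partial>\<mu>)"
    by (intro nn_integral_cong) (simp add: jump_op_def ennreal_suminf_multc jump_S)
  finally show ?thesis .
qed

text \<open>Adjunction reverses the order of the factors: flow followed by jump turns into jump
  followed by flow, both seen through \<open>S\<close>.\<close>

lemma killed_jump_dual:
  assumes s: "0 \<le> s" and [measurable]: "f \<in> borel_measurable E" "g \<in> borel_measurable E"
  shows "(\<integral>\<^sup>+z. g z * killed_flow (jump_op f) s z \<partial>\<mu>)
    = (\<integral>\<^sup>+z. jump_op (killed_flow (\<lambda>z. g (S z)) s) (S z) * f z \<partial>\<mu>)"
proof -
  have "(\<integral>\<^sup>+z. g z * killed_flow (jump_op f) s z \<partial>\<mu>)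
      = (\<integral>\<^sup>+z. killed_flow (\<lambda>z. g (S z)) s (S z) * jump_op f z \<partial>\<mu>)"
    by (rule flow_dual[OF s]) measurable
  also have "\<dots> = (\<integral>\<^sup>+z. jump_op (\<lambda>z. killed_flow (\<lambda>z. g (S z)) s (S (S z))) (S z) * f z \<partial>\<mu>)"
    by (rule jump_dual) measurable
  also have "\<dots> = (\<integral>\<^sup>+z. jump_op (killed_flow (\<lambda>z. g (S z)) s) (S z) * f z \<partial>\<mu>)"
    by (intro nn_integral_cong) (simp add: jump_op_def)
  finally show ?thesis .
qed

text \<open>\<open>first_jump\<close> with its two factors exchanged, as
  \<open>killed_jump_dual\<close> demands.\<close>

definition last_jump :: "(real \<Rightarrow> 's \<Rightarrow> ennreal) \<Rightarrow> real \<Rightarrow> 's \<Rightarrow> ennreal" where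
  "last_jump u t z = (\<integral>\<^sup>+s. indicator {0..t} s * jump_op (killed_flow (u (t - s)) s) z \<partial>lborel)"

text \<open>For the time-convolution pairing \<open>conv\<close>, the adjoint of \<open>first_jump\<close> is \<open>last_jump\<close>.\<close>

definition conv :: "(real \<Rightarrow> 's \<Rightarrow> ennreal) \<Rightarrow> (real \<Rightarrow> 's \<Rightarrow> ennreal) \<Rightarrow> real \<Rightarrow> ennreal" where
  "conv u v t = (\<integral>\<^sup>+s. indicator {0..t} s * (\<integral>\<^sup>+z. u (t - s) (S z) * v s z \<partial>\<mu>) \<partial>lborel)"

lemma last_jump_measurable:
  assumes [measurable]: "case_prod u \<in> borel_measurable (borel \<Otimes>\<^sub>M E)"
  shows "case_prod (last_jump u) \<in> borel_measurable (borel \<Otimes>\<^sub>M E)"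
  unfolding last_jump_def by measurable

text \<open>Both sides integrate over the same splittings of \<open>t\<close> into three durations:
  one for \<open>u\<close>, one for the killed flow next to the jump, one for \<open>v\<close>. Only
  the grouping differs, and \<open>killed_jump_dual\<close> moves the middle factor across the
  pairing.\<close>

lemma conv_first_jump:
  assumes [measurable]: "case_prod u \<in> borel_measurable (borel \<Otimes>\<^sub>M E)" "case_prod v \<in> borel_measurable (borel \<Otimes>\<^sub>M E)"
  shows "conv u (first_jump v) t = conv (last_jump u) v t"
proof -
  interpret L: pair_sigma_finite \<mu> "lborel :: real measure" ..
  \<comment> \<open>\<open>a\<close>, \<open>b\<close> and \<open>c\<close> are the three durations;
    wherever \<open>A\<close> is used under the integral they add up to \<open>t\<close>.\<close>
  define A where "A a b c = (\<integral>\<^sup>+z. jump_op (killed_flow (u a) b) (S z) * v c z \<partial>\<mu>)" for a b c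
  have A [measurable (raw)]: "(\<lambda>x. A (a x) (b x) (c x)) \<in> borel_measurable N"
    if [measurable]: "a \<in> borel_measurable N" "b \<in> borel_measurable N" "c \<in> borel_measurable N" for a b c and N :: "'x measure"
    unfolding A_def by measurable
  have "conv u (first_jump v) t = (\<integral>\<^sup>+s. \<integral>\<^sup>+p. indicator {0..t} s * indicator {0..s} p * A (t - s) p (s - p) \<partial>lborel \<partial>lborel)"
    unfolding conv_def
  proof (rule nn_integral_cong)
    fix s :: real
    have "(\<integral>\<^sup>+z. u (t - s) (S z) * first_jump v s z \<partial>\<mu>)
      = (\<integral>\<^sup>+z. \<integral>\<^sup>+p. indicator {0..s} p * (u (t - s) (S z) * killed_flow (jump_op (v (s - p))) p z) \<partial>lborel \<partial>\<mu>)"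
      unfolding first_jump_def
      by (intro nn_integral_cong, subst nn_integral_cmult[symmetric]) (auto intro!: nn_integral_cong simp: ac_simps)
    also have "\<dots> = (\<integral>\<^sup>+p. \<integral>\<^sup>+z. indicator {0..s} p * (u (t - s) (S z) * killed_flow (jump_op (v (s - p))) p z) \<partial>\<mu> \<partial>lborel)"
      by (rule L.Fubini'[symmetric]) measurable
    also have "\<dots> = (\<integral>\<^sup>+p. indicator {0..s} p * A (t - s) p (s - p) \<partial>lborel)"
    proof (rule nn_integral_cong)
      fix p :: real
      show "(\<integral>\<^sup>+z. indicator {0..s} p * (u (t - s) (S z) * killed_flow (jump_op (v (s - p))) p z) \<partial>\<mu>) = indicator {0..s} p * A (t - s) p (s - p)"
      proof (cases "0 \<le> p")
        case True
        have "(\<integral>\<^sup>+z. u (t - s) (S z) * killed_flow (jump_op (v (s - p))) p z \<partial>\<mu>)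
            = (\<integral>\<^sup>+z. jump_op (killed_flow (\<lambda>z. u (t - s) (S (S z))) p) (S z) * v (s - p) z \<partial>\<mu>)"
          by (rule killed_jump_dual[OF True]) measurable
        also have "\<dots> = A (t - s) p (s - p)"
          unfolding A_def by (intro nn_integral_cong) (simp add: jump_op_def killed_flow_def)
        finally show ?thesis by (subst nn_integral_cmult) auto
      qed (simp add: indicator_def)
    qed
    finally show "indicator {0..t} s * (\<integral>\<^sup>+z. u (t - s) (S z) * first_jump v s z \<partial>\<mu>)
      = (\<integral>\<^sup>+p. indicator {0..t} s * indicator {0..s} p * A (t - s) p (s - p) \<partial>lborel)"
      by (simp add: nn_integral_cmult mult.assoc)
  qed
  also have "\<dots> = (\<integral>\<^sup>+p. \<integral>\<^sup>+s. indicator {0..t} s * indicator {0..s} p * A (t - s) p (s - p) \<partial>lborel \<partial>lborel)"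
    by (rule lborel_pair.Fubini') measurable
  also have "\<dots> = (\<integral>\<^sup>+p. \<integral>\<^sup>+s. indicator {0..t} s * indicator {0..t - s} p * A (t - s - p) p s \<partial>lborel \<partial>lborel)"
  proof (rule nn_integral_cong)
    \<comment> \<open>Substituting \<open>p + s\<close> for \<open>s\<close> makes \<open>s\<close>
      the duration spent in \<open>v\<close>.\<close>
    fix p :: real
    have "(\<integral>\<^sup>+s. indicator {0..t} s * indicator {0..s} p * A (t - s) p (s - p) \<partial>lborel)
      = (\<integral>\<^sup>+s. indicator {0..t} (p + 1 * s) * indicator {0..p + 1 * s} p * A (t - (p + 1 * s)) p (p + 1 * s - p) \<partial>lborel)"
      unfolding indicator_def by (subst nn_integral_real_affine[where c = 1 and t = p]) simp_all
    also have "\<dots> = (\<integral>\<^sup>+s. indicator {0..t} s * indicator {0..t - s} p * A (t - s - p) p s \<partial>lborel)"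
      by (intro nn_integral_cong) (auto simp: indicator_def algebra_simps)
    finally show "(\<integral>\<^sup>+s. indicator {0..t} s * indicator {0..s} p * A (t - s) p (s - p) \<partial>lborel)
      = (\<integral>\<^sup>+s. indicator {0..t} s * indicator {0..t - s} p * A (t - s - p) p s \<partial>lborel)" .
  qed
  also have "\<dots> = (\<integral>\<^sup>+s. \<integral>\<^sup>+p. indicator {0..t} s * indicator {0..t - s} p * A (t - s - p) p s \<partial>lborel \<partial>lborel)"
    by (rule lborel_pair.Fubini') measurable
  also have "\<dots> = conv (last_jump u) v t"
    unfolding conv_def
  proof (rule nn_integral_cong)
    fix s :: real
    have "(\<integral>\<^sup>+z. last_jump u (t - s) (S z) * v s z \<partial>\<mu>)
      = (\<integral>\<^sup>+z. \<integral>\<^sup>+p. indicator {0..t - s} p * (jump_op (killed_flow (u (t - s - p)) p) (S z) * v s z) \<partial>lborel \<partial>\<mu>)"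
      unfolding last_jump_def
      by (intro nn_integral_cong, subst nn_integral_multc[symmetric]) (auto intro!: nn_integral_cong simp: ac_simps)
    also have "\<dots> = (\<integral>\<^sup>+p. \<integral>\<^sup>+z. indicator {0..t - s} p * (jump_op (killed_flow (u (t - s - p)) p) (S z) * v s z) \<partial>\<mu> \<partial>lborel)"
      by (rule L.Fubini'[symmetric]) measurable
    also have "\<dots> = (\<integral>\<^sup>+p. indicator {0..t - s} p * A (t - s - p) p s \<partial>lborel)"
      unfolding A_def by (intro nn_integral_cong nn_integral_cmult) measurable
    finally show "(\<integral>\<^sup>+p. indicator {0..t} s * indicator {0..t - s} p * A (t - s - p) p s \<partial>lborel)
      = indicator {0..t} s * (\<integral>\<^sup>+z. last_jump u (t - s) (S z) * v s z \<partial>\<mu>)"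
      by (simp add: nn_integral_cmult mult.assoc)
  qed
  finally show ?thesis .
qed

text \<open>The regrouping \<open>(J K) J = J (K J)\<close> for the jump operator \<open>J\<close>
  and the killed flow \<open>K\<close>: behind a leading jump operator the reversed recursion
  becomes the original one.\<close>

lemma last_jump_jump_op:
  assumes [measurable]: "case_prod u \<in> borel_measurable (borel \<Otimes>\<^sub>M E)" and z: "z \<in> space E"
  shows "last_jump (\<lambda>t. jump_op (u t)) t z = jump_op (first_jump u t) z"
proof -
  have [measurable]: "(\<lambda>s. killed_flow (jump_op (u (t - s))) s (F i z)) \<in> borel_measurable borel" for i
    using z by measurable
  have "last_jump (\<lambda>t. jump_op (u t)) t z
    = (\<integral>\<^sup>+s. (\<Sum>i. indicator {0..t} s * (ennreal (r i z) * killed_flow (jump_op (u (t - s))) s (F i z))) \<partial>lborel)"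
    unfolding last_jump_def jump_op_def[of "killed_flow _ _"] by (simp add: ennreal_suminf_cmult)
  also have "\<dots> = (\<Sum>i. \<integral>\<^sup>+s. indicator {0..t} s * (ennreal (r i z) * killed_flow (jump_op (u (t - s))) s (F i z)) \<partial>lborel)"
    by (rule nn_integral_suminf) measurable
  also have "\<dots> = (\<Sum>i. ennreal (r i z) * first_jump u t (F i z))"
    unfolding first_jump_def by (subst nn_integral_cmult[symmetric]) (auto simp: ac_simps)
  finally show ?thesis by (simp add: jump_op_def)
qed

lemma last_jump_cong:
  assumes "\<And>t z. z \<in> space E \<Longrightarrow> u t z = v t z" "z \<in> space E"
  shows "last_jump u t z = last_jump v t z"
  unfolding last_jump_def jump_op_def killed_flow_def using assms by simp

lemma last_jump_iter_jump_op:
  assumes u: "case_prod u \<in> borel_measurable (borel \<Otimes>\<^sub>M E)" and z: "z \<in> space E"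
  shows "(last_jump ^^ n) (\<lambda>t. jump_op (u t)) t z = jump_op ((first_jump ^^ n) u t) z"
  using z
proof (induction n arbitrary: t z)
  case (Suc n)
  have "(last_jump ^^ Suc n) (\<lambda>t. jump_op (u t)) t z = last_jump (\<lambda>t. jump_op ((first_jump ^^ n) u t)) t z"
    using last_jump_cong[OF Suc.IH Suc.prems] by simp
  also have "\<dots> = jump_op ((first_jump ^^ Suc n) u t) z"
    using last_jump_jump_op[OF first_jump_iter_measurable[OF u] Suc.prems] by simp
  finally show ?case .
qed simp

lemma conv_first_jump_iter:
  assumes u: "case_prod u \<in> borel_measurable (borel \<Otimes>\<^sub>M E)" and v: "case_prod v \<in> borel_measurable (borel \<Otimes>\<^sub>M E)"
  shows "conv u ((first_jump ^^ n) v) t = conv ((last_jump ^^ n) u) v t"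
  using u
proof (induction n arbitrary: u)
  case (Suc n)
  have "conv u ((first_jump ^^ Suc n) v) t = conv (last_jump u) ((first_jump ^^ n) v) t"
    using conv_first_jump[OF Suc.prems first_jump_iter_measurable[OF v]] by simp
  then show ?case
    using Suc.IH[OF last_jump_measurable[OF Suc.prems]] by (simp add: funpow_swap1)
qed simp

text \<open>For \<open>n = Suc m\<close> the first killed flow and jump are moved to the left by
  \<open>killed_jump_dual\<close> with the constant \<open>1\<close>, the other \<open>m\<close>
  pairs by \<open>conv_first_jump_iter\<close>, and the last killed flow by
  \<open>flow_dual\<close>. What has accumulated on the left is regrouped into the same word applied
  to \<open>1\<close>.\<close>

lemma expansion_dual:
  assumes f [measurable]: "f \<in> borel_measurable E" and t: "0 \<le> t"
  shows "(\<integral>\<^sup>+z. (first_jump ^^ n) (killed_flow f) t z \<partial>\<mu>)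
    = (\<integral>\<^sup>+z. (first_jump ^^ n) (killed_flow (\<lambda>_. 1)) t (S z) * f z \<partial>\<mu>)"
proof (cases n)
  case 0
  then show ?thesis using flow_dual[OF t f, of "\<lambda>_. 1"] by simp
next
  case (Suc m)
  interpret L: pair_sigma_finite \<mu> "lborel :: real measure" ..
  define v where "v = (first_jump ^^ m) (killed_flow f)"
  define k where "k = killed_flow (\<lambda>_. 1)"
  define w where "w = (first_jump ^^ m) k"
  have k_meas [measurable]: "case_prod k \<in> borel_measurable (borel \<Otimes>\<^sub>M E)"
    unfolding k_def by (rule killed_flow_measurable1) simp
  have [measurable]: "case_prod v \<in> borel_measurable (borel \<Otimes>\<^sub>M E)" "case_prod w \<in> borel_measurable (borel \<Otimes>\<^sub>M E)"
    unfolding v_def w_def by (rule first_jump_iter_measurable killed_flow_measurable1 f k_meas)+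
  have "(\<integral>\<^sup>+z. first_jump v t z \<partial>\<mu>)
    = (\<integral>\<^sup>+s. \<integral>\<^sup>+z. indicator {0..t} s * killed_flow (jump_op (v (t - s))) s z \<partial>\<mu> \<partial>lborel)"
    unfolding first_jump_def by (rule L.Fubini'[symmetric]) measurable
  also have "\<dots> = (\<integral>\<^sup>+s. indicator {0..t} s * (\<integral>\<^sup>+z. jump_op (k s) (S z) * v (t - s) z \<partial>\<mu>) \<partial>lborel)"
  proof (rule nn_integral_cong)
    fix s :: real
    show "(\<integral>\<^sup>+z. indicator {0..t} s * killed_flow (jump_op (v (t - s))) s z \<partial>\<mu>)
      = indicator {0..t} s * (\<integral>\<^sup>+z. jump_op (k s) (S z) * v (t - s) z \<partial>\<mu>)"
    proof (cases "0 \<le> s")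
      case True
      have "v (t - s) \<in> borel_measurable E" by measurable
      from killed_jump_dual[OF True this, of "\<lambda>_. 1"] show ?thesis
        by (subst nn_integral_cmult) (simp_all add: k_def)
    qed (simp add: indicator_def)
  qed
  \<comment> \<open>Reversing time in the outer integral gives the shape of
    \<open>conv\<close>.\<close>
  also have "\<dots> = (\<integral>\<^sup>+s. indicator {0..t} (t + -1 * s) * (\<integral>\<^sup>+z. jump_op (k (t + -1 * s)) (S z) * v (t - (t + -1 * s)) z \<partial>\<mu>) \<partial>lborel)"
    unfolding indicator_def by (subst nn_integral_real_affine[where c = "-1" and t = t]) simp_all
  also have "\<dots> = conv (\<lambda>s. jump_op (k s)) v t"
    unfolding conv_def by (intro nn_integral_cong) (auto simp: indicator_def)
  also have "\<dots> = conv ((last_jump ^^ m) (\<lambda>s. jump_op (k s))) (killed_flow f) t"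
    unfolding v_def by (rule conv_first_jump_iter) measurable
  also have "\<dots> = conv (\<lambda>s. jump_op (w s)) (killed_flow f) t"
    unfolding conv_def w_def
    by (intro nn_integral_cong arg_cong2[where f = "(*)"] refl) (simp add: last_jump_iter_jump_op[OF k_meas])
  also have "\<dots> = (\<integral>\<^sup>+s. \<integral>\<^sup>+z. indicator {0..t} s * (killed_flow (jump_op (w (t - s))) s (S z) * f z) \<partial>\<mu> \<partial>lborel)"
    unfolding conv_def
  proof (rule nn_integral_cong)
    fix s :: real
    show "indicator {0..t} s * (\<integral>\<^sup>+z. jump_op (w (t - s)) (S z) * killed_flow f s z \<partial>\<mu>)
      = (\<integral>\<^sup>+z. indicator {0..t} s * (killed_flow (jump_op (w (t - s))) s (S z) * f z) \<partial>\<mu>)"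
    proof (cases "0 \<le> s")
      case True
      have "(\<integral>\<^sup>+z. jump_op (w (t - s)) (S z) * killed_flow f s z \<partial>\<mu>)
        = (\<integral>\<^sup>+z. killed_flow (\<lambda>z. jump_op (w (t - s)) (S (S z))) s (S z) * f z \<partial>\<mu>)"
        by (rule flow_dual[OF True f]) measurable
      also have "\<dots> = (\<integral>\<^sup>+z. killed_flow (jump_op (w (t - s))) s (S z) * f z \<partial>\<mu>)"
        by (intro nn_integral_cong) (simp add: killed_flow_def)
      finally show ?thesis by (subst nn_integral_cmult) auto
    qed (simp add: indicator_def)
  qed
  also have "\<dots> = (\<integral>\<^sup>+z. \<integral>\<^sup>+s. indicator {0..t} s * (killed_flow (jump_op (w (t - s))) s (S z) * f z) \<partial>lborel \<partial>\<mu>)"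
    by (rule L.Fubini') measurable
  also have "\<dots> = (\<integral>\<^sup>+z. first_jump w t (S z) * f z \<partial>\<mu>)"
    unfolding first_jump_def
    by (intro nn_integral_cong, subst nn_integral_multc[symmetric]) (auto intro!: nn_integral_cong simp: ac_simps)
  finally show ?thesis by (simp add: Suc v_def w_def k_def)
qed

theorem invariant_probI:
  assumes "pdmp E \<phi> rate jump_kernel N P Z"
  shows "invariant_prob E P Z \<mu>"
  unfolding invariant_prob_def
proof (intro conjI allI impI)
  have P: "P \<in> E \<rightarrow>\<^sub>M prob_algebra N" and Z: "\<And>t. 0 \<le> t \<Longrightarrow> Z t \<in> N \<rightarrow>\<^sub>M E"
    and dyn: "\<And>z. z \<in> space E \<Longrightarrow> follows_jump_dynamics E \<phi> rate jump_kernel z (P z) Z"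
    using assms by (auto simp: pdmp_def markov_process_def)
  have Pz: "prob_space (P z)" "sets (P z) = sets N" if "z \<in> space E" for z
    using measurable_space[OF P that] by (auto simp: space_prob_algebra)
  have exp: "(\<integral>\<^sup>+w. f (Z t w) \<partial>P z) = (\<Sum>n. (first_jump ^^ n) (killed_flow f) t z)"
    if "z \<in> space E" "f \<in> borel_measurable E" "0 \<le> t" for f z t
  proof (rule follows_jump_dynamics_expansion[OF dyn[OF that(1)] Pz(1)[OF that(1)] that(1) _ that(2,3)])
    show "Z t \<in> P z \<rightarrow>\<^sub>M E" if "0 \<le> t" for t
      using Z[OF that] measurable_cong_sets[OF Pz(2)[OF \<open>z \<in> space E\<close>] refl] by blast
  qed
  \<comment> \<open>Total mass of the law of \<open>Z t\<close>. No mass escapes, because the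
    expansion holds for jump times tending to infinity.\<close>
  have one: "(\<Sum>n. (first_jump ^^ n) (killed_flow (\<lambda>_. 1)) t z) = 1" if "z \<in> space E" "0 \<le> t" for z t
    using exp[OF that(1) _ that(2), of "\<lambda>_. 1"] prob_space.emeasure_space_1[OF Pz(1)[OF that(1)]] by simp
  show "prob_space \<mu>" by (rule prob_space_axioms)
  show "sets \<mu> = sets E" by simp
  fix t :: real assume t: "0 \<le> t"
  have [measurable]: "P \<in> \<mu> \<rightarrow>\<^sub>M subprob_algebra N" "Z t \<in> N \<rightarrow>\<^sub>M E"
    using measurable_prob_algebraD[OF P] Z[OF t] by simp_all
  have sb: "sets (\<mu> \<bind> P) = sets N"
    by (rule sets_bind[of _ _ N]) (use Pz(2) not_empty in auto)
  show "distr (\<mu> \<bind> P) E (Z t) = \<mu>"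
  proof (rule measure_eqI)
    fix A assume "A \<in> sets (distr (\<mu> \<bind> P) E (Z t))"
    then have A [measurable]: "A \<in> sets E" by simp
    have [measurable]: "case_prod ((first_jump ^^ n) (killed_flow f)) \<in> borel_measurable (borel \<Otimes>\<^sub>M E)"
      if "f \<in> borel_measurable E" for f n
      by (rule first_jump_iter_measurable killed_flow_measurable1 that)+
    have "emeasure (distr (\<mu> \<bind> P) E (Z t)) A = emeasure (\<mu> \<bind> P) (Z t -` A \<inter> space N)"
      using sets_eq_imp_space_eq[OF sb] measurable_cong_sets[OF sb refl, of E] by (subst emeasure_distr) auto
    also have "\<dots> = (\<integral>\<^sup>+z. emeasure (P z) (Z t -` A \<inter> space N) \<partial>\<mu>)"
      by (rule emeasure_bind[of _ _ N]) (use not_empty in auto)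
    also have "\<dots> = (\<integral>\<^sup>+z. (\<Sum>n. (first_jump ^^ n) (killed_flow (indicator A)) t z) \<partial>\<mu>)"
    proof (rule nn_integral_cong)
      fix z assume "z \<in> space \<mu>"
      then have z: "z \<in> space E" by simp
      have "emeasure (P z) (Z t -` A \<inter> space N) = (\<integral>\<^sup>+w. indicator (Z t -` A \<inter> space N) w \<partial>P z)"
        using Pz(2)[OF z] by simp
      also have "\<dots> = (\<integral>\<^sup>+w. indicator A (Z t w) \<partial>P z)"
        using sets_eq_imp_space_eq[OF Pz(2)[OF z]] by (intro nn_integral_cong) (auto simp: indicator_def)
      also have "\<dots> = (\<Sum>n. (first_jump ^^ n) (killed_flow (indicator A)) t z)"
        by (rule exp[OF z _ t]) simp
      finally show "emeasure (P z) (Z t -` A \<inter> space N) = (\<Sum>n. (first_jump ^^ n) (killed_flow (indicator A)) t z)" .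
    qed
    also have "\<dots> = (\<Sum>n. \<integral>\<^sup>+z. (first_jump ^^ n) (killed_flow (indicator A)) t z \<partial>\<mu>)"
      by (rule nn_integral_suminf) measurable
    also have "\<dots> = (\<Sum>n. \<integral>\<^sup>+z. (first_jump ^^ n) (killed_flow (\<lambda>_. 1)) t (S z) * indicator A z \<partial>\<mu>)"
      by (simp add: expansion_dual[OF _ t])
    also have "\<dots> = (\<integral>\<^sup>+z. (\<Sum>n. (first_jump ^^ n) (killed_flow (\<lambda>_. 1)) t (S z) * indicator A z) \<partial>\<mu>)"
      by (rule nn_integral_suminf[symmetric]) measurable
    also have "\<dots> = (\<integral>\<^sup>+z. indicator A z \<partial>\<mu>)"
      by (intro nn_integral_cong) (simp add: ennreal_suminf_multc one[OF _ t])
    finally show "emeasure (distr (\<mu> \<bind> P) E (Z t)) A = emeasure \<mu> A" by simp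
  qed simp
qed

end

section \<open>Construction of the process\<close>

text \<open>The half-open interval keeps \<open>u * rate y\<close> strictly below a positive
  \<open>rate y\<close>, so that \<open>pick\<close> finds an index.\<close>

definition unit_uniform :: "real measure" where
  "unit_uniform = uniform_measure lborel {0..<1}"

definition step_law :: "(real \<times> real) measure" where
  "step_law = unit_exponential \<Otimes>\<^sub>M unit_uniform"

lemma prob_space_unit_uniform: "prob_space unit_uniform"
  unfolding unit_uniform_def by (rule prob_space_uniform_measure) auto

lemma sets_unit_uniform [measurable_cong, simp]: "sets unit_uniform = sets borel"
  by (simp add: unit_uniform_def)

lemma space_unit_uniform [simp]: "space unit_uniform = UNIV"
  by (simp add: unit_uniform_def)

lemma prob_space_step_law: "prob_space step_law"
proof -
  interpret A: prob_space unit_exponential by (rule prob_space_unit_exponential)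
  interpret B: prob_space unit_uniform by (rule prob_space_unit_uniform)
  interpret pair_prob_space unit_exponential unit_uniform ..
  show ?thesis unfolding step_law_def by unfold_locales
qed

lemma sets_step_law [measurable_cong, simp]: "sets step_law = sets (borel \<Otimes>\<^sub>M borel)"
  unfolding step_law_def by (intro sets_pair_measure_cong) auto

lemma space_step_law [simp]: "space step_law = UNIV"
  by (simp add: step_law_def space_pair_measure)

lemma nn_integral_step_law:
  assumes [measurable]: "f \<in> borel_measurable (borel \<Otimes>\<^sub>M borel)"
  shows "(\<integral>\<^sup>+a. f a \<partial>step_law) = (\<integral>\<^sup>+x. \<integral>\<^sup>+y. f (x, y) \<partial>unit_uniform \<partial>unit_exponential)"
proof -
  interpret B: prob_space unit_uniform by (rule prob_space_unit_uniform)
  show ?thesis unfolding step_law_def by (rule B.nn_integral_fst[symmetric]) measurable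
qed

lemma nn_integral_step_law_fst:
  assumes [measurable]: "f \<in> borel_measurable borel"
  shows "(\<integral>\<^sup>+a. f (fst a) \<partial>step_law) = (\<integral>\<^sup>+x. f x \<partial>unit_exponential)"
  using prob_space.emeasure_space_1[OF prob_space_unit_uniform] by (simp add: nn_integral_step_law)

lemma AE_step_law_pos: "AE a in step_law. 0 < fst a"
proof -
  have "{a \<in> space (borel \<Otimes>\<^sub>M borel). \<not> 0 < (fst a :: real)} \<in> sets (borel \<Otimes>\<^sub>M (borel :: real measure))"
    by measurable
  then have [measurable]: "{a :: real \<times> real. \<not> 0 < fst a} \<in> sets (borel \<Otimes>\<^sub>M borel)"
    by (simp add: space_pair_measure)
  have "emeasure step_law {a. \<not> 0 < fst a} = (\<integral>\<^sup>+a. indicator {..0} (fst a) \<partial>step_law)"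
  proof -
    have "emeasure step_law {a. \<not> 0 < fst a} = (\<integral>\<^sup>+a. indicator {a. \<not> 0 < fst a} a \<partial>step_law)" by simp
    also have "\<dots> = (\<integral>\<^sup>+a. indicator {..0} (fst a) \<partial>step_law)"
      by (intro nn_integral_cong) (auto simp: indicator_def)
    finally show ?thesis .
  qed
  also have "\<dots> = emeasure unit_exponential {..0}"
    by (simp add: nn_integral_step_law_fst)
  also have "\<dots> = 0"
    using AE_unit_exponential_pos by (subst (asm) AE_iff_measurable[OF _ refl]) (auto simp: not_less atMost_def)
  finally show ?thesis
    by (intro AE_I[where N = "{a. \<not> 0 < fst a}"]) auto
qed

interpretation step_seq: sequence_space step_law
proof -
  interpret prob_space step_law by (rule prob_space_step_law)
  show "sequence_space step_law" by unfold_locales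
qed

lemma nn_integral_exp_unit_exponential:
  "(\<integral>\<^sup>+x. ennreal (exp (- x)) \<partial>unit_exponential) = ennreal (1/2)"
proof -
  interpret prob_space "density lborel (exponential_density 2)"
    by (rule prob_space_exponential_density) simp
  have one: "(\<integral>\<^sup>+x. ennreal (exponential_density 2 x) \<partial>lborel) = 1"
    using emeasure_space_1 by (simp add: emeasure_density)
  have "(\<integral>\<^sup>+x. ennreal (exp (- x)) \<partial>unit_exponential) = (\<integral>\<^sup>+x. ennreal (1/2) * ennreal (exponential_density 2 x) \<partial>lborel)"
    unfolding unit_exponential_def
    by (subst nn_integral_density)
      (auto intro!: nn_integral_cong simp: exponential_density_def ennreal_mult[symmetric] exp_add[symmetric] simp del: ennreal_half)
  then show ?thesis by (simp add: nn_integral_cmult one)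
qed

lemma nn_integral_exp_sum_step_seq:
  "(\<integral>\<^sup>+\<omega>. ennreal (exp (- (\<Sum>k<n. fst (\<omega> k)))) \<partial>step_seq.S) = ennreal (1/2) ^ n"
proof (induction n)
  case 0
  then show ?case by (simp add: step_seq.P.emeasure_space_1)
next
  case (Suc n)
  have "(\<integral>\<^sup>+\<omega>. ennreal (exp (- (\<Sum>k<Suc n. fst (\<omega> k)))) \<partial>step_seq.S)
    = (\<integral>\<^sup>+x. ennreal (exp (- (\<Sum>k<Suc n. fst (case_nat (fst x) (snd x) k)))) \<partial>(step_law \<Otimes>\<^sub>M step_seq.S))"
    by (subst step_seq.PiM_iter[symmetric], subst nn_integral_distr) (simp_all add: split_beta')
  also have "\<dots> = (\<integral>\<^sup>+x. ennreal (exp (- fst (fst x))) * ennreal (exp (- (\<Sum>k<n. fst (snd x k)))) \<partial>(step_law \<Otimes>\<^sub>M step_seq.S))"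
    by (simp only: sum.lessThan_Suc_shift) (simp add: ennreal_mult[symmetric] exp_add[symmetric])
  also have "\<dots> = (\<integral>\<^sup>+a. \<integral>\<^sup>+\<omega>. ennreal (exp (- fst a)) * ennreal (exp (- (\<Sum>k<n. fst (\<omega> k)))) \<partial>step_seq.S \<partial>step_law)"
    by (subst step_seq.P.nn_integral_fst[symmetric]) simp_all
  also have "\<dots> = ennreal (1/2) ^ Suc n"
    by (simp add: nn_integral_cmult Suc nn_integral_multc nn_integral_step_law_fst[of "\<lambda>x. ennreal (exp (- x))"]
        nn_integral_exp_unit_exponential)
  finally show ?case .
qed

text \<open>Exponential Markov inequality: \<open>exp (- c)\<close> has mean \<open>1/2\<close>
  under a clock, so the first \<open>n\<close> independent clocks have sum at most \<open>m\<close>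
  with probability at most \<open>exp m * (1/2)^n\<close>, which tends to zero.\<close>

lemma AE_sum_step_seq_unbounded:
  "AE \<omega> in step_seq.S. \<forall>C::real. \<exists>n. C < (\<Sum>k<n. fst (\<omega> k))"
proof -
  have "AE \<omega> in step_seq.S. \<exists>n. real m < (\<Sum>k<n. fst (\<omega> k))" for m :: nat
  proof -
    let ?A = "{\<omega> \<in> space step_seq.S. \<forall>n. (\<Sum>k<n. fst (\<omega> k)) \<le> real m}"
    have [measurable]: "?A \<in> sets step_seq.S" by measurable
    have "emeasure step_seq.S ?A \<le> ennreal (exp (real m)) * ennreal (1/2) ^ n" for n
    proof -
      have "emeasure step_seq.S ?A = (\<integral>\<^sup>+\<omega>. indicator ?A \<omega> \<partial>step_seq.S)" by simp
      also have "\<dots> \<le> (\<integral>\<^sup>+\<omega>. ennreal (exp (real m)) * ennreal (exp (- (\<Sum>k<n. fst (\<omega> k)))) \<partial>step_seq.S)"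
      proof (rule nn_integral_mono)
        fix \<omega> :: "nat \<Rightarrow> real \<times> real"
        show "indicator ?A \<omega> \<le> ennreal (exp (real m)) * ennreal (exp (- (\<Sum>k<n. fst (\<omega> k))))"
        proof (cases "\<omega> \<in> ?A")
          case True
          then have "1 \<le> exp (real m - (\<Sum>k<n. fst (\<omega> k)))" by simp
          then show ?thesis
            by (simp add: ennreal_mult[symmetric] exp_add[symmetric] indicator_def flip: ennreal_1)
        qed simp
      qed
      also have "\<dots> = ennreal (exp (real m)) * ennreal (1/2) ^ n"
        by (subst nn_integral_cmult) (simp_all add: nn_integral_exp_sum_step_seq)
      finally show ?thesis .
    qed
    then have "emeasure step_seq.S ?A \<le> ennreal (exp (real m) * (1/2) ^ n)" for n
      by (simp add: ennreal_mult ennreal_power del: ennreal_half)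
    moreover have "(\<lambda>n. ennreal (exp (real m) * (1/2) ^ n)) \<longlonglongrightarrow> ennreal (exp (real m) * 0)"
      by (intro tendsto_ennrealI tendsto_mult tendsto_const LIMSEQ_power_zero) simp
    ultimately have "emeasure step_seq.S ?A \<le> ennreal (exp (real m) * 0)"
      by (intro LIMSEQ_le_const) auto
    then have "emeasure step_seq.S ?A = 0" by simp
    then show ?thesis
      by (intro AE_I[where N = ?A]) (auto simp: not_less)
  qed
  then have "AE \<omega> in step_seq.S. \<forall>m::nat. \<exists>n. real m < (\<Sum>k<n. fst (\<omega> k))"
    by (simp add: AE_all_countable)
  then show ?thesis
  proof eventually_elim
    case (elim \<omega>)
    show ?case
    proof
      fix C :: real
      obtain m :: nat where "C \<le> real m" using real_arch_simple by blast
      then show "\<exists>n. C < (\<Sum>k<n. fst (\<omega> k))" using elim le_less_trans by blast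
    qed
  qed
qed

text \<open>In a path \<open>w\<close>, \<open>w n\<close> consists of the holding time after the \<open>n\<close>-th jump and of the state right
  after that jump.\<close>

definition jump_time :: "nat \<Rightarrow> (nat \<Rightarrow> ereal \<times> 's) \<Rightarrow> ereal" where
  "jump_time n w = (\<Sum>k<n. fst (w k))"

lemma jump_time_0 [simp]: "jump_time 0 w = 0"
  by (simp add: jump_time_def)

lemma jump_time_Suc: "jump_time (Suc n) w = jump_time n w + fst (w n)"
  by (simp add: jump_time_def)

lemma jump_time_case_nat: "jump_time (Suc n) (case_nat (s, y) w) = s + jump_time n w"
  unfolding jump_time_def by (simp only: sum.lessThan_Suc_shift) simp

definition positive_path :: "(nat \<Rightarrow> ereal \<times> 's) \<Rightarrow> bool" where
  "positive_path w \<longleftrightarrow> (\<forall>n. 0 < fst (w n))"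

text \<open>The event, later shown to have full measure, on which pathwise arguments take place: no
  simultaneous jumps and no accumulation.\<close>

definition regular_path :: "(nat \<Rightarrow> ereal \<times> 's) \<Rightarrow> bool" where
  "regular_path w \<longleftrightarrow> positive_path w \<and> (\<forall>m::nat. \<exists>n. ereal (real m) < jump_time n w)"

lemma jump_time_nonneg: "positive_path w \<Longrightarrow> 0 \<le> jump_time n w"
  unfolding jump_time_def positive_path_def by (intro sum_nonneg) (auto intro: less_imp_le)

lemma jump_time_mono:
  assumes "positive_path w" "m \<le> n"
  shows "jump_time m w \<le> jump_time n w"
proof (rule lift_Suc_mono_le[of "\<lambda>n. jump_time n w", OF _ assms(2)])
  fix n
  have "jump_time n w + 0 \<le> jump_time n w + fst (w n)"
    using assms(1) by (intro add_left_mono) (auto simp: positive_path_def intro: less_imp_le)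
  then show "jump_time n w \<le> jump_time (Suc n) w" by (simp add: jump_time_Suc)
qed

lemma positive_path_case_nat: "positive_path (case_nat (s, y) w) \<longleftrightarrow> 0 < s \<and> positive_path w"
  unfolding positive_path_def by (auto split: nat.splits)

lemma jump_time_increasing:
  assumes "positive_path w"
  shows "if jump_time n w < \<infinity> then jump_time n w < jump_time (Suc n) w else jump_time (Suc n) w = \<infinity>"
  using jump_time_nonneg[OF assms, of n] assms[unfolded positive_path_def, rule_format, of n]
  by (cases "jump_time n w"; cases "fst (w n)") (auto simp: jump_time_Suc)

lemma jump_time_unbounded:
  assumes "regular_path w"
  shows "(\<lambda>n. jump_time n w) \<longlonglongrightarrow> \<infinity>"
  unfolding tendsto_PInfty
proof
  fix C :: real
  obtain m :: nat where "C \<le> real m" using real_arch_simple by blast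
  moreover obtain N where "ereal (real m) < jump_time N w"
    using assms by (auto simp: regular_path_def)
  ultimately have "ereal C < jump_time N w"
    by (meson ereal_less_eq(3) le_less_trans)
  moreover have "jump_time N w \<le> jump_time n w" if "N \<le> n" for n
    using jump_time_mono that assms by (auto simp: regular_path_def)
  ultimately show "\<forall>\<^sub>F n in sequentially. ereal C < jump_time n w"
    unfolding eventually_sequentially using less_le_trans by blast
qed

lemma regular_path_index:
  assumes "regular_path w" "0 \<le> t"
  obtains n where "jump_time n w \<le> ereal t" "ereal t < jump_time (Suc n) w"
proof -
  obtain m where m: "ereal t < jump_time m w"
    using order_tendstoD(1)[OF jump_time_unbounded[OF assms(1)], of "ereal t"]
    by (auto simp: eventually_sequentially)
  define n where "n = (LEAST n. ereal t < jump_time n w)"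
  have n: "ereal t < jump_time n w" unfolding n_def by (rule LeastI[of "\<lambda>n. ereal t < jump_time n w", OF m])
  then obtain k where k: "n = Suc k"
    using assms(2) by (cases n) (auto simp: zero_ereal_def)
  have "\<not> ereal t < jump_time k w"
    using not_less_Least[of k "\<lambda>n. ereal t < jump_time n w"] k by (simp add: n_def)
  then show ?thesis using that[of k] n k by simp
qed

lemma jump_index_unique:
  assumes "positive_path w" "jump_time n w \<le> ereal t" "ereal t < jump_time (Suc n) w"
    "jump_time m w \<le> ereal t" "ereal t < jump_time (Suc m) w"
  shows "m = n"
proof (rule ccontr)
  assume "m \<noteq> n"
  then consider "Suc m \<le> n" | "Suc n \<le> m" by linarith
  then show False
    using jump_time_mono[OF assms(1)] assms(2-5) by cases (meson leD le_less_trans less_le_trans)+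
qed

section \<open>Paths built from the driving sequence\<close>

context pdmp_setup
begin

text \<open>Inverse of the partial sums of the rates; comparison with \<open>u * rate y\<close>
  avoids dividing by a rate that may vanish.\<close>

definition pick :: "'s \<Rightarrow> real \<Rightarrow> nat" where
  "pick y u = (LEAST i. u * rate y < (\<Sum>k\<le>i. r k y))"

text \<open>If the clock never rings the state is kept, merely to have a value.\<close>

definition next_state :: "'s \<Rightarrow> real \<times> real \<Rightarrow> 's" where
  "next_state y a =
    (if wait y (fst a) < \<infinity> then
       let y' = \<phi> (real_of_ereal (wait y (fst a))) y in F (pick y' (snd a)) y'
     else y)"

lemma pick_measurable [measurable (raw)]:
  assumes [measurable]: "f \<in> M \<rightarrow>\<^sub>M E" "g \<in> borel_measurable M"
  shows "(\<lambda>x. pick (f x) (g x)) \<in> M \<rightarrow>\<^sub>M count_space UNIV"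
  unfolding pick_def by measurable

lemma jump_at_measurable [measurable (raw)]:
  assumes [measurable]: "i \<in> M \<rightarrow>\<^sub>M count_space UNIV" "f \<in> M \<rightarrow>\<^sub>M E"
  shows "(\<lambda>x. F (i x) (f x)) \<in> M \<rightarrow>\<^sub>M E"
  by (rule measurable_compose_countable[where g = i]) measurable

lemma next_state_measurable [measurable (raw)]:
  assumes [measurable]: "f \<in> M \<rightarrow>\<^sub>M E" "g \<in> M \<rightarrow>\<^sub>M borel \<Otimes>\<^sub>M borel"
  shows "(\<lambda>x. next_state (f x) (g x)) \<in> M \<rightarrow>\<^sub>M E"
  unfolding next_state_def Let_def by measurable

lemma next_state_in_space [simp]: "y \<in> space E \<Longrightarrow> next_state y a \<in> space E"
  by (simp add: next_state_def Let_def)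

text \<open>The values \<open>u\<close> that select type \<open>i\<close> form the interval between
  two consecutive partial sums of the rates, divided by the total rate; its length is
  \<open>r i y / rate y\<close>.\<close>

lemma pick_law:
  assumes y: "y \<in> space E" and pos: "0 < rate y" and f: "f \<in> borel_measurable E"
  shows "(\<integral>\<^sup>+u. f (F (pick y u) y) \<partial>unit_uniform) = (\<Sum>i. ennreal (r i y / rate y) * f (F i y))"
proof -
  define s where "s i = (\<Sum>k<i. r k y)" for i
  have smono: "mono s" unfolding s_def by (intro monoI sum_mono2) (auto intro: rate_nonneg)
  have s0: "0 \<le> s i" for i unfolding s_def by (intro sum_nonneg rate_nonneg)
  have s_le: "s i \<le> rate y" for i
    unfolding s_def rate_def by (rule sum_le_suminf[OF rate_summable[OF y]]) (auto intro: rate_nonneg)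
  have s_lim: "s \<longlonglongrightarrow> rate y"
    unfolding s_def rate_def by (rule summable_LIMSEQ[OF rate_summable[OF y]])
  have pick: "pick y u = i \<longleftrightarrow> s i \<le> u * rate y \<and> u * rate y < s (Suc i)" if u: "0 \<le> u" "u < 1" for u i
  proof -
    have ex: "\<exists>i. u * rate y < s (Suc i)"
    proof -
      have "u * rate y < rate y" using u pos by simp
      from order_tendstoD(1)[OF s_lim this] obtain N where "\<forall>n\<ge>N. u * rate y < s n"
        by (auto simp: eventually_sequentially)
      then show ?thesis by (meson le_SucI order_refl)
    qed
    have p: "pick y u = (LEAST i. u * rate y < s (Suc i))"
      by (simp add: pick_def s_def lessThan_Suc_atMost)
    have p1: "u * rate y < s (Suc (pick y u))" unfolding p by (rule LeastI_ex[OF ex])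
    have p2: "s (pick y u) \<le> u * rate y"
    proof (cases "pick y u")
      case 0
      then show ?thesis using u pos by (simp add: s_def)
    next
      case (Suc k)
      then have "\<not> u * rate y < s (Suc k)"
        using not_less_Least[of k "\<lambda>i. u * rate y < s (Suc i)"] by (simp add: p)
      then show ?thesis using Suc by simp
    qed
    show ?thesis
    proof
      assume "s i \<le> u * rate y \<and> u * rate y < s (Suc i)"
      moreover have "Suc i \<le> pick y u \<Longrightarrow> s (Suc i) \<le> s (pick y u)"
        "Suc (pick y u) \<le> i \<Longrightarrow> s (Suc (pick y u)) \<le> s i"
        using smono by (auto dest: monoD)
      ultimately show "pick y u = i" using p1 p2 by (cases "pick y u" i rule: linorder_cases) auto
    qed (use p1 p2 in auto)
  qed
  have prob: "emeasure unit_uniform {u. pick y u = i} = ennreal (r i y / rate y)" for i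
  proof -
    have [measurable]: "pick y \<in> borel \<rightarrow>\<^sub>M count_space UNIV" using y by measurable
    have "emeasure unit_uniform {u. pick y u = i} = emeasure lborel ({0..<1} \<inter> {u. pick y u = i}) / emeasure lborel {0..<1::real}"
      unfolding unit_uniform_def by (rule emeasure_uniform_measure) auto
    also have "{0..<1} \<inter> {u. pick y u = i} = {s i / rate y..<s (Suc i) / rate y}"
    proof (intro set_eqI iffI)
      fix u assume "u \<in> {s i / rate y..<s (Suc i) / rate y}"
      moreover from this have "0 \<le> u" "u < 1"
        using divide_nonneg_pos[OF s0[of i] pos] s_le[of "Suc i"] pos
        by (auto intro: order_trans less_le_trans simp: divide_le_eq_1)
      ultimately show "u \<in> {0..<1} \<inter> {u. pick y u = i}" using pos by (auto simp: pick field_simps)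
    next
      fix u assume "u \<in> {0..<1} \<inter> {u. pick y u = i}"
      then have "s i \<le> u * rate y \<and> u * rate y < s (Suc i)" using pick[of u i] by simp
      then show "u \<in> {s i / rate y..<s (Suc i) / rate y}" using pos by (simp add: field_simps)
    qed
    also have "emeasure lborel {s i / rate y..<s (Suc i) / rate y} / emeasure lborel {0..<1::real} = ennreal (r i y / rate y)"
      using pos rate_nonneg[of i y] by (simp add: s_def divide_right_mono diff_divide_distrib[symmetric] divide_ennreal_def)
    finally show ?thesis .
  qed
  have [measurable]: "pick y \<in> borel \<rightarrow>\<^sub>M count_space UNIV" using y by measurable
  have "(\<integral>\<^sup>+u. f (F (pick y u) y) \<partial>unit_uniform) = (\<integral>\<^sup>+u. (\<Sum>i. f (F i y) * indicator {u. pick y u = i} u) \<partial>unit_uniform)"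
  proof (rule nn_integral_cong)
    fix u
    show "f (F (pick y u) y) = (\<Sum>i. f (F i y) * indicator {u. pick y u = i} u)"
      by (subst suminf_finite[of "{pick y u}"]) (auto simp: indicator_def)
  qed
  also have "\<dots> = (\<Sum>i. \<integral>\<^sup>+u. f (F i y) * indicator {u. pick y u = i} u \<partial>unit_uniform)"
    by (rule nn_integral_suminf) measurable
  also have "\<dots> = (\<Sum>i. f (F i y) * emeasure unit_uniform {u. pick y u = i})"
    by (intro suminf_cong nn_integral_cmult_indicator) measurable
  finally show ?thesis by (simp add: prob mult.commute)
qed

primrec state :: "'s \<Rightarrow> (nat \<Rightarrow> real \<times> real) \<Rightarrow> nat \<Rightarrow> 's" where
  "state z \<omega> 0 = z"
| "state z \<omega> (Suc n) = next_state (state z \<omega> n) (\<omega> n)"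

definition path :: "'s \<Rightarrow> (nat \<Rightarrow> real \<times> real) \<Rightarrow> nat \<Rightarrow> ereal \<times> 's" where
  "path z \<omega> n = (wait (state z \<omega> n) (fst (\<omega> n)), state z \<omega> n)"

abbreviation path_space :: "(nat \<Rightarrow> ereal \<times> 's) measure" where
  "path_space \<equiv> \<Pi>\<^sub>M n\<in>UNIV. borel \<Otimes>\<^sub>M E"

definition path_law :: "'s \<Rightarrow> (nat \<Rightarrow> ereal \<times> 's) measure" where
  "path_law z = distr step_seq.S path_space (path z)"

text \<open>The default \<open>snd (w 0)\<close> serves paths in which no two consecutive jump times
  enclose \<open>t\<close>; it keeps the map measurable into \<open>E\<close> on the whole path
  space.\<close>

definition process :: "real \<Rightarrow> (nat \<Rightarrow> ereal \<times> 's) \<Rightarrow> 's" where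
  "process t w =
    (if \<exists>n. jump_time n w \<le> ereal t \<and> ereal t < jump_time (Suc n) w then
       let n = LEAST n. jump_time n w \<le> ereal t \<and> ereal t < jump_time (Suc n) w
       in \<phi> (t - real_of_ereal (jump_time n w)) (snd (w n))
     else snd (w 0))"

lemma state_in_space [simp]: "z \<in> space E \<Longrightarrow> state z \<omega> n \<in> space E"
  by (induction n) auto

lemma state_measurable [measurable (raw)]:
  assumes [measurable]: "f \<in> M \<rightarrow>\<^sub>M E" "g \<in> M \<rightarrow>\<^sub>M step_seq.S"
  shows "(\<lambda>x. state (f x) (g x) n) \<in> M \<rightarrow>\<^sub>M E"
proof (induction n)
  case (Suc n)
  note [measurable] = Suc
  have "(\<lambda>x. g x n) \<in> M \<rightarrow>\<^sub>M step_law"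
    using measurable_compose[OF assms(2) measurable_component_singleton] by simp
  then have [measurable]: "(\<lambda>x. g x n) \<in> M \<rightarrow>\<^sub>M borel \<Otimes>\<^sub>M borel"
    using measurable_cong_sets[OF refl sets_step_law] by blast
  show ?case by simp
qed simp

lemma path_measurable [measurable (raw)]:
  assumes [measurable]: "f \<in> M \<rightarrow>\<^sub>M E" "g \<in> M \<rightarrow>\<^sub>M step_seq.S"
  shows "(\<lambda>x. path (f x) (g x)) \<in> M \<rightarrow>\<^sub>M path_space"
proof (rule measurable_PiM_single')
  fix n
  have "(\<lambda>x. g x n) \<in> M \<rightarrow>\<^sub>M step_law"
    using measurable_compose[OF assms(2) measurable_component_singleton] by simp
  then have [measurable]: "(\<lambda>x. g x n) \<in> M \<rightarrow>\<^sub>M borel \<Otimes>\<^sub>M borel"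
    using measurable_cong_sets[OF refl sets_step_law] by blast
  show "(\<lambda>x. path (f x) (g x) n) \<in> M \<rightarrow>\<^sub>M borel \<Otimes>\<^sub>M E"
    unfolding path_def by measurable
next
  show "(\<lambda>x. path (f x) (g x)) \<in> space M \<rightarrow> UNIV \<rightarrow>\<^sub>E space (borel \<Otimes>\<^sub>M E)"
    using measurable_space[OF assms(1)] by (auto simp: path_def space_pair_measure)
qed

lemma state_case_nat: "state z (case_nat a \<omega>) (Suc n) = state (next_state z a) \<omega> n"
  by (induction n) auto

lemma path_case_nat: "path z (case_nat a \<omega>) = case_nat (wait z (fst a), z) (path (next_state z a) \<omega>)"
proof
  fix n show "path z (case_nat a \<omega>) n = case_nat (wait z (fst a), z) (path (next_state z a) \<omega>) n"
    by (cases n) (simp_all add: path_def state_case_nat del: state.simps(2))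
qed

lemma jump_time_measurable [measurable]: "jump_time n \<in> borel_measurable path_space"
  unfolding jump_time_def by measurable

lemma process_measurable [measurable]: "process t \<in> path_space \<rightarrow>\<^sub>M E"
proof -
  have [measurable]: "(\<lambda>w. LEAST n. jump_time n w \<le> ereal t \<and> ereal t < jump_time (Suc n) w) \<in> path_space \<rightarrow>\<^sub>M count_space UNIV"
    by measurable
  have "(\<lambda>w. \<phi> (t - real_of_ereal (jump_time (LEAST n. jump_time n w \<le> ereal t \<and> ereal t < jump_time (Suc n) w) w))
      (snd (w (LEAST n. jump_time n w \<le> ereal t \<and> ereal t < jump_time (Suc n) w)))) \<in> path_space \<rightarrow>\<^sub>M E"
    by (rule measurable_compose_countable[where f = "\<lambda>n w. \<phi> (t - real_of_ereal (jump_time n w)) (snd (w n))"]) measurable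
  then show ?thesis unfolding process_def Let_def by measurable
qed

lemma positive_path_measurable [measurable]: "Measurable.pred path_space positive_path"
  unfolding positive_path_def by measurable

lemma regular_path_measurable [measurable]: "Measurable.pred path_space regular_path"
  unfolding regular_path_def by measurable

lemma sets_path_law [simp, measurable_cong]: "sets (path_law z) = sets path_space"
  by (simp add: path_law_def)

lemma space_path_law [simp]: "space (path_law z) = space path_space"
  by (simp add: path_law_def)

lemma prob_space_path_law: "z \<in> space E \<Longrightarrow> prob_space (path_law z)"
  unfolding path_law_def by (intro step_seq.P.prob_space_distr) measurable

lemma path_law_measurable [measurable]: "path_law \<in> E \<rightarrow>\<^sub>M prob_algebra path_space"
proof (rule measurable_prob_algebraI)
  show "path_law \<in> E \<rightarrow>\<^sub>M subprob_algebra path_space"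
    unfolding path_law_def
  proof (rule measurable_distr2)
    show "case_prod path \<in> E \<Otimes>\<^sub>M step_seq.S \<rightarrow>\<^sub>M path_space"
      unfolding split_beta' by measurable
    show "(\<lambda>x. step_seq.S) \<in> E \<rightarrow>\<^sub>M subprob_algebra step_seq.S"
      using step_seq.P.M_in_subprob by simp
  qed
qed (rule prob_space_path_law)

lemma path_law_measurable_subprob [measurable]: "path_law \<in> E \<rightarrow>\<^sub>M subprob_algebra path_space"
  by (rule measurable_prob_algebraD[OF path_law_measurable])

lemma nn_integral_path_law:
  assumes "z \<in> space E" and f [measurable]: "f \<in> borel_measurable path_space"
  shows "(\<integral>\<^sup>+w. f w \<partial>path_law z) = (\<integral>\<^sup>+\<omega>. f (path z \<omega>) \<partial>step_seq.S)"
  unfolding path_law_def using assms(1) by (intro nn_integral_distr) measurable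

text \<open>Splitting off the head of the i.i.d. sequence: the tail is independent of it and drives
  a fresh path from \<open>next_state z a\<close>.\<close>

lemma path_law_first_step:
  assumes z: "z \<in> space E" and f [measurable]: "f \<in> borel_measurable path_space"
  shows "(\<integral>\<^sup>+w. f w \<partial>path_law z)
    = (\<integral>\<^sup>+a. \<integral>\<^sup>+w. f (case_nat (wait z (fst a), z) w) \<partial>path_law (next_state z a) \<partial>step_law)"
proof -
  have [measurable]: "(\<lambda>w. case_nat (x, z) w) \<in> path_space \<rightarrow>\<^sub>M path_space" for x :: ereal
    using z by (intro measurable_case_nat') measurable
  have "(\<integral>\<^sup>+w. f w \<partial>path_law z) = (\<integral>\<^sup>+\<omega>. f (path z \<omega>) \<partial>step_seq.S)"
    by (rule nn_integral_path_law[OF assms])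
  also have "\<dots> = (\<integral>\<^sup>+x. f (path z (case_nat (fst x) (snd x))) \<partial>(step_law \<Otimes>\<^sub>M step_seq.S))"
    using z by (subst step_seq.PiM_iter[symmetric], subst nn_integral_distr) (simp_all add: split_beta')
  also have "\<dots> = (\<integral>\<^sup>+a. \<integral>\<^sup>+\<omega>. f (path z (case_nat a \<omega>)) \<partial>step_seq.S \<partial>step_law)"
    using z by (subst step_seq.P.nn_integral_fst[symmetric]) simp_all
  also have "\<dots> = (\<integral>\<^sup>+a. \<integral>\<^sup>+w. f (case_nat (wait z (fst a), z) w) \<partial>path_law (next_state z a) \<partial>step_law)"
    by (intro nn_integral_cong, subst nn_integral_path_law) (simp_all add: z path_case_nat)
  finally show ?thesis .
qed

lemma path_comb_seq: "path z (comb_seq n \<omega> \<omega>') = comb_seq n (path z \<omega>) (path (state z \<omega> n) \<omega>')"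
proof -
  have 1: "state z (comb_seq n \<omega> \<omega>') k = state z \<omega> k" if "k \<le> n" for k
    using that by (induction k) (auto simp: comb_seq_less)
  have 2: "state z (comb_seq n \<omega> \<omega>') (n + k) = state (state z \<omega> n) \<omega>' k" for k
  proof (induction k)
    case (Suc k)
    have "comb_seq n \<omega> \<omega>' (n + k) = \<omega>' k" by (simp add: comb_seq_def)
    then show ?case using Suc by simp
  qed (simp add: 1)
  show ?thesis
  proof
    fix k show "path z (comb_seq n \<omega> \<omega>') k = comb_seq n (path z \<omega>) (path (state z \<omega> n) \<omega>') k"
    proof (cases "k < n")
      case True
      then show ?thesis by (simp add: path_def 1 comb_seq_less)
    next
      case False
      then obtain j where "k = n + j" using le_Suc_ex not_less by blast
      moreover have "comb_seq n \<omega> \<omega>' (n + j) = \<omega>' j" "comb_seq n v v' (n + j) = v' j" for v v' :: "nat \<Rightarrow> ereal \<times> 's"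
        by (simp_all add: comb_seq_def)
      ultimately show ?thesis by (simp add: path_def 2)
    qed
  qed
qed

text \<open>Markov property at a jump number instead of a time: from index \<open>n\<close> on, the
  i.i.d. sequence may be replaced by an independent copy that drives a path from the state in entry
  \<open>n\<close>. \<open>comb_seq\<close> glues the first \<open>n\<close> entries of
  \<open>w\<close> to \<open>w'\<close>.\<close>

lemma path_law_restart:
  assumes z: "z \<in> space E" and f [measurable]: "f \<in> borel_measurable path_space"
  shows "(\<integral>\<^sup>+w. f w \<partial>path_law z)
    = (\<integral>\<^sup>+w. \<integral>\<^sup>+w'. f (comb_seq n w w') \<partial>path_law (snd (w n)) \<partial>path_law z)"
proof -
  have [measurable]: "(\<lambda>x. path z (comb_seq n (fst x) (snd x))) \<in> step_seq.S \<Otimes>\<^sub>M step_seq.S \<rightarrow>\<^sub>M path_space"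
    using z measurable_comb_seq[of n step_law] by (intro path_measurable) (simp_all add: split_beta')
  have cs: "(\<lambda>x. comb_seq n (fst x) (snd x)) \<in> path_space \<Otimes>\<^sub>M path_space \<rightarrow>\<^sub>M path_space"
    using measurable_comb_seq[of n "borel \<Otimes>\<^sub>M E"] by (simp add: split_beta')
  have "(\<integral>\<^sup>+w. f w \<partial>path_law z) = (\<integral>\<^sup>+\<omega>. f (path z \<omega>) \<partial>step_seq.S)"
    by (rule nn_integral_path_law[OF assms])
  also have "\<dots> = (\<integral>\<^sup>+x. f (path z (comb_seq n (fst x) (snd x))) \<partial>(step_seq.S \<Otimes>\<^sub>M step_seq.S))"
    using z measurable_comb_seq[of n step_law]
    by (subst step_seq.PiM_comb_seq[symmetric, of n], subst nn_integral_distr) (simp_all add: split_beta')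
  also have "\<dots> = (\<integral>\<^sup>+\<omega>. \<integral>\<^sup>+\<omega>'. f (path z (comb_seq n \<omega> \<omega>')) \<partial>step_seq.S \<partial>step_seq.S)"
    by (subst step_seq.P.nn_integral_fst[symmetric]) simp_all
  also have "\<dots> = (\<integral>\<^sup>+\<omega>. \<integral>\<^sup>+w'. f (comb_seq n (path z \<omega>) w') \<partial>path_law (snd (path z \<omega> n)) \<partial>step_seq.S)"
  proof (rule nn_integral_cong)
    fix \<omega> assume \<omega>: "\<omega> \<in> space step_seq.S"
    have "path z \<omega> \<in> space path_space"
      using z \<omega> by (intro measurable_space[OF path_measurable[where f = "\<lambda>_. z" and g = "\<lambda>x. x"]]) auto
    then have [measurable]: "(\<lambda>w'. comb_seq n (path z \<omega>) w') \<in> path_space \<rightarrow>\<^sub>M path_space"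
      using measurable_compose[OF measurable_Pair1' cs] by simp
    show "(\<integral>\<^sup>+\<omega>'. f (path z (comb_seq n \<omega> \<omega>')) \<partial>step_seq.S) = (\<integral>\<^sup>+w'. f (comb_seq n (path z \<omega>) w') \<partial>path_law (snd (path z \<omega> n)))"
      by (subst nn_integral_path_law) (simp_all add: path_comb_seq path_def z)
  qed
  also have "\<dots> = (\<integral>\<^sup>+w. \<integral>\<^sup>+w'. f (comb_seq n w w') \<partial>path_law (snd (w n)) \<partial>path_law z)"
  proof (rule nn_integral_path_law[OF z, symmetric])
    show "(\<lambda>w. \<integral>\<^sup>+w'. f (comb_seq n w w') \<partial>path_law (snd (w n))) \<in> borel_measurable path_space"
    proof (rule nn_integral_measurable_subprob_algebra2)
      show "(\<lambda>(w, w'). f (comb_seq n w w')) \<in> borel_measurable (path_space \<Otimes>\<^sub>M path_space)"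
        using measurable_compose[OF cs f] by (simp add: split_beta')
      show "(\<lambda>w. path_law (snd (w n))) \<in> path_space \<rightarrow>\<^sub>M subprob_algebra path_space"
        by measurable
    qed
  qed
  finally show ?thesis .
qed

end

text \<open>The direction opposite to \<open>emeasure_Int_real_cond_exp\<close>. The indicator of
  \<open>B\<close> passes through the conditional expectation, so multiplying by it reduces a claim
  on \<open>B\<close> to the usual characterisation on the whole space.\<close>

lemma (in prob_space) real_cond_exp_indicatorI:
  assumes F: "subalgebra M F" and A: "A \<in> sets M" and B: "B \<in> sets F"
    and g: "g \<in> borel_measurable F" "\<And>w. w \<in> space M \<Longrightarrow> 0 \<le> g w"
    and eq: "\<And>H. H \<in> sets F \<Longrightarrow> H \<subseteq> B \<Longrightarrow> emeasure M (H \<inter> A) = (\<integral>\<^sup>+w. indicator H w * ennreal (g w) \<partial>M)"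
  shows "AE w in M. w \<in> B \<longrightarrow> real_cond_exp M F (indicator A) w = g w"
proof -
  interpret finite_measure_subalgebra M F
    by standard (rule F)
  have sub: "H \<in> sets M" if "H \<in> sets F" for H using F that by (auto simp: subalgebra_def)
  have BM [measurable]: "B \<in> sets M" by (rule sub[OF B])
  have gM [measurable]: "g \<in> borel_measurable M" by (rule measurable_from_subalg[OF F g(1)])
  have ind: "integrable M (indicator C :: 'a \<Rightarrow> real)" if "C \<in> sets M" for C
    by (rule integrable_real_indicator[OF that]) (simp add: emeasure_eq_measure)
  have BA: "(\<lambda>w. indicator B w * indicator A w :: real) = indicator (B \<inter> A)"
    by (auto simp: indicator_def fun_eq_iff)
  have int: "(\<integral>w. indicator H w * (indicator B w * g w) \<partial>M) = measure M (H \<inter> (B \<inter> A))"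
    if H: "H \<in> sets F" for H
  proof -
    have "(\<integral>\<^sup>+w. ennreal (indicator H w * (indicator B w * g w)) \<partial>M) = (\<integral>\<^sup>+w. indicator (H \<inter> B) w * ennreal (g w) \<partial>M)"
      by (intro nn_integral_cong) (auto simp: indicator_def)
    also have "\<dots> = emeasure M (H \<inter> B \<inter> A)"
      using H B by (intro eq[symmetric]) auto
    finally have "(\<integral>\<^sup>+w. ennreal (indicator H w * (indicator B w * g w)) \<partial>M) = ennreal (measure M (H \<inter> (B \<inter> A)))"
      by (simp add: emeasure_eq_measure Int_assoc)
    moreover have "(\<integral>w. indicator H w * (indicator B w * g w) \<partial>M) = enn2real (\<integral>\<^sup>+w. ennreal (indicator H w * (indicator B w * g w)) \<partial>M)"
      by (rule integral_eq_nn_integral) (use sub[OF H] g(2) in \<open>auto intro!: AE_I2\<close>)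
    ultimately show ?thesis by simp
  qed
  have "AE w in M. real_cond_exp M F (\<lambda>w. indicator B w * indicator A w) w = indicator B w * g w"
  proof (rule real_cond_exp_charact)
    show "integrable M (\<lambda>w. indicator B w * indicator A w :: real)"
      using ind[of "B \<inter> A"] A by (simp add: BA)
    show "integrable M (\<lambda>w. indicator B w * g w)"
    proof (rule integrableI_nonneg)
      have "(\<integral>\<^sup>+w. ennreal (indicator B w * g w) \<partial>M) = (\<integral>\<^sup>+w. indicator B w * ennreal (g w) \<partial>M)"
        by (intro nn_integral_cong) (auto simp: indicator_def)
      also have "\<dots> = emeasure M (B \<inter> A)" by (rule eq[symmetric, OF B]) simp
      finally show "(\<integral>\<^sup>+w. ennreal (indicator B w * g w) \<partial>M) < \<infinity>" by (simp add: emeasure_eq_measure)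
    qed (auto intro!: AE_I2 simp: g(2))
    show "(\<lambda>w. indicator B w * g w) \<in> borel_measurable F"
      using g(1) B by measurable
    fix H assume H: "H \<in> sets F"
    have "(\<integral>w\<in>H. indicat_real B w * indicator A w \<partial>M) = (\<integral>w. indicat_real (H \<inter> (B \<inter> A)) w \<partial>M)"
      unfolding set_lebesgue_integral_def by (intro Bochner_Integration.integral_cong) (auto simp: indicator_def)
    also have "\<dots> = measure M (H \<inter> (B \<inter> A))"
      using sub[OF H] A by simp
    finally show "(\<integral>w\<in>H. indicator B w * indicator A w \<partial>M) = (\<integral>w\<in>H. indicator B w * g w \<partial>M)"
      using int[OF H] by (simp add: set_lebesgue_integral_def)
  qed
  moreover have "AE w in M. real_cond_exp M F (\<lambda>w. indicator B w * indicator A w) w = indicator B w * real_cond_exp M F (indicator A) w"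
  proof (rule real_cond_exp_mult)
    show "integrable M (\<lambda>w. indicator B w * indicator A w :: real)"
      using ind[of "B \<inter> A"] A by (simp add: BA)
  qed (use A B in auto)
  ultimately show ?thesis
    by eventually_elim (auto simp: indicator_def)
qed

text \<open>Generators of the history cannot separate two paths with the same jump data, and this
  property survives complements and countable unions. It replaces a representation of the events as
  functions of the data.\<close>

lemma jump_history_determined:
  assumes "H \<in> sets (jump_history M E T Y m n)" "w \<in> space M" "w' \<in> space M"
    and "\<And>k. k \<le> m \<Longrightarrow> T k w = T k w'" "\<And>k. k \<le> n \<Longrightarrow> Y k w = Y k w'"
  shows "w \<in> H \<longleftrightarrow> w' \<in> H"
  using assms(1) unfolding sets_jump_history
  by (induction rule: sigma_sets.induct) (use assms(2-) in auto)

context pdmp_setup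
begin

lemma case_nat_in_path_space:
  "w \<in> space path_space \<Longrightarrow> y \<in> space E \<Longrightarrow> case_nat (s, y) w \<in> space path_space"
  by (auto simp: space_PiM space_pair_measure PiE_iff split: nat.splits)

lemma comb_seq_in_path_space:
  "w \<in> space path_space \<Longrightarrow> w' \<in> space path_space \<Longrightarrow> comb_seq n w w' \<in> space path_space"
  by (auto simp: space_PiM PiE_iff comb_seq_def)

lemma path_space_snd: "w \<in> space path_space \<Longrightarrow> snd (w n) \<in> space E"
  by (auto simp: space_PiM PiE_iff space_pair_measure mem_Times_iff)

lemma jump_time_comb_seq:
  "k \<le> n \<Longrightarrow> jump_time k (comb_seq n w w') = jump_time k w"
  "jump_time (Suc n) (comb_seq n w w') = jump_time n w + fst (w' 0)"
proof -
  show *: "jump_time k (comb_seq n w w') = jump_time k w" if "k \<le> n" for k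
    unfolding jump_time_def using that by (intro sum.cong) (auto simp: comb_seq_def)
  show "jump_time (Suc n) (comb_seq n w w') = jump_time n w + fst (w' 0)"
    by (simp add: jump_time_Suc *) (simp add: comb_seq_def)
qed

lemma emeasure_path_law_wait:
  assumes y: "y \<in> space E" and t: "0 \<le> t"
  shows "emeasure (path_law y) {w \<in> space path_space. ereal t < fst (w 0)} = ennreal (exp (- Lam t y))"
proof -
  have [measurable]: "wait y \<in> borel_measurable borel" using y by measurable
  have "emeasure (path_law y) {w \<in> space path_space. ereal t < fst (w 0)}
    = (\<integral>\<^sup>+w. indicator {w \<in> space path_space. ereal t < fst (w 0)} w \<partial>path_law y)"
    by simp
  also have "\<dots> = (\<integral>\<^sup>+a. \<integral>\<^sup>+w. indicator {w \<in> space path_space. ereal t < fst (w 0)} (case_nat (wait y (fst a), y) w) \<partial>path_law (next_state y a) \<partial>step_law)"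
    by (rule path_law_first_step[OF y]) measurable
  also have "\<dots> = (\<integral>\<^sup>+a. \<integral>\<^sup>+w. indicator {c. ereal t < wait y c} (fst a) \<partial>path_law (next_state y a) \<partial>step_law)"
    by (intro nn_integral_cong) (use y in \<open>auto simp: indicator_def case_nat_in_path_space\<close>)
  also have "\<dots> = (\<integral>\<^sup>+a. indicator {c. ereal t < wait y c} (fst a) \<partial>step_law)"
    using prob_space.emeasure_space_1[OF prob_space_path_law[OF next_state_in_space[OF y]]]
    by simp
  also have "\<dots> = emeasure unit_exponential {c. ereal t < wait y c}"
    by (subst nn_integral_step_law_fst) auto
  finally show ?thesis using emeasure_less_wait[OF assms] by simp
qed

text \<open>The jump time has density \<open>rate * exp (- Lam)\<close> along the trajectory, which
  vanishes where the rate does. So almost surely no jump leaves from a state of rate zero, where the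
  kernel has no meaning.\<close>

lemma AE_unit_exponential_rate_pos:
  assumes y: "y \<in> space E"
  shows "AE c in unit_exponential. wait y c < \<infinity> \<longrightarrow> 0 < rate (\<phi> (real_of_ereal (wait y c)) y)"
proof -
  have [measurable]: "wait y \<in> borel_measurable borel" "(\<lambda>s. rate (\<phi> s y)) \<in> borel_measurable borel" using y by measurable
  let ?A = "{c. wait y c < \<infinity> \<and> rate (\<phi> (real_of_ereal (wait y c)) y) = 0}"
  have "emeasure unit_exponential ?A = (\<integral>\<^sup>+c. indicator ?A c \<partial>unit_exponential)" by simp
  also have "\<dots> = (\<integral>\<^sup>+c. (if wait y c < \<infinity> then indicator {s. rate (\<phi> s y) = 0} (real_of_ereal (wait y c)) else 0) \<partial>unit_exponential)"
    by (intro nn_integral_cong) (auto simp: indicator_def)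
  also have "\<dots> = (\<integral>\<^sup>+s. ennreal (rate (\<phi> s y) * exp (- Lam s y)) * indicator {0..} s * indicator {s. rate (\<phi> s y) = 0} s \<partial>lborel)"
    by (rule nn_integral_wait[OF y]) measurable
  also have "\<dots> = (\<integral>\<^sup>+s. 0 \<partial>(lborel :: real measure))"
    by (intro nn_integral_cong) (auto simp: indicator_def)
  finally have "emeasure unit_exponential ?A = 0" by simp
  then have "AE c in unit_exponential. c \<notin> ?A"
    by (intro AE_not_in) (auto simp: null_sets_def)
  then show ?thesis
    by eventually_elim (use total_rate_nonneg[OF flow_in_space[OF y]] in \<open>auto simp: less_le\<close>)
qed

end

text \<open>\<open>B z t\<close> bounds the rate along all possible trajectories from \<open>z\<close> up to time \<open>t\<close>.\<close>

locale nonexplosive_pdmp = pdmp_setup E \<phi> r F for E :: "'s measure" and \<phi> r F +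
  fixes B :: "'s \<Rightarrow> real \<Rightarrow> real"
  assumes singleton_sets: "z \<in> space E \<Longrightarrow> {z} \<in> sets E"
    and rate_bound: "z \<in> space E \<Longrightarrow> 0 \<le> s \<Longrightarrow> s \<le> t \<Longrightarrow> rate (\<phi> s z) \<le> B z t"
    and bound_jump: "z \<in> space E \<Longrightarrow> 0 \<le> s \<Longrightarrow> s \<le> t \<Longrightarrow> B (F i (\<phi> s z)) (t - s) \<le> B z t"
begin

lemma AE_path_law_start:
  assumes z: "z \<in> space E"
  shows "AE w in path_law z. snd (w 0) = z"
proof -
  have [measurable]: "{z} \<in> sets E" by (rule singleton_sets[OF z])
  have "{w \<in> space path_space. snd (w 0) \<in> {z}} \<in> sets path_space" by measurable
  then have "(AE w in path_law z. snd (w 0) = z) \<longleftrightarrow> (AE \<omega> in step_seq.S. snd (path z \<omega> 0) = z)"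
    unfolding path_law_def using z by (intro AE_distr_iff) simp_all
  then show ?thesis by (simp add: path_def)
qed

section \<open>Absence of explosion and the law of the constructed jumps\<close>

text \<open>A clock that rings at time \<open>u\<close> has used at most \<open>B z t * u\<close> of
  integrated rate, and \<open>bound_jump\<close> passes the same bound on to the remaining time
  \<open>t - u\<close>. The sum of these contributions does not depend on \<open>n\<close>.\<close>

lemma sum_le_bound:
  assumes "z \<in> space E" "jump_time n (path z \<omega>) \<le> ereal t" "0 \<le> t"
  shows "(\<Sum>k<n. fst (\<omega> k)) \<le> B z t * t"
  using assms
proof (induction n arbitrary: z t \<omega>)
  case 0
  have "0 \<le> rate (\<phi> 0 z)" using 0 by (intro total_rate_nonneg) auto
  also have "\<dots> \<le> B z t" using 0 by (intro rate_bound) auto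
  finally show ?case using 0 by simp
next
  case (Suc n)
  note z = Suc.prems(1)
  define a where "a = \<omega> 0"
  define \<omega>' where "\<omega>' = (\<lambda>k. \<omega> (Suc k))"
  have \<omega>: "\<omega> = case_nat a \<omega>'" by (auto simp: a_def \<omega>'_def fun_eq_iff split: nat.split)
  have T: "jump_time (Suc n) (path z \<omega>) = wait z (fst a) + jump_time n (path (next_state z a) \<omega>')"
    unfolding \<omega> path_case_nat jump_time_case_nat ..
  have T0: "0 \<le> jump_time n (path (next_state z a) \<omega>')"
    unfolding jump_time_def path_def by (intro sum_nonneg) (simp add: wait_nonneg)
  obtain u where u: "wait z (fst a) = ereal u" "0 \<le> u" "u \<le> t" "jump_time n (path (next_state z a) \<omega>') \<le> ereal (t - u)"
    using T T0 wait_nonneg[of z "fst a"] Suc.prems(2)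
    by (cases "wait z (fst a)"; cases "jump_time n (path (next_state z a) \<omega>')") auto
  obtain i where i: "next_state z a = F i (\<phi> u z)"
    using u(1) by (auto simp: next_state_def Let_def)
  have "fst a \<le> Lam u z" by (rule Lam_wait_ge[OF z u(1)])
  also have "\<dots> \<le> integral {0..u} (\<lambda>s. B z t)"
    unfolding Lam_def using u by (intro integral_le rate_integrable_on[OF z] integrable_const_ivl rate_bound[OF z]) auto
  finally have 1: "fst a \<le> B z t * u" using u by (simp add: mult.commute)
  have "(\<Sum>k<n. fst (\<omega>' k)) \<le> B (next_state z a) (t - u) * (t - u)"
    using z u by (intro Suc.IH) auto
  also have "\<dots> \<le> B z t * (t - u)"
    unfolding i using u by (intro mult_right_mono bound_jump[OF z]) auto
  finally have 2: "(\<Sum>k<n. fst (\<omega>' k)) \<le> B z t * (t - u)" .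
  have "(\<Sum>k<Suc n. fst (\<omega> k)) = fst a + (\<Sum>k<n. fst (\<omega>' k))"
    unfolding sum.lessThan_Suc_shift by (simp add: a_def \<omega>'_def)
  then show ?case using 1 2 by (simp add: algebra_simps)
qed

text \<open>If all jump times stayed at most \<open>m\<close>, then \<open>sum_le_bound\<close>
  would bound all partial sums of the clocks, against
  \<open>AE_sum_step_seq_unbounded\<close>.\<close>

lemma AE_regular_path:
  assumes z: "z \<in> space E"
  shows "AE w in path_law z. regular_path w"
proof -
  have "AE \<omega> in step_seq.S. 0 < fst (\<omega> n)" for n
    by (rule AE_PiM_component[where I = UNIV and M = "\<lambda>_. step_law"]) (simp_all add: prob_space_step_law AE_step_law_pos)
  then have "AE \<omega> in step_seq.S. \<forall>n. 0 < fst (\<omega> n)" by (simp add: AE_all_countable)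
  then have "AE \<omega> in step_seq.S. regular_path (path z \<omega>)"
    using AE_sum_step_seq_unbounded
  proof eventually_elim
    case (elim \<omega>)
    have "\<exists>n. ereal (real m) < jump_time n (path z \<omega>)" for m
    proof -
      obtain n where "B z (real m) * real m < (\<Sum>k<n. fst (\<omega> k))" using elim(2) by blast
      then show ?thesis
        using sum_le_bound[OF z, of n \<omega> "real m"] by (auto simp: not_le[symmetric])
    qed
    then show ?case
      using elim(1) z unfolding regular_path_def positive_path_def
      by (auto simp: path_def wait_pos)
  qed
  moreover have "(AE w in path_law z. regular_path w) \<longleftrightarrow> (AE \<omega> in step_seq.S. regular_path (path z \<omega>))"
    unfolding path_law_def using z by (intro AE_distr_iff) simp_all
  ultimately show ?thesis by simp
qed

text \<open>Restart at index \<open>n\<close>: replacing everything from there on by a fresh path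
  leaves the events of the history unchanged, and the new holding time has survival function
  \<open>exp (- Lam t y)\<close> for the state \<open>y\<close> in entry \<open>n\<close>.\<close>

lemma path_law_T_law:
  assumes z: "z \<in> space E" and t: "0 \<le> t"
  defines "Y \<equiv> \<lambda>n w. snd (w n)"
  shows "AE w in path_law z. jump_time n w < \<infinity> \<longrightarrow>
           real_cond_exp (path_law z) (jump_history (path_law z) E jump_time Y n n)
             (indicator {w \<in> space (path_law z). jump_time (Suc n) w > jump_time n w + ereal t}) w
           = exp (- integral {0..t} (\<lambda>s. rate (\<phi> s (Y n w))))"
proof -
  interpret prob_space "path_law z" by (rule prob_space_path_law[OF z])
  let ?F = "jump_history (path_law z) E jump_time Y n n"
  have TY [measurable]: "jump_time k \<in> borel_measurable (path_law z)" "Y k \<in> path_law z \<rightarrow>\<^sub>M E" for k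
    unfolding Y_def by measurable
  have F [measurable]: "jump_time n \<in> borel_measurable ?F" "Y n \<in> ?F \<rightarrow>\<^sub>M E"
    by (auto intro!: jump_history_measurable_T jump_history_measurable_Y TY)
  have sub: "subalgebra (path_law z) ?F" by (rule subalgebra_jump_history[OF TY])
  let ?B = "{w \<in> space path_space. jump_time n w < \<infinity>}"
  have "{w \<in> space ?F. jump_time n w < \<infinity>} \<in> sets ?F" by measurable
  then have BF: "?B \<in> sets ?F" by simp
  let ?A = "{w \<in> space (path_law z). jump_time (Suc n) w > jump_time n w + ereal t}"
  have A: "?A \<in> sets (path_law z)" by measurable
  have "AE w in path_law z. w \<in> ?B \<longrightarrow> real_cond_exp (path_law z) ?F (indicator ?A) w = exp (- Lam t (Y n w))"
  proof (rule real_cond_exp_indicatorI[OF sub A BF])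
    fix H assume H: "H \<in> sets ?F" "H \<subseteq> ?B"
    have HM [measurable]: "H \<in> sets path_space" using sub H(1) by (auto simp: subalgebra_def)
    have [measurable]: "?A \<in> sets path_space" using A by simp
    have "emeasure (path_law z) (H \<inter> ?A) = (\<integral>\<^sup>+w. indicator (H \<inter> ?A) w \<partial>path_law z)"
      by simp
    also have "\<dots> = (\<integral>\<^sup>+w. \<integral>\<^sup>+w'. indicator (H \<inter> ?A) (comb_seq n w w') \<partial>path_law (snd (w n)) \<partial>path_law z)"
      by (rule path_law_restart[OF z]) measurable
    also have "\<dots> = (\<integral>\<^sup>+w. indicator H w * ennreal (exp (- Lam t (Y n w))) \<partial>path_law z)"
    proof (rule nn_integral_cong_AE)
      show "AE w in path_law z. (\<integral>\<^sup>+w'. indicator (H \<inter> ?A) (comb_seq n w w') \<partial>path_law (snd (w n)))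
        = indicator H w * ennreal (exp (- Lam t (Y n w)))"
        using AE_regular_path[OF z] AE_space
      proof eventually_elim
        case (elim w)
        then have w: "w \<in> space path_space" by simp
        then have y: "snd (w n) \<in> space E" by (rule path_space_snd)
        have pos: "0 \<le> jump_time n w" using elim(1) by (auto simp: regular_path_def intro: jump_time_nonneg)
        have "(\<integral>\<^sup>+w'. indicator (H \<inter> ?A) (comb_seq n w w') \<partial>path_law (snd (w n)))
          = (\<integral>\<^sup>+w'. indicator H w * indicator {w \<in> space path_space. ereal t < fst (w 0)} w' \<partial>path_law (snd (w n)))"
        proof (rule nn_integral_cong_AE)
          show "AE w' in path_law (snd (w n)). indicator (H \<inter> ?A) (comb_seq n w w')
              = (indicator H w * indicator {w \<in> space path_space. ereal t < fst (w 0)} w' :: ennreal)"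
            using AE_path_law_start[OF y] AE_space
          proof eventually_elim
            case (elim w')
            then have w': "w' \<in> space path_space" by simp
            have c: "comb_seq n w w' \<in> space path_space" by (rule comb_seq_in_path_space[OF w w'])
            \<comment> \<open>Entry \<open>n\<close> of the glued path comes from \<open>w'\<close>;
              its state is still that of \<open>w\<close>, because \<open>w'\<close> almost surely
              starts there.\<close>
            have "comb_seq n w w' \<in> H \<longleftrightarrow> w \<in> H"
            proof (rule jump_history_determined[OF H(1)])
              show "Y k (comb_seq n w w') = Y k w" if "k \<le> n" for k
                using elim(1) that by (auto simp: Y_def comb_seq_def)
            qed (use c w in \<open>auto simp: jump_time_comb_seq\<close>)
            \<comment> \<open>Inside \<open>H\<close> the time \<open>jump_time n w\<close> is
              finite and can be cancelled.\<close>
            moreover have "jump_time n w + ereal t < jump_time n w + fst (w' 0) \<longleftrightarrow> ereal t < fst (w' 0)" if "w \<in> H"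
              using that H(2) pos by (cases "jump_time n w"; cases "fst (w' 0)") auto
            ultimately show ?case
              using c w' by (auto simp: indicator_def jump_time_comb_seq)
          qed
        qed
        also have "\<dots> = indicator H w * emeasure (path_law (snd (w n))) {w \<in> space path_space. ereal t < fst (w 0)}"
          by (rule nn_integral_cmult_indicator) measurable
        also have "\<dots> = indicator H w * ennreal (exp (- Lam t (Y n w)))"
          using emeasure_path_law_wait[OF y t] by (simp add: Y_def)
        finally show ?case .
      qed
    qed
    finally show "emeasure (path_law z) (H \<inter> ?A) = (\<integral>\<^sup>+w. indicator H w * ennreal (exp (- Lam t (Y n w))) \<partial>path_law z)" .
  qed auto
  then show ?thesis
    using AE_space by eventually_elim (auto simp: Lam_def)
qed

text \<open>The history now contains the holding time \<open>n\<close> but not the next state. So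
  after the restart at \<open>n\<close> one more step is split off: its clock fixes the jump time,
  and its uniform variable, independent of the clock, selects the jump.\<close>

lemma path_law_Y_law:
  assumes z: "z \<in> space E" and A: "A \<in> sets E"
  defines "Y \<equiv> \<lambda>n w. snd (w n)"
  shows "AE w in path_law z. jump_time (Suc n) w < \<infinity> \<longrightarrow>
           real_cond_exp (path_law z) (jump_history (path_law z) E jump_time Y (Suc n) n)
             (indicator {w \<in> space (path_law z). Y (Suc n) w \<in> A}) w
           = jump_kernel (\<phi> (real_of_ereal (jump_time (Suc n) w) - real_of_ereal (jump_time n w)) (Y n w)) A"
proof -
  interpret prob_space "path_law z" by (rule prob_space_path_law[OF z])
  interpret U: prob_space unit_uniform by (rule prob_space_unit_uniform)
  note A [measurable]
  let ?F = "jump_history (path_law z) E jump_time Y (Suc n) n"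
  have TY [measurable]: "jump_time k \<in> borel_measurable (path_law z)" "Y k \<in> path_law z \<rightarrow>\<^sub>M E" for k
    unfolding Y_def by measurable
  have F [measurable]: "jump_time n \<in> borel_measurable ?F" "jump_time (Suc n) \<in> borel_measurable ?F" "Y n \<in> ?F \<rightarrow>\<^sub>M E"
    by (auto intro!: jump_history_measurable_T jump_history_measurable_Y TY)
  have sub: "subalgebra (path_law z) ?F" by (rule subalgebra_jump_history[OF TY])
  let ?B = "{w \<in> space path_space. jump_time (Suc n) w < \<infinity>}"
  have "{w \<in> space ?F. jump_time (Suc n) w < \<infinity>} \<in> sets ?F" by measurable
  then have BF: "?B \<in> sets ?F" by simp
  let ?A = "{w \<in> space (path_law z). Y (Suc n) w \<in> A}"
  have AM: "?A \<in> sets (path_law z)" by measurable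
  let ?X = "\<lambda>w. \<phi> (real_of_ereal (jump_time (Suc n) w) - real_of_ereal (jump_time n w)) (Y n w)"
  have "AE w in path_law z. w \<in> ?B \<longrightarrow> real_cond_exp (path_law z) ?F (indicator ?A) w = jump_kernel (?X w) A"
  proof (rule real_cond_exp_indicatorI[OF sub AM BF])
    show "(\<lambda>w. jump_kernel (?X w) A) \<in> borel_measurable ?F"
      unfolding jump_kernel_def by measurable
    show "0 \<le> jump_kernel (?X w) A" if "w \<in> space (path_law z)" for w
    proof -
      have X: "?X w \<in> space E" using measurable_space[OF TY(2) that] by simp
      have "summable (\<lambda>i. r i (?X w) / rate (?X w) * indicator A (F i (?X w)))"
        by (rule summable_comparison_test'[OF summable_divide[OF rate_summable[OF X], of "rate (?X w)"], of 0])
          (use rate_nonneg total_rate_nonneg[OF X] in \<open>auto simp: indicator_def\<close>)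
      then show ?thesis
        unfolding jump_kernel_def by (intro suminf_nonneg) (use rate_nonneg total_rate_nonneg[OF X] in auto)
    qed
    fix H assume H: "H \<in> sets ?F" "H \<subseteq> ?B"
    have HM [measurable]: "H \<in> sets path_space" using sub H(1) by (auto simp: subalgebra_def)
    have [measurable]: "?A \<in> sets path_space" using AM by simp
    have [measurable]: "Y k \<in> path_space \<rightarrow>\<^sub>M E" for k unfolding Y_def by measurable
    have step: "(\<integral>\<^sup>+w. f w \<partial>path_law z) = (\<integral>\<^sup>+w. \<integral>\<^sup>+a. \<integral>\<^sup>+w'. f (comb_seq n w (case_nat (wait (Y n w) (fst a), Y n w) w'))
        \<partial>path_law (next_state (Y n w) a) \<partial>step_law \<partial>path_law z)"
      if [measurable]: "f \<in> borel_measurable path_space" for f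
    proof -
      have "(\<integral>\<^sup>+w. f w \<partial>path_law z) = (\<integral>\<^sup>+w. \<integral>\<^sup>+w'. f (comb_seq n w w') \<partial>path_law (snd (w n)) \<partial>path_law z)"
        by (rule path_law_restart[OF z]) fact
      also have "\<dots> = (\<integral>\<^sup>+w. \<integral>\<^sup>+a. \<integral>\<^sup>+w'. f (comb_seq n w (case_nat (wait (Y n w) (fst a), Y n w) w'))
        \<partial>path_law (next_state (Y n w) a) \<partial>step_law \<partial>path_law z)"
        unfolding Y_def by (intro nn_integral_cong path_law_first_step path_space_snd) simp_all
      finally show ?thesis .
    qed
    \<comment> \<open>A reference path with \<open>n\<close>-th holding time \<open>s\<close>. Its
      tail is filled with \<open>w\<close> itself, since events of the history do not look beyond
      entry \<open>n\<close>.\<close>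
    define u where "u w s = comb_seq n w (case_nat (s, Y n w) w)" for w s
    have "emeasure (path_law z) (H \<inter> ?A) = (\<integral>\<^sup>+w. indicator (H \<inter> ?A) w \<partial>path_law z)"
      by simp
    also have "\<dots> = (\<integral>\<^sup>+w. \<integral>\<^sup>+a. \<integral>\<^sup>+w'. indicator (H \<inter> ?A) (comb_seq n w (case_nat (wait (Y n w) (fst a), Y n w) w'))
        \<partial>path_law (next_state (Y n w) a) \<partial>step_law \<partial>path_law z)"
      by (rule step) measurable
    also have "\<dots> = (\<integral>\<^sup>+w. \<integral>\<^sup>+a. \<integral>\<^sup>+w'. indicator H (comb_seq n w (case_nat (wait (Y n w) (fst a), Y n w) w'))
          * ennreal (jump_kernel (?X (comb_seq n w (case_nat (wait (Y n w) (fst a), Y n w) w'))) A)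
        \<partial>path_law (next_state (Y n w) a) \<partial>step_law \<partial>path_law z)"
    proof (rule nn_integral_cong_AE)
      show "AE w in path_law z.
          (\<integral>\<^sup>+a. \<integral>\<^sup>+w'. indicator (H \<inter> ?A) (comb_seq n w (case_nat (wait (Y n w) (fst a), Y n w) w')) \<partial>path_law (next_state (Y n w) a) \<partial>step_law)
        = (\<integral>\<^sup>+a. \<integral>\<^sup>+w'. indicator H (comb_seq n w (case_nat (wait (Y n w) (fst a), Y n w) w'))
          * ennreal (jump_kernel (?X (comb_seq n w (case_nat (wait (Y n w) (fst a), Y n w) w'))) A) \<partial>path_law (next_state (Y n w) a) \<partial>step_law)"
        using AE_regular_path[OF z] AE_space
      proof eventually_elim
        case (elim w)
        then have w: "w \<in> space path_space" by simp
        define y where "y = Y n w"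
        have y [simp]: "y \<in> space E" unfolding y_def Y_def by (rule path_space_snd[OF w])
        have pos: "0 \<le> jump_time n w" using elim(1) by (auto simp: regular_path_def intro: jump_time_nonneg)
        \<comment> \<open>Of the history event, the state before the jump and the state after it,
          only the last depends on the tail \<open>w'\<close>, and it is the start of that
          tail.\<close>
        have u_eq: "indicator H (comb_seq n w (case_nat (s, y) w')) = (indicator H (u w s) :: ennreal)"
          "Y (Suc n) (comb_seq n w (case_nat (s, y) w')) = snd (w' 0)"
          "comb_seq n w (case_nat (s, y) w') \<in> space path_space"
          "indicator H (u w s) \<noteq> (0::ennreal) \<Longrightarrow> 0 \<le> s \<Longrightarrow> s < \<infinity> \<and> ?X (comb_seq n w (case_nat (s, y) w')) = \<phi> (real_of_ereal s) y"
          if w': "w' \<in> space path_space" for s w'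
        proof -
          show c: "comb_seq n w (case_nat (s, y) w') \<in> space path_space" for s
            by (intro comb_seq_in_path_space case_nat_in_path_space w w' y)
          have u: "u w s \<in> space path_space"
            unfolding u_def using w y by (intro comb_seq_in_path_space case_nat_in_path_space) (simp_all add: y_def)
          have "comb_seq n w (case_nat (s, y) w') \<in> H \<longleftrightarrow> u w s \<in> H"
          proof (rule jump_history_determined[OF H(1)])
            show "jump_time k (comb_seq n w (case_nat (s, y) w')) = jump_time k (u w s)" if "k \<le> Suc n" for k
            proof (cases "k = Suc n")
              case True
              then show ?thesis unfolding True u_def jump_time_comb_seq(2) by simp
            next
              case False
              with that have "k \<le> n" by simp
              then show ?thesis unfolding u_def by (simp add: jump_time_comb_seq(1))
            qed
            show "Y k (comb_seq n w (case_nat (s, y) w')) = Y k (u w s)" if "k \<le> n" for k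
              using that by (auto simp: Y_def u_def comb_seq_def y_def)
          qed (use c u in simp_all)
          then show "indicator H (comb_seq n w (case_nat (s, y) w')) = (indicator H (u w s) :: ennreal)"
            by (simp add: indicator_def)
          show "Y (Suc n) (comb_seq n w (case_nat (s, y) w')) = snd (w' 0)"
            by (simp add: Y_def comb_seq_def Suc_diff_le)
          show "s < \<infinity> \<and> ?X (comb_seq n w (case_nat (s, y) w')) = \<phi> (real_of_ereal s) y"
            if nz: "indicator H (u w s) \<noteq> (0::ennreal)" and s: "0 \<le> s"
          proof -
            have "u w s \<in> ?B" using nz H(2) by (auto simp: indicator_def split: if_splits)
            then have "jump_time n w + s < \<infinity>" by (simp add: u_def jump_time_comb_seq)
            then obtain p q where pq: "jump_time n w = ereal p" "s = ereal q"
              using pos s by (cases "jump_time n w"; cases s) auto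
            then show ?thesis
              by (simp add: jump_time_comb_seq) (simp add: Y_def comb_seq_def)
          qed
        qed
        have [measurable]: "u w \<in> borel \<rightarrow>\<^sub>M path_space"
        proof -
          have "(\<lambda>s. case_nat (s, y) w) \<in> borel \<rightarrow>\<^sub>M path_space"
            using w by (intro measurable_case_nat') (auto)
          then show ?thesis
            unfolding u_def y_def[symmetric]
            using measurable_compose[OF measurable_Pair[OF measurable_const[OF w]], OF _ measurable_comb_seq] by fastforce
        qed
        have [measurable]: "wait y \<in> borel_measurable borel" by measurable
        have "(\<integral>\<^sup>+a. \<integral>\<^sup>+w'. indicator (H \<inter> ?A) (comb_seq n w (case_nat (wait y (fst a), y) w')) \<partial>path_law (next_state y a) \<partial>step_law)
          = (\<integral>\<^sup>+a. indicator H (u w (wait y (fst a))) * indicator A (next_state y a) \<partial>step_law)"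
        proof (rule nn_integral_cong)
          fix a
          interpret P: prob_space "path_law (next_state y a)" by (rule prob_space_path_law) simp
          have "(\<integral>\<^sup>+w'. indicator (H \<inter> ?A) (comb_seq n w (case_nat (wait y (fst a), y) w')) \<partial>path_law (next_state y a))
            = (\<integral>\<^sup>+w'. indicator H (u w (wait y (fst a))) * indicator A (next_state y a) \<partial>path_law (next_state y a))"
          proof (rule nn_integral_cong_AE)
            show "AE w' in path_law (next_state y a). indicator (H \<inter> ?A) (comb_seq n w (case_nat (wait y (fst a), y) w'))
              = (indicator H (u w (wait y (fst a))) * indicator A (next_state y a) :: ennreal)"
              using AE_path_law_start[OF next_state_in_space[OF y], of a] AE_space
            proof eventually_elim
              case (elim w')
              then have w': "w' \<in> space path_space" by simp
              have "indicator ?A (comb_seq n w (case_nat (wait y (fst a), y) w')) = (indicator A (next_state y a) :: ennreal)"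
                using u_eq(2,3)[OF w', of "wait y (fst a)"] elim(1) by (simp add: indicator_def)
              then show ?case
                using u_eq(1)[OF w', of "wait y (fst a)"] by (simp add: indicator_inter_arith)
            qed
          qed
          then show "(\<integral>\<^sup>+w'. indicator (H \<inter> ?A) (comb_seq n w (case_nat (wait y (fst a), y) w')) \<partial>path_law (next_state y a))
            = indicator H (u w (wait y (fst a))) * indicator A (next_state y a)"
            using P.emeasure_space_1 by simp
        qed
        also have "\<dots> = (\<integral>\<^sup>+c. \<integral>\<^sup>+v. indicator H (u w (wait y c)) * indicator A (next_state y (c, v)) \<partial>unit_uniform \<partial>unit_exponential)"
          by (subst nn_integral_step_law) simp_all
        also have "\<dots> = (\<integral>\<^sup>+c. indicator H (u w (wait y c)) * ennreal (jump_kernel (\<phi> (real_of_ereal (wait y c)) y) A) \<partial>unit_exponential)"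
        proof (rule nn_integral_cong_AE)
          \<comment> \<open>Positivity of the rate at the jump holds almost surely and is what
            \<open>pick_law\<close> asks for; outside the history event both sides vanish.\<close>
          show "AE c in unit_exponential. (\<integral>\<^sup>+v. indicator H (u w (wait y c)) * indicator A (next_state y (c, v)) \<partial>unit_uniform)
            = indicator H (u w (wait y c)) * ennreal (jump_kernel (\<phi> (real_of_ereal (wait y c)) y) A)"
            using AE_unit_exponential_rate_pos[OF y]
          proof eventually_elim
            case (elim c)
            show ?case
            proof (cases "indicator H (u w (wait y c)) = (0::ennreal)")
              case False
              then have fin: "wait y c < \<infinity>"
                using u_eq(4)[OF w False wait_nonneg] by simp
              let ?y = "\<phi> (real_of_ereal (wait y c)) y"
              have "(\<integral>\<^sup>+v. indicator A (next_state y (c, v)) \<partial>unit_uniform) = (\<integral>\<^sup>+v. indicator A (F (pick ?y v) ?y) \<partial>unit_uniform)"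
                using fin by (simp add: next_state_def Let_def)
              also have "\<dots> = ennreal (jump_kernel ?y A)"
                using elim fin by (subst pick_law) (simp_all add: ennreal_jump_kernel)
              finally show ?thesis by (simp add: nn_integral_cmult)
            qed simp
          qed
        qed
        also have "\<dots> = (\<integral>\<^sup>+a. indicator H (u w (wait y (fst a))) * ennreal (jump_kernel (\<phi> (real_of_ereal (wait y (fst a))) y) A) \<partial>step_law)"
          unfolding jump_kernel_def
          by (rule nn_integral_step_law_fst[symmetric]) measurable
        also have "\<dots> = (\<integral>\<^sup>+a. \<integral>\<^sup>+w'. indicator H (comb_seq n w (case_nat (wait y (fst a), y) w'))
          * ennreal (jump_kernel (?X (comb_seq n w (case_nat (wait y (fst a), y) w'))) A) \<partial>path_law (next_state y a) \<partial>step_law)"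
        proof (rule nn_integral_cong)
          fix a
          interpret P: prob_space "path_law (next_state y a)" by (rule prob_space_path_law) simp
          have "(\<integral>\<^sup>+w'. indicator H (comb_seq n w (case_nat (wait y (fst a), y) w'))
              * ennreal (jump_kernel (?X (comb_seq n w (case_nat (wait y (fst a), y) w'))) A) \<partial>path_law (next_state y a))
            = (\<integral>\<^sup>+w'. indicator H (u w (wait y (fst a))) * ennreal (jump_kernel (\<phi> (real_of_ereal (wait y (fst a))) y) A) \<partial>path_law (next_state y a))"
          proof (rule nn_integral_cong)
            fix w' assume "w' \<in> space (path_law (next_state y a))"
            then have w': "w' \<in> space path_space" by simp
            show "indicator H (comb_seq n w (case_nat (wait y (fst a), y) w'))
              * ennreal (jump_kernel (?X (comb_seq n w (case_nat (wait y (fst a), y) w'))) A)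
              = indicator H (u w (wait y (fst a))) * ennreal (jump_kernel (\<phi> (real_of_ereal (wait y (fst a))) y) A)"
            proof (cases "indicator H (u w (wait y (fst a))) = (0::ennreal)")
              case True
              then show ?thesis unfolding u_eq(1)[OF w'] by simp
            next
              case False
              show ?thesis
                unfolding u_eq(1)[OF w'] conjunct2[OF u_eq(4)[OF w' False wait_nonneg]] ..
            qed
          qed
          then show "indicator H (u w (wait y (fst a))) * ennreal (jump_kernel (\<phi> (real_of_ereal (wait y (fst a))) y) A)
            = (\<integral>\<^sup>+w'. indicator H (comb_seq n w (case_nat (wait y (fst a), y) w'))
              * ennreal (jump_kernel (?X (comb_seq n w (case_nat (wait y (fst a), y) w'))) A) \<partial>path_law (next_state y a))"
            using P.emeasure_space_1 by simp
        qed
        finally show ?case unfolding y_def .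
      qed
    qed
    also have "\<dots> = (\<integral>\<^sup>+w. indicator H w * ennreal (jump_kernel (?X w) A) \<partial>path_law z)"
      by (rule step[symmetric]) (unfold jump_kernel_def, measurable)
    finally show "emeasure (path_law z) (H \<inter> ?A) = (\<integral>\<^sup>+w. indicator H w * ennreal (jump_kernel (?X w) A) \<partial>path_law z)" .
  qed
  then show ?thesis
    using AE_space by eventually_elim auto
qed

lemma process_eq:
  assumes "positive_path w" "jump_time n w \<le> ereal t" "ereal t < jump_time (Suc n) w"
  shows "process t w = \<phi> (t - real_of_ereal (jump_time n w)) (snd (w n))"
proof -
  have "(LEAST n. jump_time n w \<le> ereal t \<and> ereal t < jump_time (Suc n) w) = n"
    using assms(2,3) by (intro Least_equality) (simp, metis jump_index_unique[OF assms] order_refl)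
  moreover have "\<exists>n. jump_time n w \<le> ereal t \<and> ereal t < jump_time (Suc n) w"
    using assms(2,3) by blast
  ultimately show ?thesis
    unfolding process_def Let_def by simp
qed

lemma path_law_follows_jump_dynamics:
  assumes z: "z \<in> space E"
  shows "follows_jump_dynamics E \<phi> rate jump_kernel z (path_law z) process"
  unfolding follows_jump_dynamics_def
proof (rule exI[of _ jump_time], rule exI[of _ "\<lambda>n w. snd (w n)"], intro conjI allI ballI impI)
  show "AE w in path_law z. jump_time 0 w = 0 \<and> snd (w 0) = z"
    using AE_path_law_start[OF z] by simp
  show "AE w in path_law z. \<forall>n. if jump_time n w < \<infinity> then jump_time n w < jump_time (Suc n) w else jump_time (Suc n) w = \<infinity>"
    using AE_regular_path[OF z] by eventually_elim (intro allI jump_time_increasing, simp add: regular_path_def)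
  show "AE w in path_law z. (\<lambda>n. jump_time n w) \<longlonglongrightarrow> \<infinity>"
    using AE_regular_path[OF z] by eventually_elim (rule jump_time_unbounded)
  show "AE w in path_law z. \<forall>n t. jump_time n w \<le> ereal t \<and> ereal t < jump_time (Suc n) w \<longrightarrow>
      process t w = \<phi> (t - real_of_ereal (jump_time n w)) (snd (w n))"
    using AE_regular_path[OF z] by eventually_elim (auto simp: regular_path_def intro: process_eq)
  show "jump_time n \<in> borel_measurable (path_law z)" "(\<lambda>w. snd (w n)) \<in> path_law z \<rightarrow>\<^sub>M E" for n
    by measurable
qed (rule path_law_T_law[OF z] path_law_Y_law[OF z], assumption)+

end

section \<open>The Markov property\<close>

lemma space_natural_filtration [simp]: "space (natural_filtration N E Z t) = space N"
  unfolding natural_filtration_def by (rule space_measure_of) auto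

lemma sets_natural_filtration:
  "sets (natural_filtration N E Z t) =
    sigma_sets (space N) {Z r -` A \<inter> space N | r A. 0 \<le> r \<and> r \<le> t \<and> A \<in> sets E}"
  unfolding natural_filtration_def by (rule sets_measure_of) auto

lemma subalgebra_natural_filtration:
  assumes "\<And>r. 0 \<le> r \<Longrightarrow> Z r \<in> N \<rightarrow>\<^sub>M E" "sets M = sets N"
  shows "subalgebra M (natural_filtration N E Z t)"
  unfolding subalgebra_def sets_natural_filtration assms(2)
  using sets_eq_imp_space_eq[OF assms(2)]
  by (auto intro!: sets.sigma_sets_subset measurable_sets[OF assms(1)])

lemma natural_filtration_measurable:
  assumes "Z r \<in> N \<rightarrow>\<^sub>M E" "0 \<le> r" "r \<le> t"
  shows "Z r \<in> natural_filtration N E Z t \<rightarrow>\<^sub>M E"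
proof (rule measurableI)
  fix A assume "A \<in> sets E"
  then show "Z r -` A \<inter> space (natural_filtration N E Z t) \<in> sets (natural_filtration N E Z t)"
    unfolding sets_natural_filtration space_natural_filtration using assms(2,3) by (intro sigma_sets.Basic) blast
qed (use measurable_space[OF assms(1)] in simp)

context nonexplosive_pdmp
begin

lemma process_before:
  assumes "positive_path (case_nat (s, y) w)" "0 \<le> t" "ereal t < s"
  shows "process t (case_nat (s, y) w) = \<phi> t y"
  using process_eq[OF assms(1), of 0 t] assms(2,3) jump_time_case_nat[of 0 s y w] by (simp add: zero_ereal_def)

lemma process_after:
  assumes w: "regular_path w" and u: "0 < u" "u \<le> t"
  shows "process t (case_nat (ereal u, y) w) = process (t - u) w"
proof -
  have pos: "positive_path w" "positive_path (case_nat (ereal u, y) w)"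
    using w u by (auto simp: regular_path_def positive_path_case_nat)
  obtain n where n: "jump_time n w \<le> ereal (t - u)" "ereal (t - u) < jump_time (Suc n) w"
    using regular_path_index[OF w, of "t - u"] u by auto
  obtain p where p: "jump_time n w = ereal p"
    using n(1) jump_time_nonneg[OF pos(1), of n] by (cases "jump_time n w") auto
  have 1: "jump_time (Suc n) (case_nat (ereal u, y) w) = ereal (u + p)"
    by (simp add: jump_time_case_nat p)
  have 2: "ereal t < jump_time (Suc (Suc n)) (case_nat (ereal u, y) w)"
    unfolding jump_time_case_nat using n(2) by (cases "jump_time (Suc n) w") auto
  have "process t (case_nat (ereal u, y) w) = \<phi> (t - (u + p)) (snd (w n))"
    using process_eq[OF pos(2) _ 2] n(1) by (simp add: 1 p)
  also have "\<dots> = process (t - u) w"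
    using process_eq[OF pos(1) n] by (simp add: p algebra_simps)
  finally show ?thesis .
qed

text \<open>A cylinder event at the times in \<open>R\<close>, split by the number \<open>n\<close>
  of jumps up to \<open>s\<close>; this number is the induction variable for the Markov
  property.\<close>

definition observed :: "nat \<Rightarrow> real \<Rightarrow> real set \<Rightarrow> (real \<Rightarrow> 's set) \<Rightarrow> (nat \<Rightarrow> ereal \<times> 's) \<Rightarrow> ennreal" where
  "observed n s R A w =
    (if (\<forall>r\<in>R. process r w \<in> A r) \<and> jump_time n w \<le> ereal s \<and> ereal s < jump_time (Suc n) w then 1 else 0)"

lemma observed_measurable:
  assumes "finite R" "\<And>r. A r \<in> sets E"
  shows "observed n s R A \<in> borel_measurable path_space"
proof -
  note [measurable] = assms(2)
  have "{w \<in> space path_space. \<forall>r\<in>R. process r w \<in> A r} \<in> sets path_space"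
    by (rule sets.sets_Collect_finite_All[OF _ assms(1)]) measurable
  then have [measurable]: "Measurable.pred path_space (\<lambda>w. \<forall>r\<in>R. process r w \<in> A r)"
    by (simp add: pred_def)
  show ?thesis unfolding observed_def by measurable
qed

definition semigroup :: "('s \<Rightarrow> ennreal) \<Rightarrow> real \<Rightarrow> 's \<Rightarrow> ennreal" where
  "semigroup f t z = (\<integral>\<^sup>+w. f (process t w) \<partial>path_law z)"

lemma semigroup_measurable:
  assumes [measurable]: "f \<in> borel_measurable E"
  shows "semigroup f t \<in> borel_measurable E"
  unfolding semigroup_def by measurable

text \<open>The expectation with the first clock and uniform variable still visible; the lack of
  memory of the clock acts on this argument.\<close>

definition after_step :: "('s \<Rightarrow> ennreal) \<Rightarrow> real \<Rightarrow> 's \<Rightarrow> real \<times> real \<Rightarrow> ennreal" where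
  "after_step f t z a =
    (\<integral>\<^sup>+w. f (process t (case_nat (wait z (fst a), z) w)) \<partial>path_law (next_state z a))"

lemma after_step_measurable:
  assumes z: "z \<in> space E" and [measurable]: "f \<in> borel_measurable E"
  shows "after_step f t z \<in> borel_measurable (borel \<Otimes>\<^sub>M borel)"
  unfolding after_step_def
proof (rule nn_integral_measurable_subprob_algebra2)
  show "(\<lambda>a. path_law (next_state z a)) \<in> borel \<Otimes>\<^sub>M borel \<rightarrow>\<^sub>M subprob_algebra path_space"
    using z by measurable
  have [measurable]: "wait z \<in> borel_measurable borel" using z by measurable
  have "(\<lambda>x. case_nat (wait z (fst (fst x)), z) (snd x)) \<in> (borel \<Otimes>\<^sub>M borel) \<Otimes>\<^sub>M path_space \<rightarrow>\<^sub>M path_space"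
    using z by (intro measurable_case_nat') measurable
  then have [measurable]: "(\<lambda>x. process t (case_nat (wait z (fst (fst x)), z) (snd x))) \<in> (borel \<Otimes>\<^sub>M borel) \<Otimes>\<^sub>M path_space \<rightarrow>\<^sub>M E"
    by (rule measurable_compose[OF _ process_measurable])
  show "(\<lambda>(x, y). f (process t (case_nat (wait z (fst x), z) y))) \<in> borel_measurable ((borel \<Otimes>\<^sub>M borel) \<Otimes>\<^sub>M path_space)"
    unfolding split_beta' by measurable
qed

lemma semigroup_eq_after_step:
  assumes "z \<in> space E" and [measurable]: "f \<in> borel_measurable E"
  shows "semigroup f t z = (\<integral>\<^sup>+a. after_step f t z a \<partial>step_law)"
  unfolding semigroup_def after_step_def by (rule path_law_first_step) (use assms in measurable)

text \<open>Flowing for time \<open>s\<close> and reducing the clock by \<open>Lam s z\<close>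
  describe the same future. Either there is no jump up to \<open>s + t\<close> and both sides sit on
  the same flow line, or the jump happens at the same time and place with the same
  \<open>v\<close>.\<close>

lemma after_step_shift:
  assumes z: "z \<in> space E" and s: "0 \<le> s" and t: "0 \<le> t" and c: "Lam s z < c" "0 < c"
  shows "after_step f (s + t) z (c, v) = after_step f t (\<phi> s z) (c - Lam s z, v)"
proof -
  define \<sigma> where "\<sigma> = wait (\<phi> s z) (c - Lam s z)"
  have wait: "wait z c = ereal s + \<sigma>" unfolding \<sigma>_def by (rule wait_shift[OF z s c(1)])
  have pos: "0 < wait z c" "0 < \<sigma>"
    using z c unfolding \<sigma>_def by (auto intro!: wait_pos)
  have before: "process (s + t) (case_nat (wait z c, z) w) = \<phi> (s + t) z"
    "process t (case_nat (\<sigma>, \<phi> s z) w) = \<phi> (s + t) z"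
    if "positive_path w" "ereal t < \<sigma>" for w
  proof -
    have "ereal (s + t) < wait z c" using that(2) unfolding wait by (cases \<sigma>) auto
    then show "process (s + t) (case_nat (wait z c, z) w) = \<phi> (s + t) z"
      using that pos s t by (intro process_before) (auto simp: positive_path_case_nat)
    show "process t (case_nat (\<sigma>, \<phi> s z) w) = \<phi> (s + t) z"
      unfolding flow_add[OF z] using that pos t by (intro process_before) (auto simp: positive_path_case_nat)
  qed
  show ?thesis
  proof (cases "ereal t < \<sigma>")
    case True
    have const: "(\<integral>\<^sup>+w. f (process (s + t) (case_nat (wait z c, z) w)) \<partial>path_law y) = f (\<phi> (s + t) z)"
      "(\<integral>\<^sup>+w. f (process t (case_nat (\<sigma>, \<phi> s z) w)) \<partial>path_law y) = f (\<phi> (s + t) z)" if y: "y \<in> space E" for y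
    proof -
      have 1: "(\<integral>\<^sup>+w. f (\<phi> (s + t) z) \<partial>path_law y) = f (\<phi> (s + t) z)"
        using prob_space.emeasure_space_1[OF prob_space_path_law[OF y]] by simp
      have "AE w in path_law y. positive_path w"
        using AE_regular_path[OF y] by eventually_elim (simp add: regular_path_def)
      then have "AE w in path_law y. f (process (s + t) (case_nat (wait z c, z) w)) = f (\<phi> (s + t) z)"
        "AE w in path_law y. f (process t (case_nat (\<sigma>, \<phi> s z) w)) = f (\<phi> (s + t) z)"
        by (eventually_elim, simp add: before True)+
      from this[THEN nn_integral_cong_AE] show "(\<integral>\<^sup>+w. f (process (s + t) (case_nat (wait z c, z) w)) \<partial>path_law y) = f (\<phi> (s + t) z)"
        "(\<integral>\<^sup>+w. f (process t (case_nat (\<sigma>, \<phi> s z) w)) \<partial>path_law y) = f (\<phi> (s + t) z)"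
        unfolding 1 by simp_all
    qed
    show ?thesis
      unfolding after_step_def fst_conv \<sigma>_def[symmetric] using z by (simp add: const)
  next
    case False
    then obtain q where q: "\<sigma> = ereal q" "0 < q" "q \<le> t"
      using pos by (cases \<sigma>) auto
    have next_eq: "next_state z (c, v) = next_state (\<phi> s z) (c - Lam s z, v)"
      using wait q by (simp add: next_state_def Let_def flow_add[OF z] \<sigma>_def[symmetric])
    have "(\<integral>\<^sup>+w. f (process (s + t) (case_nat (wait z c, z) w)) \<partial>path_law (next_state z (c, v)))
      = (\<integral>\<^sup>+w. f (process t (case_nat (\<sigma>, \<phi> s z) w)) \<partial>path_law (next_state z (c, v)))"
    proof (rule nn_integral_cong_AE)
      show "AE w in path_law (next_state z (c, v)). f (process (s + t) (case_nat (wait z c, z) w)) = f (process t (case_nat (\<sigma>, \<phi> s z) w))"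
        using AE_regular_path[OF next_state_in_space[OF z]]
      proof eventually_elim
        case (elim w)
        have "process (s + t) (case_nat (ereal (s + q), z) w) = process (s + t - (s + q)) w"
          using q s by (intro process_after[OF elim]) auto
        moreover have "process t (case_nat (ereal q, \<phi> s z) w) = process (t - q) w"
          using q by (intro process_after[OF elim]) auto
        ultimately show ?case by (simp add: wait q)
      qed
    qed
    then show ?thesis
      unfolding after_step_def fst_conv \<sigma>_def[symmetric] next_eq .
  qed
qed

text \<open>Without a jump up to \<open>s\<close> the past is deterministic: the observations reduce
  to the constant \<open>b\<close> and the event to \<open>Lam s z < c\<close>. Lack of memory then
  produces \<open>b * exp (- Lam s z) * semigroup f t (\<phi> s z)\<close> on both sides.\<close>

lemma markov_observed_0:
  assumes z: "z \<in> space E" and s: "0 \<le> s" and t: "0 \<le> t" and R: "finite R" "R \<subseteq> {0..s}" and A: "\<And>r. A r \<in> sets E"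
    and f [measurable]: "f \<in> borel_measurable E"
  shows "(\<integral>\<^sup>+w. observed 0 s R A w * f (process (s + t) w) \<partial>path_law z)
    = (\<integral>\<^sup>+w. observed 0 s R A w * semigroup f t (process s w) \<partial>path_law z)"
proof -
  note [measurable] = observed_measurable[OF R(1) A] semigroup_measurable[OF f] after_step_measurable[OF _ f]
  interpret U: prob_space unit_uniform by (rule prob_space_unit_uniform)
  define b where "b = (if \<forall>r\<in>R. \<phi> r z \<in> A r then 1 else 0 :: ennreal)"
  define y where "y = \<phi> s z"
  have y: "y \<in> space E" using z by (simp add: y_def)
  have L: "0 \<le> Lam s z" by (rule Lam_nonneg[OF z])
  have obs: "observed 0 s R A (case_nat (wait z c, z) w) = (if Lam s z < c then b else 0)"
    "Lam s z < c \<Longrightarrow> process s (case_nat (wait z c, z) w) = y"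
    if w: "positive_path w" and c: "0 < c" for c w
  proof -
    have pos: "positive_path (case_nat (wait z c, z) w)"
      using w wait_pos[OF z c] by (simp add: positive_path_case_nat)
    have T: "jump_time (Suc 0) (case_nat (wait z c, z) w) = wait z c"
      by (simp add: jump_time_case_nat)
    have iff: "ereal s < wait z c \<longleftrightarrow> Lam s z < c" by (rule less_wait_iff[OF z s])
    have pr: "process r (case_nat (wait z c, z) w) = \<phi> r z" if "Lam s z < c" "0 \<le> r" "r \<le> s" for r
      using that iff by (intro process_before[OF pos]) (auto intro: le_less_trans[of _ "ereal s"])
    show "observed 0 s R A (case_nat (wait z c, z) w) = (if Lam s z < c then b else 0)"
    proof (cases "Lam s z < c")
      case True
      have "(\<forall>r\<in>R. process r (case_nat (wait z c, z) w) \<in> A r) \<longleftrightarrow> (\<forall>r\<in>R. \<phi> r z \<in> A r)"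
        using pr[OF True] R(2) by (intro ball_cong) auto
      then show ?thesis using True s iff by (simp add: observed_def T b_def zero_ereal_def)
    next
      case False
      then show ?thesis using iff by (simp add: observed_def T)
    qed
    show "Lam s z < c \<Longrightarrow> process s (case_nat (wait z c, z) w) = y"
      unfolding y_def using pr s by simp
  qed
  have AEpos: "AE w in path_law (next_state z a). positive_path w" for a
    using AE_regular_path[OF next_state_in_space[OF z]] by eventually_elim (simp add: regular_path_def)
  have cm [measurable]: "(\<lambda>w. process u (case_nat (wait z c, z) w)) \<in> path_space \<rightarrow>\<^sub>M E" for u c
  proof -
    have "(\<lambda>w. case_nat (wait z c, z) w) \<in> path_space \<rightarrow>\<^sub>M path_space"
      using z by (intro measurable_case_nat') measurable
    then show ?thesis by (rule measurable_compose[OF _ process_measurable])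
  qed
  have "(\<integral>\<^sup>+w. observed 0 s R A w * f (process (s + t) w) \<partial>path_law z)
    = (\<integral>\<^sup>+a. \<integral>\<^sup>+w. observed 0 s R A (case_nat (wait z (fst a), z) w) * f (process (s + t) (case_nat (wait z (fst a), z) w)) \<partial>path_law (next_state z a) \<partial>step_law)"
    by (rule path_law_first_step[OF z]) measurable
  also have "\<dots> = (\<integral>\<^sup>+a. b * (if Lam s z < fst a then after_step f t y (fst a - Lam s z, snd a) else 0) \<partial>step_law)"
  proof (rule nn_integral_cong_AE)
    show "AE a in step_law. (\<integral>\<^sup>+w. observed 0 s R A (case_nat (wait z (fst a), z) w) * f (process (s + t) (case_nat (wait z (fst a), z) w)) \<partial>path_law (next_state z a))
      = b * (if Lam s z < fst a then after_step f t y (fst a - Lam s z, snd a) else 0)"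
      using AE_step_law_pos
    proof eventually_elim
      case (elim a)
      have "(\<integral>\<^sup>+w. observed 0 s R A (case_nat (wait z (fst a), z) w) * f (process (s + t) (case_nat (wait z (fst a), z) w)) \<partial>path_law (next_state z a))
        = (\<integral>\<^sup>+w. (if Lam s z < fst a then b else 0) * f (process (s + t) (case_nat (wait z (fst a), z) w)) \<partial>path_law (next_state z a))"
        using AEpos[of a] by (intro nn_integral_cong_AE, eventually_elim) (simp only: obs(1)[OF _ elim])
      also have "\<dots> = (if Lam s z < fst a then b else 0) * after_step f (s + t) z a"
        unfolding after_step_def by (rule nn_integral_cmult) measurable
      finally show ?case
        using after_step_shift[OF z s t _ elim, of f "snd a"] by (simp add: y_def)
    qed
  qed
  also have "\<dots> = b * (\<integral>\<^sup>+a. (if Lam s z < fst a then after_step f t y (fst a - Lam s z, snd a) else 0) \<partial>step_law)"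
    using y by (intro nn_integral_cmult) measurable
  also have "(\<integral>\<^sup>+a. (if Lam s z < fst a then after_step f t y (fst a - Lam s z, snd a) else 0) \<partial>step_law)
    = (\<integral>\<^sup>+c. (if Lam s z < c then (\<integral>\<^sup>+v. after_step f t y (c - Lam s z, v) \<partial>unit_uniform) else 0) \<partial>unit_exponential)"
    using y by (subst nn_integral_step_law) (auto intro!: nn_integral_cong)
  also have "\<dots> = ennreal (exp (- Lam s z)) * (\<integral>\<^sup>+c. (\<integral>\<^sup>+v. after_step f t y (c, v) \<partial>unit_uniform) \<partial>unit_exponential)"
    using y L by (intro nn_integral_unit_exponential_shift U.borel_measurable_nn_integral) measurable
  also have "(\<integral>\<^sup>+c. (\<integral>\<^sup>+v. after_step f t y (c, v) \<partial>unit_uniform) \<partial>unit_exponential) = semigroup f t y"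
    using y by (simp add: semigroup_eq_after_step nn_integral_step_law)
  finally have lhs: "(\<integral>\<^sup>+w. observed 0 s R A w * f (process (s + t) w) \<partial>path_law z) = b * (ennreal (exp (- Lam s z)) * semigroup f t y)" .
  have "(\<integral>\<^sup>+w. observed 0 s R A w * semigroup f t (process s w) \<partial>path_law z)
    = (\<integral>\<^sup>+a. \<integral>\<^sup>+w. observed 0 s R A (case_nat (wait z (fst a), z) w) * semigroup f t (process s (case_nat (wait z (fst a), z) w)) \<partial>path_law (next_state z a) \<partial>step_law)"
    by (rule path_law_first_step[OF z]) measurable
  also have "\<dots> = (\<integral>\<^sup>+a. b * semigroup f t y * indicator {Lam s z<..} (fst a) \<partial>step_law)"
  proof (rule nn_integral_cong_AE)
    show "AE a in step_law. (\<integral>\<^sup>+w. observed 0 s R A (case_nat (wait z (fst a), z) w) * semigroup f t (process s (case_nat (wait z (fst a), z) w)) \<partial>path_law (next_state z a))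
      = b * semigroup f t y * indicator {Lam s z<..} (fst a)"
      using AE_step_law_pos
    proof eventually_elim
      case (elim a)
      have "(\<integral>\<^sup>+w. observed 0 s R A (case_nat (wait z (fst a), z) w) * semigroup f t (process s (case_nat (wait z (fst a), z) w)) \<partial>path_law (next_state z a))
        = (\<integral>\<^sup>+w. b * semigroup f t y * indicator {Lam s z<..} (fst a) \<partial>path_law (next_state z a))"
      proof (rule nn_integral_cong_AE)
        show "AE w in path_law (next_state z a). observed 0 s R A (case_nat (wait z (fst a), z) w) * semigroup f t (process s (case_nat (wait z (fst a), z) w))
          = b * semigroup f t y * indicator {Lam s z<..} (fst a)"
          using AEpos[of a]
        proof eventually_elim
          case w: (elim w)
          show ?case using obs[OF w elim] by (cases "Lam s z < fst a") (simp_all add: indicator_def)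
        qed
      qed
      also have "\<dots> = b * semigroup f t y * indicator {Lam s z<..} (fst a)"
        using prob_space.emeasure_space_1[OF prob_space_path_law[OF next_state_in_space[OF z], of a]] by simp
      finally show ?case .
    qed
  qed
  also have "\<dots> = b * semigroup f t y * ennreal (exp (- Lam s z))"
    by (subst nn_integral_step_law_fst[of "\<lambda>c. b * semigroup f t y * indicator {Lam s z<..} c"])
      (simp_all add: nn_integral_cmult_indicator emeasure_unit_exponential_greaterThan L)
  finally show ?thesis unfolding lhs by (simp add: ac_simps)
qed

text \<open>Given a first jump at \<open>u\<close>, observation times below \<open>u\<close> are
  decided by the flow from \<open>z\<close>; the others are shifted by \<open>u\<close> and seen by
  the path restarted after the jump, which has one jump less before the shifted present.\<close>

lemma markov_observed:
  assumes "z \<in> space E" "0 \<le> s" "0 \<le> t" "finite R" "R \<subseteq> {0..s}" "\<And>r. A r \<in> sets E"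
    and f [measurable]: "f \<in> borel_measurable E"
  shows "(\<integral>\<^sup>+w. observed n s R A w * f (process (s + t) w) \<partial>path_law z)
    = (\<integral>\<^sup>+w. observed n s R A w * semigroup f t (process s w) \<partial>path_law z)"
  using assms(1-6)
proof (induction n arbitrary: z s R A)
  case 0
  then show ?case by (intro markov_observed_0 f)
next
  case (Suc n)
  note z = Suc.prems(1) and R = Suc.prems(4,5) and A = Suc.prems(6)
  note [measurable] = observed_measurable[OF R(1) A] semigroup_measurable[OF f]
  have cm [measurable]: "(\<lambda>w. case_nat (x, z) w) \<in> path_space \<rightarrow>\<^sub>M path_space" for x :: ereal
    using z by (intro measurable_case_nat') measurable
  have "AE a in step_law.
      (\<integral>\<^sup>+w. observed (Suc n) s R A (case_nat (wait z (fst a), z) w) * f (process (s + t) (case_nat (wait z (fst a), z) w)) \<partial>path_law (next_state z a))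
    = (\<integral>\<^sup>+w. observed (Suc n) s R A (case_nat (wait z (fst a), z) w) * semigroup f t (process s (case_nat (wait z (fst a), z) w)) \<partial>path_law (next_state z a))"
    using AE_step_law_pos
  proof eventually_elim
    case (elim a)
    define y where "y = next_state z a"
    have y: "y \<in> space E" using z by (simp add: y_def)
    have pos: "0 < wait z (fst a)" by (rule wait_pos[OF z elim])
    have reg: "AE w in path_law y. regular_path w" by (rule AE_regular_path[OF y])
    show ?case unfolding y_def[symmetric]
    proof (cases "wait z (fst a) \<le> ereal s")
      \<comment> \<open>A first jump after \<open>s\<close> leaves no room for \<open>Suc n\<close>
        jumps up to \<open>s\<close>, so both integrands vanish.\<close>
      case False
      have "AE w in path_law y. observed (Suc n) s R A (case_nat (wait z (fst a), z) w) = 0"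
        using reg
      proof eventually_elim
        case (elim w)
        have "0 \<le> jump_time n w" using elim by (auto simp: regular_path_def intro: jump_time_nonneg)
        then have "wait z (fst a) + 0 \<le> jump_time (Suc n) (case_nat (wait z (fst a), z) w)"
          unfolding jump_time_case_nat by (rule add_left_mono)
        then have "\<not> jump_time (Suc n) (case_nat (wait z (fst a), z) w) \<le> ereal s"
          using False by (auto intro: order_trans)
        then show ?case by (simp add: observed_def)
      qed
      then have "AE w in path_law y.
          observed (Suc n) s R A (case_nat (wait z (fst a), z) w) * f (process (s + t) (case_nat (wait z (fst a), z) w))
        = observed (Suc n) s R A (case_nat (wait z (fst a), z) w) * semigroup f t (process s (case_nat (wait z (fst a), z) w))"
        by eventually_elim simp
      then show "(\<integral>\<^sup>+w. observed (Suc n) s R A (case_nat (wait z (fst a), z) w) * f (process (s + t) (case_nat (wait z (fst a), z) w)) \<partial>path_law y)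
        = (\<integral>\<^sup>+w. observed (Suc n) s R A (case_nat (wait z (fst a), z) w) * semigroup f t (process s (case_nat (wait z (fst a), z) w)) \<partial>path_law y)"
        by (rule nn_integral_cong_AE)
    next
      case True
      then obtain u where u: "wait z (fst a) = ereal u" "0 < u" "u \<le> s"
        using pos by (cases "wait z (fst a)") auto
      \<comment> \<open>\<open>b\<close> records the observations before the first jump;
        \<open>R'\<close> and \<open>A'\<close> are the later ones in the time of the restarted
        path.\<close>
      define b where "b = (if \<forall>r\<in>R. r < u \<longrightarrow> \<phi> r z \<in> A r then 1 else 0 :: ennreal)"
      define R' where "R' = (\<lambda>r. r - u) ` {r \<in> R. u \<le> r}"
      define A' where "A' r = A (r + u)" for r
      have R': "finite R'" "R' \<subseteq> {0..s - u}" using R by (auto simp: R'_def)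
      have A': "A' r \<in> sets E" for r using A by (simp add: A'_def)
      note [measurable] = observed_measurable[OF R'(1) A']
      have eq: "AE w in path_law y. observed (Suc n) s R A (case_nat (ereal u, z) w) = b * observed n (s - u) R' A' w
          \<and> process s (case_nat (ereal u, z) w) = process (s - u) w
          \<and> process (s + t) (case_nat (ereal u, z) w) = process ((s - u) + t) w"
        using reg
      proof eventually_elim
        case (elim w)
        have p: "positive_path (case_nat (ereal u, z) w)"
          using elim u by (simp add: positive_path_case_nat regular_path_def)
        have "(\<forall>r\<in>R. process r (case_nat (ereal u, z) w) \<in> A r)
          \<longleftrightarrow> (\<forall>r\<in>R. r < u \<longrightarrow> \<phi> r z \<in> A r) \<and> (\<forall>r\<in>R. u \<le> r \<longrightarrow> process (r - u) w \<in> A r)"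
        proof -
          have "process r (case_nat (ereal u, z) w) = (if r < u then \<phi> r z else process (r - u) w)" if "r \<in> R" for r
            using that R(2) u process_before[OF p, of r] process_after[OF elim u(2), of r z] by auto
          then show ?thesis by (auto simp: not_less split: if_splits)
        qed
        also have "(\<forall>r\<in>R. u \<le> r \<longrightarrow> process (r - u) w \<in> A r) \<longleftrightarrow> (\<forall>r\<in>R'. process r w \<in> A' r)"
          by (auto simp: R'_def A'_def)
        finally have 1: "(\<forall>r\<in>R. process r (case_nat (ereal u, z) w) \<in> A r)
          \<longleftrightarrow> (\<forall>r\<in>R. r < u \<longrightarrow> \<phi> r z \<in> A r) \<and> (\<forall>r\<in>R'. process r w \<in> A' r)" .
        have 2: "jump_time (Suc m) (case_nat (ereal u, z) w) \<le> ereal s \<longleftrightarrow> jump_time m w \<le> ereal (s - u)" for m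
          unfolding jump_time_case_nat by (cases "jump_time m w") auto
        show ?case
          unfolding observed_def 1 2 not_le[symmetric] b_def
          using process_after[OF elim u(2), of s z] process_after[OF elim u(2), of "s + t" z] u Suc.prems(3)
          by (auto simp: algebra_simps)
      qed
      have "(\<integral>\<^sup>+w. observed (Suc n) s R A (case_nat (ereal u, z) w) * f (process (s + t) (case_nat (ereal u, z) w)) \<partial>path_law y)
        = (\<integral>\<^sup>+w. b * (observed n (s - u) R' A' w * f (process ((s - u) + t) w)) \<partial>path_law y)"
        using eq by (intro nn_integral_cong_AE, eventually_elim) (simp add: mult.assoc)
      also have "\<dots> = b * (\<integral>\<^sup>+w. observed n (s - u) R' A' w * f (process ((s - u) + t) w) \<partial>path_law y)"
        by (rule nn_integral_cmult) measurable
      also have "\<dots> = b * (\<integral>\<^sup>+w. observed n (s - u) R' A' w * semigroup f t (process (s - u) w) \<partial>path_law y)"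
        using Suc.IH[OF y _ Suc.prems(3) R' A'] u by simp
      also have "\<dots> = (\<integral>\<^sup>+w. b * (observed n (s - u) R' A' w * semigroup f t (process (s - u) w)) \<partial>path_law y)"
        by (rule nn_integral_cmult[symmetric]) measurable
      also have "\<dots> = (\<integral>\<^sup>+w. observed (Suc n) s R A (case_nat (ereal u, z) w) * semigroup f t (process s (case_nat (ereal u, z) w)) \<partial>path_law y)"
        using eq by (intro nn_integral_cong_AE, eventually_elim) (simp add: mult.assoc)
      finally show "(\<integral>\<^sup>+w. observed (Suc n) s R A (case_nat (wait z (fst a), z) w) * f (process (s + t) (case_nat (wait z (fst a), z) w)) \<partial>path_law y)
        = (\<integral>\<^sup>+w. observed (Suc n) s R A (case_nat (wait z (fst a), z) w) * semigroup f t (process s (case_nat (wait z (fst a), z) w)) \<partial>path_law y)"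
        unfolding u(1) .
    qed
  qed
  then have "(\<integral>\<^sup>+a. \<integral>\<^sup>+w. observed (Suc n) s R A (case_nat (wait z (fst a), z) w) * f (process (s + t) (case_nat (wait z (fst a), z) w)) \<partial>path_law (next_state z a) \<partial>step_law)
    = (\<integral>\<^sup>+a. \<integral>\<^sup>+w. observed (Suc n) s R A (case_nat (wait z (fst a), z) w) * semigroup f t (process s (case_nat (wait z (fst a), z) w)) \<partial>path_law (next_state z a) \<partial>step_law)"
    by (rule nn_integral_cong_AE)
  moreover have "(\<integral>\<^sup>+w. observed (Suc n) s R A w * f (process (s + t) w) \<partial>path_law z)
    = (\<integral>\<^sup>+a. \<integral>\<^sup>+w. observed (Suc n) s R A (case_nat (wait z (fst a), z) w) * f (process (s + t) (case_nat (wait z (fst a), z) w)) \<partial>path_law (next_state z a) \<partial>step_law)"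
    by (rule path_law_first_step[OF z]) measurable
  moreover have "(\<integral>\<^sup>+w. observed (Suc n) s R A w * semigroup f t (process s w) \<partial>path_law z)
    = (\<integral>\<^sup>+a. \<integral>\<^sup>+w. observed (Suc n) s R A (case_nat (wait z (fst a), z) w) * semigroup f t (process s (case_nat (wait z (fst a), z) w)) \<partial>path_law (next_state z a) \<partial>step_law)"
    by (rule path_law_first_step[OF z]) measurable
  ultimately show ?case by simp
qed

lemma markov_cylinder:
  assumes z: "z \<in> space E" and s: "0 \<le> s" and t: "0 \<le> t" and R: "finite R" "R \<subseteq> {0..s}" and A: "\<And>r. A r \<in> sets E"
    and f [measurable]: "f \<in> borel_measurable E"
  defines "H \<equiv> {w \<in> space path_space. \<forall>r\<in>R. process r w \<in> A r}"
  shows "(\<integral>\<^sup>+w. indicator H w * f (process (s + t) w) \<partial>path_law z)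
    = (\<integral>\<^sup>+w. indicator H w * semigroup f t (process s w) \<partial>path_law z)"
proof -
  note [measurable] = observed_measurable[OF R(1) A] semigroup_measurable[OF f]
  have sum: "(\<integral>\<^sup>+w. indicator H w * g w \<partial>path_law z) = (\<Sum>n. \<integral>\<^sup>+w. observed n s R A w * g w \<partial>path_law z)"
    if [measurable]: "g \<in> borel_measurable path_space" for g
  proof -
    have "(\<integral>\<^sup>+w. indicator H w * g w \<partial>path_law z) = (\<integral>\<^sup>+w. (\<Sum>n. observed n s R A w * g w) \<partial>path_law z)"
    proof (rule nn_integral_cong_AE)
      show "AE w in path_law z. indicator H w * g w = (\<Sum>n. observed n s R A w * g w)"
        using AE_regular_path[OF z] AE_space
      proof eventually_elim
        case (elim w)
        obtain n where n: "jump_time n w \<le> ereal s" "ereal s < jump_time (Suc n) w"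
          by (rule regular_path_index[OF elim(1) s])
        have "positive_path w" using elim(1) by (simp add: regular_path_def)
        note unique = jump_index_unique[OF this n]
        have "(\<Sum>m. observed m s R A w * g w) = (\<Sum>m\<in>{n}. observed m s R A w * g w)"
          by (rule suminf_finite) (use unique in \<open>auto simp: observed_def\<close>)
        also have "\<dots> = indicator H w * g w"
          using n elim(2) by (simp add: observed_def H_def indicator_def)
        finally show ?case by simp
      qed
    qed
    also have "\<dots> = (\<Sum>n. \<integral>\<^sup>+w. observed n s R A w * g w \<partial>path_law z)"
      by (rule nn_integral_suminf) measurable
    finally show ?thesis .
  qed
  show ?thesis
    by (simp add: sum markov_observed[OF z s t R A f])
qed

text \<open>Finite-time cylinders are stable under intersection and generate the past, so two finite
  measures that agree on them agree on all events of the past.\<close>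

lemma markov_filtration:
  assumes z: "z \<in> space E" and s: "0 \<le> s" and t: "0 \<le> t"
    and C [measurable]: "C \<in> sets E" and H: "H \<in> sets (natural_filtration path_space E process s)"
  shows "emeasure (path_law z) (H \<inter> {w \<in> space path_space. process (s + t) w \<in> C})
    = (\<integral>\<^sup>+w. indicator H w * emeasure (path_law (process s w)) {w \<in> space path_space. process t w \<in> C} \<partial>path_law z)"
proof -
  interpret prob_space "path_law z" by (rule prob_space_path_law[OF z])
  let ?F = "natural_filtration path_space E process s"
  define G where "G = {{w \<in> space path_space. \<forall>r\<in>R. process r w \<in> A r} | R A. finite R \<and> R \<subseteq> {0..s} \<and> (\<forall>r. A r \<in> sets E)}"
  define m1 where "m1 = density (path_law z) (indicator {w \<in> space path_space. process (s + t) w \<in> C})"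
  define m2 where "m2 = density (path_law z) (\<lambda>w. semigroup (indicator C) t (process s w))"
  have [measurable]: "semigroup (indicator C) t \<in> borel_measurable E" by (rule semigroup_measurable) simp
  have sub: "subalgebra m1 ?F" "subalgebra m2 ?F"
    by (rule subalgebra_natural_filtration; simp add: m1_def m2_def)+
  have HM: "K \<in> sets path_space" if "K \<in> sets ?F" for K
    using sub(1) that by (auto simp: subalgebra_def m1_def)
  have e1: "emeasure m1 K = emeasure (path_law z) (K \<inter> {w \<in> space path_space. process (s + t) w \<in> C})"
    if [measurable]: "K \<in> sets path_space" for K
    unfolding m1_def by (subst emeasure_restricted) (auto simp: Int_commute)
  have e2: "emeasure m2 K = (\<integral>\<^sup>+w. indicator K w * semigroup (indicator C) t (process s w) \<partial>path_law z)"
    if [measurable]: "K \<in> sets path_space" for K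
    unfolding m2_def by (subst emeasure_density) (auto simp: mult.commute)
  have GF: "K \<in> sets ?F" if KG: "K \<in> G" for K
  proof -
    obtain R A where K: "K = {w \<in> space path_space. \<forall>r\<in>R. process r w \<in> A r}" and R: "finite R" "R \<subseteq> {0..s}" and A: "\<And>r. A r \<in> sets E"
      using KG unfolding G_def by blast
    have "{w \<in> space ?F. \<forall>r\<in>R. process r w \<in> A r} \<in> sets ?F"
    proof (rule sets.sets_Collect_finite_All[OF _ R(1)])
      fix r assume "r \<in> R"
      then have [measurable]: "process r \<in> ?F \<rightarrow>\<^sub>M E"
        using R(2) by (intro natural_filtration_measurable) auto
      show "{w \<in> space ?F. process r w \<in> A r} \<in> sets ?F" using A by measurable
    qed
    then show ?thesis by (simp add: K)
  qed
  have sets_F: "sets ?F = sigma_sets (space path_space) G"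
  proof
    have "a \<in> G" if "a \<in> {process r -` A \<inter> space path_space |r A. 0 \<le> r \<and> r \<le> s \<and> A \<in> sets E}" for a
    proof -
      from that obtain r A where "a = process r -` A \<inter> space path_space" "0 \<le> r" "r \<le> s" "A \<in> sets E" by auto
      then show ?thesis
        unfolding G_def by (intro CollectI exI[of _ "{r}"] exI[of _ "\<lambda>_. A"]) auto
    qed
    then show "sets ?F \<subseteq> sigma_sets (space path_space) G"
      unfolding sets_natural_filtration by (intro sigma_sets_mono) auto
    have "G \<subseteq> sets ?F" using GF by auto
    from sets.sigma_sets_subset[OF this] show "sigma_sets (space path_space) G \<subseteq> sets ?F" by simp
  qed
  have cyl: "emeasure m1 K = emeasure m2 K" if K: "K \<in> G" for K
  proof -
    obtain R A where KR: "K = {w \<in> space path_space. \<forall>r\<in>R. process r w \<in> A r}" and R: "finite R" "R \<subseteq> {0..s}" and A: "\<And>r. A r \<in> sets E"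
      using K unfolding G_def by blast
    have KM [measurable]: "K \<in> sets path_space" by (rule HM[OF GF[OF K]])
    have "emeasure m1 K = (\<integral>\<^sup>+w. indicator (K \<inter> {w \<in> space path_space. process (s + t) w \<in> C}) w \<partial>path_law z)"
      unfolding e1[OF KM] by simp
    also have "\<dots> = (\<integral>\<^sup>+w. indicator K w * indicator C (process (s + t) w) \<partial>path_law z)"
      by (intro nn_integral_cong) (auto simp: indicator_def)
    also have "\<dots> = emeasure m2 K"
      unfolding e2[OF KM] unfolding KR by (rule markov_cylinder[OF z s t R A]) measurable
    finally show ?thesis .
  qed
  \<comment> \<open>Agreement is asserted for the past only, hence the restriction of both measures
    to the filtration.\<close>
  have "restr_to_subalg m1 ?F = restr_to_subalg m2 ?F"
  proof (rule measure_eqI_generator_eq)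
    show "Int_stable G"
    proof (rule Int_stableI)
      fix a b assume "a \<in> G" "b \<in> G"
      then obtain R1 A1 R2 A2 where
        a: "a = {w \<in> space path_space. \<forall>r\<in>R1. process r w \<in> A1 r}" "finite R1" "R1 \<subseteq> {0..s}" "\<forall>r. A1 r \<in> sets E" and
        b: "b = {w \<in> space path_space. \<forall>r\<in>R2. process r w \<in> A2 r}" "finite R2" "R2 \<subseteq> {0..s}" "\<forall>r. A2 r \<in> sets E"
        unfolding G_def by blast
      \<comment> \<open>A time observed in only one of the two cylinders is left unconstrained by
        the other through \<open>space E\<close>.\<close>
      define A where "A r = (if r \<in> R1 then A1 r else space E) \<inter> (if r \<in> R2 then A2 r else space E)" for r
      have "process r w \<in> space E" if "w \<in> space path_space" for r w
        using measurable_space[OF process_measurable that] .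
      then have "a \<inter> b = {w \<in> space path_space. \<forall>r\<in>R1 \<union> R2. process r w \<in> A r}"
        unfolding a(1) b(1) by (auto simp: A_def)
      moreover have "A r \<in> sets E" for r using a(4) b(4) by (auto simp: A_def)
      ultimately show "a \<inter> b \<in> G"
        unfolding G_def using a(2,3) b(2,3)
        by (intro CollectI exI[of _ "R1 \<union> R2"] exI[of _ A]) auto
    qed
    show "G \<subseteq> Pow (space path_space)" by (auto simp: G_def)
    show "sets (restr_to_subalg m1 ?F) = sigma_sets (space path_space) G" "sets (restr_to_subalg m2 ?F) = sigma_sets (space path_space) G"
      using sets_restr_to_subalg[OF sub(1)] sets_restr_to_subalg[OF sub(2)] sets_F by simp_all
    show "emeasure (restr_to_subalg m1 ?F) X = emeasure (restr_to_subalg m2 ?F) X" if "X \<in> G" for X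
      using cyl[OF that] GF[OF that] sub by (simp add: emeasure_restr_to_subalg)
    have top: "space path_space \<in> G"
      unfolding G_def by (intro CollectI exI[of _ "{}"] exI[of _ "\<lambda>_. space E"]) auto
    show "range (\<lambda>_::nat. space path_space) \<subseteq> G" using top by auto
    show "(\<Union>i::nat. space path_space) = space path_space" by simp
    show "emeasure (restr_to_subalg m1 ?F) (space path_space) \<noteq> \<infinity>" for i :: nat
      using GF[OF top] sub(1) by (simp add: emeasure_restr_to_subalg e1 emeasure_eq_measure)
  qed
  then have "emeasure m1 H = emeasure m2 H"
    using emeasure_restr_to_subalg[OF sub(1) H] emeasure_restr_to_subalg[OF sub(2) H] by simp
  also have "\<dots> = (\<integral>\<^sup>+w. indicator H w * emeasure (path_law (process s w)) {w \<in> space path_space. process t w \<in> C} \<partial>path_law z)"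
    unfolding e2[OF HM[OF H]]
  proof (rule nn_integral_cong)
    fix w
    have "semigroup (indicator C) t (process s w) = (\<integral>\<^sup>+w'. indicator {w \<in> space path_space. process t w \<in> C} w' \<partial>path_law (process s w))"
      unfolding semigroup_def by (intro nn_integral_cong) (auto simp: indicator_def)
    then show "indicator H w * semigroup (indicator C) t (process s w)
      = indicator H w * emeasure (path_law (process s w)) {w \<in> space path_space. process t w \<in> C}"
      by simp
  qed
  finally show ?thesis unfolding e1[OF HM[OF H]] .
qed

theorem pdmp_path_law: "pdmp E \<phi> rate jump_kernel path_space path_law process"
  unfolding pdmp_def markov_process_def
proof (intro conjI allI ballI impI)
  show "path_law \<in> E \<rightarrow>\<^sub>M prob_algebra path_space" by (rule path_law_measurable)
  show "process t \<in> path_space \<rightarrow>\<^sub>M E" for t by (rule process_measurable)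
  fix z assume z: "z \<in> space E"
  interpret prob_space "path_law z" by (rule prob_space_path_law[OF z])
  show "AE w in path_law z. process 0 w = z"
    using AE_path_law_start[OF z] AE_regular_path[OF z]
  proof eventually_elim
    case (elim w)
    have "positive_path w" using elim(2) by (simp add: regular_path_def)
    moreover from this have "ereal 0 < jump_time (Suc 0) w"
      by (simp add: jump_time_def positive_path_def zero_ereal_def)
    ultimately show ?case
      using process_eq[of w 0 0] elim(1) z by (simp add: zero_ereal_def flow_zero)
  qed
  show "follows_jump_dynamics E \<phi> rate jump_kernel z (path_law z) process"
    by (rule path_law_follows_jump_dynamics[OF z])
  fix s t :: real and A assume s: "0 \<le> s" and t: "0 \<le> t" and A [measurable]: "A \<in> sets E"
  let ?F = "natural_filtration path_space E process s"
  let ?C = "{w \<in> space path_space. process t w \<in> A}"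
  have sub: "subalgebra (path_law z) ?F"
    by (rule subalgebra_natural_filtration) simp_all
  have "AE w in path_law z. w \<in> space ?F \<longrightarrow> real_cond_exp (path_law z) ?F (indicator {w \<in> space path_space. process (s + t) w \<in> A}) w
      = measure (path_law (process s w)) ?C"
  proof (rule real_cond_exp_indicatorI[OF sub _ sets.top])
    have [measurable]: "(\<lambda>y. measure (path_law y) ?C) \<in> borel_measurable E"
      by measurable
    have "process s \<in> ?F \<rightarrow>\<^sub>M E"
      using s by (intro natural_filtration_measurable) auto
    then show "(\<lambda>w. measure (path_law (process s w)) ?C) \<in> borel_measurable ?F"
      by measurable
    fix H assume H: "H \<in> sets ?F"
    have "emeasure (path_law (process s w)) ?C = ennreal (measure (path_law (process s w)) ?C)" if "w \<in> space path_space" for w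
    proof -
      have "process s w \<in> space E" using measurable_space[OF process_measurable that] .
      then interpret P: prob_space "path_law (process s w)" by (rule prob_space_path_law)
      show ?thesis by (rule P.emeasure_eq_measure)
    qed
    then show "emeasure (path_law z) (H \<inter> {w \<in> space path_space. process (s + t) w \<in> A})
        = (\<integral>\<^sup>+w. indicator H w * ennreal (measure (path_law (process s w)) ?C) \<partial>path_law z)"
      unfolding markov_filtration[OF z s t A H] by (intro nn_integral_cong) simp
  qed measurable
  then show "AE w in path_law z. real_cond_exp (path_law z) ?F (indicator {w \<in> space path_space. process (s + t) w \<in> A}) w
      = measure (path_law (process s w)) ?C"
    using AE_space by eventually_elim simp
qed

end

section \<open>The zigzag dynamics on Hilbert space\<close>

text \<open>\<open>polish_space\<close> adds completeness and a countable base to the inner product,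
  hence a separable Hilbert space; an orthonormal family indexed by \<open>nat\<close> makes it
  infinite dimensional.\<close>

locale hilbert_basis =
  fixes e :: "nat \<Rightarrow> 'h::{real_inner, polish_space}"
  assumes basis: "orthonormal_basis e"
begin

lemma inner_basis: "e i \<bullet> e j = (if i = j then 1 else 0)"
  using basis by (simp add: orthonormal_basis_def)

lemma norm_basis [simp]: "norm (e i) = 1"
  by (simp add: norm_eq_sqrt_inner inner_basis)

definition proj :: "nat \<Rightarrow> 'h \<Rightarrow> 'h" where
  "proj n x = (\<Sum>i<n. (x \<bullet> e i) *\<^sub>R e i)"

lemma proj_linear: "linear (proj n)"
  unfolding proj_def
  by (rule linearI) (simp_all add: inner_add_left scaleR_add_left sum.distrib scaleR_sum_right)

lemma inner_proj: "proj n x \<bullet> y = (\<Sum>i<n. (x \<bullet> e i) * (y \<bullet> e i))"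
  by (simp add: proj_def inner_sum_left) (simp add: inner_commute)

lemma proj_inner_basis: "proj n x \<bullet> e j = (if j < n then x \<bullet> e j else 0)"
proof -
  have "proj n x \<bullet> e j = (\<Sum>i<n. if i = j then x \<bullet> e j else 0)"
    unfolding inner_proj by (intro sum.cong) (auto simp: inner_basis)
  then show ?thesis by simp
qed

lemma norm_proj_square: "(norm (proj n x))\<^sup>2 = (\<Sum>i<n. (x \<bullet> e i)\<^sup>2)"
proof -
  have "(norm (proj n x))\<^sup>2 = proj n x \<bullet> proj n x" by (simp add: power2_norm_eq_inner)
  also have "\<dots> = (\<Sum>i<n. (x \<bullet> e i) * (proj n x \<bullet> e i))" by (rule inner_proj)
  also have "\<dots> = (\<Sum>i<n. (x \<bullet> e i)\<^sup>2)"
    by (intro sum.cong) (auto simp: proj_inner_basis power2_eq_square)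
  finally show ?thesis .
qed

lemma norm_minus_proj_square: "(norm (x - proj n x))\<^sup>2 = (norm x)\<^sup>2 - (\<Sum>i<n. (x \<bullet> e i)\<^sup>2)"
proof -
  have "(norm (x - proj n x))\<^sup>2 = (norm x)\<^sup>2 - 2 * (proj n x \<bullet> x) + (norm (proj n x))\<^sup>2"
    by (simp add: power2_norm_eq_inner inner_diff_left inner_diff_right inner_commute)
  moreover have "proj n x \<bullet> x = (\<Sum>i<n. (x \<bullet> e i)\<^sup>2)"
    by (simp add: inner_proj power2_eq_square)
  ultimately show ?thesis
    by (simp add: norm_proj_square)
qed

lemma bessel: "(\<Sum>i<n. (x \<bullet> e i)\<^sup>2) \<le> (norm x)\<^sup>2"
  using norm_minus_proj_square[of x n] zero_le_power2[of "norm (x - proj n x)"] by linarith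

lemma norm_minus_proj_le: "norm (x - proj n x) \<le> norm x"
  by (rule power2_le_imp_le) (simp_all add: norm_minus_proj_square sum_nonneg)

lemma proj_eventually_id:
  assumes "y \<in> span (range e)"
  shows "\<exists>N. \<forall>n\<ge>N. proj n y = y"
  using assms
proof (induction rule: span_induct)
  case (step x)
  then obtain j where x: "x = e j" by auto
  have "proj n (e j) = e j" if "Suc j \<le> n" for n
  proof -
    have "proj n (e j) = (\<Sum>i<n. if i = j then e j else 0)"
      unfolding proj_def by (intro sum.cong) (auto simp: inner_basis)
    then show ?thesis using that by simp
  qed
  then show ?case unfolding x by blast
next
  case base
  show ?case
  proof (rule subspaceI)
    show "0 \<in> {y. \<exists>N. \<forall>n\<ge>N. proj n y = y}" by (simp add: linear_0[OF proj_linear])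
    fix x y assume "x \<in> {y. \<exists>N. \<forall>n\<ge>N. proj n y = y}" "y \<in> {y. \<exists>N. \<forall>n\<ge>N. proj n y = y}"
    then obtain N1 N2 where "\<forall>n\<ge>N1. proj n x = x" "\<forall>n\<ge>N2. proj n y = y" by auto
    then show "x + y \<in> {y. \<exists>N. \<forall>n\<ge>N. proj n y = y}"
      by (auto simp: linear_add[OF proj_linear] intro!: exI[of _ "max N1 N2"])
  next
    fix c x assume "x \<in> {y. \<exists>N. \<forall>n\<ge>N. proj n y = y}"
    then show "c *\<^sub>R x \<in> {y. \<exists>N. \<forall>n\<ge>N. proj n y = y}"
      by (auto simp: linear_scale[OF proj_linear])
  qed
qed

text \<open>The map sending \<open>x\<close> to \<open>x - proj n x\<close> is linear and does not
  increase the norm, so convergence carries over from the dense span, where \<open>proj n\<close> is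
  eventually the identity.\<close>

lemma proj_tendsto: "(\<lambda>n. proj n x) \<longlonglongrightarrow> x"
proof (rule metric_LIMSEQ_I)
  fix \<epsilon> :: real assume "0 < \<epsilon>"
  have "x \<in> closure (span (range e))" using basis by (simp add: orthonormal_basis_def)
  then obtain y where y: "y \<in> span (range e)" "dist y x < \<epsilon>"
    using \<open>0 < \<epsilon>\<close> by (auto simp: closure_approachable)
  obtain N where N: "\<And>n. N \<le> n \<Longrightarrow> proj n y = y" using proj_eventually_id[OF y(1)] by auto
  have "dist (proj n x) x < \<epsilon>" if "N \<le> n" for n
  proof -
    have "x - proj n x = (x - y) - proj n (x - y)"
      by (simp add: linear_diff[OF proj_linear] N[OF that])
    then have "norm (x - proj n x) \<le> norm (x - y)"
      using norm_minus_proj_le[of "x - y" n] by (simp only:)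
    then show ?thesis using y(2) by (simp add: dist_norm norm_minus_commute)
  qed
  then show "\<exists>N. \<forall>n\<ge>N. dist (proj n x) x < \<epsilon>" by blast
qed

lemma parseval: "(\<lambda>i. (x \<bullet> e i) * (y \<bullet> e i)) sums (x \<bullet> y)"
  unfolding sums_def inner_proj[symmetric]
  by (intro tendsto_inner proj_tendsto tendsto_const)

lemma inner_basis_eqI: "(\<And>i. x \<bullet> e i = y \<bullet> e i) \<Longrightarrow> x = y"
  using LIMSEQ_unique[OF proj_tendsto[of x]] proj_tendsto[of y] by (simp add: proj_def)

lemma sum_abs_inner_le: "(\<Sum>i<n. \<bar>(x \<bullet> e i) * (y \<bullet> e i)\<bar>) \<le> norm x * norm y"
proof -
  have L2: "L2_set (\<lambda>i. x \<bullet> e i) {..<n} \<le> norm x" for x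
    unfolding L2_set_def using real_sqrt_le_mono[OF bessel[of x n]] by simp
  have "(\<Sum>i<n. \<bar>(x \<bullet> e i) * (y \<bullet> e i)\<bar>) = (\<Sum>i<n. \<bar>x \<bullet> e i\<bar> * \<bar>y \<bullet> e i\<bar>)"
    by (simp add: abs_mult)
  also have "\<dots> \<le> L2_set (\<lambda>i. x \<bullet> e i) {..<n} * L2_set (\<lambda>i. y \<bullet> e i) {..<n}"
    by (rule L2_set_mult_ineq)
  also have "\<dots> \<le> norm x * norm y"
    by (intro mult_mono L2) (auto simp: L2_set_nonneg)
  finally show ?thesis .
qed

lemma summable_abs_inner: "summable (\<lambda>i. \<bar>(x \<bullet> e i) * (y \<bullet> e i)\<bar>)"
  by (rule summableI_nonneg_bounded[OF _ sum_abs_inner_le]) simp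

lemma suminf_abs_inner_le: "(\<Sum>i. \<bar>(x \<bullet> e i) * (y \<bullet> e i)\<bar>) \<le> norm x * norm y"
  by (rule suminf_le_const[OF summable_abs_inner sum_abs_inner_le])

lemma flip_linear: "linear (flip e i)"
  unfolding flip_def by (rule linearI) (simp_all add: inner_add_left algebra_simps)

lemma norm_flip [simp]: "norm (flip e i v) = norm v"
proof -
  have "(norm (flip e i v))\<^sup>2 = (norm v)\<^sup>2"
    by (simp add: flip_def power2_norm_eq_inner inner_diff_left inner_diff_right inner_basis inner_commute algebra_simps)
  then show ?thesis by (simp add: power2_eq_iff_nonneg)
qed

lemma flip_inner: "flip e i v \<bullet> e j = (if i = j then - (v \<bullet> e i) else v \<bullet> e j)"
  by (auto simp: flip_def inner_diff_left inner_basis)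

lemma flip_measurable [measurable]: "flip e i \<in> borel_measurable borel"
  unfolding flip_def[abs_def] by measurable

end

section \<open>Covariance, velocity space and rates\<close>

locale zigzag_setting = hilbert_basis e for e :: "nat \<Rightarrow> 'h::{real_inner, polish_space}" +
  fixes \<Sigma> :: "'h \<Rightarrow> 'h" and \<gamma> :: "nat \<Rightarrow> real" and \<Phi> :: "'h \<Rightarrow> real"
  assumes cov: "covariance_operator \<Sigma> e \<gamma>" and pot: "assumption_G \<Phi>"
begin

lemma \<Sigma>_bounded_linear: "bounded_linear \<Sigma>"
  using cov unfolding covariance_operator_def by blast

lemma \<Sigma>_linear: "linear \<Sigma>"
  using \<Sigma>_bounded_linear by (rule bounded_linear.linear)

lemma \<Sigma>_symmetric: "\<Sigma> x \<bullet> y = x \<bullet> \<Sigma> y"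
  using cov unfolding covariance_operator_def by blast

lemma \<Sigma>_pos: "x \<noteq> 0 \<Longrightarrow> 0 < \<Sigma> x \<bullet> x"
  using cov unfolding covariance_operator_def by blast

lemma \<Sigma>_basis: "\<Sigma> (e j) = (\<gamma> j)\<^sup>2 *\<^sub>R e j"
  using cov unfolding covariance_operator_def by blast

lemma \<gamma>_nonzero: "\<gamma> j \<noteq> 0"
proof -
  have "e j \<noteq> 0" using norm_basis[of j] by (metis norm_zero zero_neq_one)
  from \<Sigma>_pos[OF this] show ?thesis by (auto simp: \<Sigma>_basis inner_basis)
qed

lemma \<gamma>_summable: "summable (\<lambda>j. (\<gamma> j)\<^sup>2)"
proof -
  have "summable (\<lambda>j. \<Sigma> (e j) \<bullet> e j)" using cov unfolding covariance_operator_def by blast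
  then show ?thesis by (simp add: \<Sigma>_basis inner_basis)
qed

lemma \<Sigma>_inj: "inj \<Sigma>"
  unfolding linear_injective_0[OF \<Sigma>_linear] using \<Sigma>_pos by (metis inner_zero_left less_irrefl)

lemma inv_\<Sigma> [simp]: "inv \<Sigma> (\<Sigma> w) = w"
  by (rule inv_f_f[OF \<Sigma>_inj])

lemma \<Sigma>_inner_basis: "\<Sigma> w \<bullet> e i = (\<gamma> i)\<^sup>2 * (w \<bullet> e i)"
  by (simp add: \<Sigma>_symmetric \<Sigma>_basis)

lemma \<Sigma>_measurable [measurable]: "\<Sigma> \<in> borel_measurable borel"
  by (intro borel_measurable_continuous_onI linear_continuous_on \<Sigma>_bounded_linear)

lemma \<Sigma>_flip: "\<Sigma> (flip e i w) = flip e i (\<Sigma> w)"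
  by (simp add: flip_def linear_diff[OF \<Sigma>_linear] linear_scale[OF \<Sigma>_linear] \<Sigma>_basis \<Sigma>_inner_basis mult.assoc mult.commute)

lemma space_velocity_borel [simp]: "space (velocity_borel \<Sigma>) = range \<Sigma>"
  by (simp add: velocity_borel_def velocities_def)

lemma measurable_velocity_borelI:
  assumes "f \<in> borel_measurable M"
  shows "(\<lambda>x. \<Sigma> (f x)) \<in> M \<rightarrow>\<^sub>M velocity_borel \<Sigma>"
  unfolding velocity_borel_def by (rule measurable_vimage_algebra2) (auto simp: velocities_def assms)

lemma inv_\<Sigma>_measurable [measurable]: "inv \<Sigma> \<in> velocity_borel \<Sigma> \<rightarrow>\<^sub>M borel"
  unfolding velocity_borel_def by (rule measurable_vimage_algebra1) simp

lemma velocity_borel_id: "(\<lambda>v. v) \<in> velocity_borel \<Sigma> \<rightarrow>\<^sub>M borel"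
proof -
  have "(\<lambda>v. \<Sigma> (inv \<Sigma> v)) \<in> velocity_borel \<Sigma> \<rightarrow>\<^sub>M borel" by measurable
  then show ?thesis
    by (rule measurable_cong[THEN iffD1, rotated]) (auto simp: f_inv_into_f)
qed

lemma measurable_velocity_borelD:
  assumes "f \<in> M \<rightarrow>\<^sub>M velocity_borel \<Sigma>" shows "f \<in> borel_measurable M"
  using measurable_compose[OF assms velocity_borel_id] .

text \<open>The Borel sets of the velocity space are those of the Hilbert space transported by
  \<open>\<Sigma>\<close>; an operator commuting with \<open>\<Sigma>\<close> is measurable for them
  as soon as it is for the ordinary ones.\<close>

lemma measurable_velocity_borel:
  assumes "linear T" "T \<in> borel_measurable borel" "\<And>w. \<Sigma> (T w) = T (\<Sigma> w)" "f \<in> M \<rightarrow>\<^sub>M velocity_borel \<Sigma>"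
  shows "(\<lambda>x. T (f x)) \<in> M \<rightarrow>\<^sub>M velocity_borel \<Sigma>"
proof -
  have "(\<lambda>x. \<Sigma> (T (inv \<Sigma> (f x)))) \<in> M \<rightarrow>\<^sub>M velocity_borel \<Sigma>"
    by (rule measurable_velocity_borelI[OF measurable_compose[OF measurable_compose[OF assms(4) inv_\<Sigma>_measurable] assms(2)]])
  then show ?thesis
  proof (rule measurable_cong[THEN iffD1, rotated])
    fix x assume "x \<in> space M"
    then have "f x \<in> range \<Sigma>" using measurable_space[OF assms(4)] by simp
    then show "\<Sigma> (T (inv \<Sigma> (f x))) = T (f x)" by (auto simp: assms(3))
  qed
qed

lemma velocity_singleton: "v \<in> range \<Sigma> \<Longrightarrow> {v} \<in> sets (velocity_borel \<Sigma>)"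
proof -
  assume v: "v \<in> range \<Sigma>"
  have "inv \<Sigma> -` {inv \<Sigma> v} \<inter> space (velocity_borel \<Sigma>) \<in> sets (velocity_borel \<Sigma>)"
    by (rule measurable_sets[OF inv_\<Sigma>_measurable]) simp
  also have "inv \<Sigma> -` {inv \<Sigma> v} \<inter> space (velocity_borel \<Sigma>) = {v}"
    using v by auto
  finally show ?thesis .
qed

text \<open>Here the trace class condition enters: the \<open>i\<close>-th coordinate of
  \<open>\<Sigma> w\<close> is at most \<open>(\<gamma> i)^2 * norm w\<close> in absolute
  value.\<close>

lemma summable_velocity: "v \<in> range \<Sigma> \<Longrightarrow> summable (\<lambda>i. \<bar>v \<bullet> e i\<bar>)"
proof -
  assume "v \<in> range \<Sigma>"
  then obtain w where v: "v = \<Sigma> w" by auto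
  show ?thesis
  proof (rule summable_comparison_test'[of "\<lambda>i. (\<gamma> i)\<^sup>2 * norm w" 0])
    show "summable (\<lambda>i. (\<gamma> i)\<^sup>2 * norm w)" by (intro summable_mult2 \<gamma>_summable)
    fix i
    have "\<bar>w \<bullet> e i\<bar> \<le> norm w" using Cauchy_Schwarz_ineq2[of w "e i"] by simp
    then show "norm \<bar>v \<bullet> e i\<bar> \<le> (\<gamma> i)\<^sup>2 * norm w"
      by (simp add: v \<Sigma>_inner_basis abs_mult mult_left_mono)
  qed
qed

abbreviation "grad \<equiv> gradient \<Phi>"

lemma grad: "(\<Phi> has_derivative (\<lambda>h. h \<bullet> grad x)) (at x)"
  using pot by (simp add: assumption_G_def gderiv_def)

lemma grad_continuous: "continuous_on UNIV grad"
proof -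
  have "isCont grad x" for x
  proof -
    obtain L where "L-lipschitz_on (ball x 1) grad"
      using pot bounded_ball[of x 1] unfolding assumption_G_def by blast
    then have "continuous_on (ball x 1) grad" by (rule lipschitz_on_continuous_on)
    then show ?thesis by (simp add: continuous_on_eq_continuous_at)
  qed
  then show ?thesis by (simp add: continuous_on_eq_continuous_at)
qed

lemma grad_measurable [measurable]: "grad \<in> borel_measurable borel"
  by (rule borel_measurable_continuous_onI[OF grad_continuous])

lemma \<Phi>_measurable [measurable]: "\<Phi> \<in> borel_measurable borel"
  by (intro borel_measurable_continuous_onI continuous_at_imp_continuous_on ballI has_derivative_continuous[OF grad])

lemma \<Phi>_nonneg: "0 \<le> \<Phi> x"
  using pot by (auto simp: assumption_G_def)

definition grad_const :: real where
  "grad_const = (SOME K. 0 \<le> K \<and> (\<forall>x. norm (grad x) \<le> K * (1 + norm x)))"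

lemma grad_const: "0 \<le> grad_const" "norm (grad x) \<le> grad_const * (1 + norm x)"
proof -
  obtain K where K: "\<And>x. norm (grad x) \<le> K * (1 + norm x)"
    using pot by (auto simp: assumption_G_def)
  have "0 \<le> K" using order_trans[OF norm_ge_zero K[of 0]] by simp
  then have "\<exists>K. 0 \<le> K \<and> (\<forall>x. norm (grad x) \<le> K * (1 + norm x))" using K by blast
  from someI_ex[OF this] show "0 \<le> grad_const" "norm (grad x) \<le> grad_const * (1 + norm x)"
    by (simp_all add: grad_const_def)
qed

text \<open>The rate before its positive part is taken, for the velocity \<open>\<Sigma> w\<close>:
  the factor \<open>(\<gamma> i)^2\<close> in its coordinate cancels the quotient of
  \<open>flip_rate\<close>.\<close>

definition drift :: "nat \<Rightarrow> 'h \<Rightarrow> 'h \<Rightarrow> real" where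
  "drift i x w = (w \<bullet> e i) * (x \<bullet> e i) + (\<Sigma> w \<bullet> e i) * (grad x \<bullet> e i)"

lemma flip_rate_drift: "flip_rate e \<gamma> \<Phi> i (x, \<Sigma> w) = max (drift i x w) 0"
proof -
  have "(\<gamma> i)\<^sup>2 * (w \<bullet> e i) * ((x \<bullet> e i) / (\<gamma> i)\<^sup>2) = (w \<bullet> e i) * (x \<bullet> e i)"
    using \<gamma>_nonzero[of i] by simp
  then show ?thesis
    by (simp only: flip_rate_def drift_def \<Sigma>_inner_basis distrib_left prod.case)
qed

lemma drift_sums: "(\<lambda>i. drift i x w) sums (w \<bullet> x + \<Sigma> w \<bullet> grad x)"
  unfolding drift_def by (intro sums_add parseval)

lemma abs_drift_le: "\<bar>drift i x w\<bar> \<le> \<bar>(w \<bullet> e i) * (x \<bullet> e i)\<bar> + \<bar>(\<Sigma> w \<bullet> e i) * (grad x \<bullet> e i)\<bar>"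
  unfolding drift_def by (rule abs_triangle_ineq)

lemma summable_abs_drift: "summable (\<lambda>i. \<bar>drift i x w\<bar>)"
  by (rule summable_comparison_test'[of _ 0, OF summable_add[OF summable_abs_inner summable_abs_inner]])
    (use abs_drift_le in simp)

lemma suminf_abs_drift_le: "(\<Sum>i. \<bar>drift i x w\<bar>) \<le> norm w * norm x + norm (\<Sigma> w) * norm (grad x)"
proof -
  have "(\<Sum>i. \<bar>drift i x w\<bar>) \<le> (\<Sum>i. \<bar>(w \<bullet> e i) * (x \<bullet> e i)\<bar> + \<bar>(\<Sigma> w \<bullet> e i) * (grad x \<bullet> e i)\<bar>)"
    by (rule suminf_le[OF abs_drift_le summable_abs_drift summable_add[OF summable_abs_inner summable_abs_inner]])
  also have "\<dots> = (\<Sum>i. \<bar>(w \<bullet> e i) * (x \<bullet> e i)\<bar>) + (\<Sum>i. \<bar>(\<Sigma> w \<bullet> e i) * (grad x \<bullet> e i)\<bar>)"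
    by (rule suminf_add[symmetric, OF summable_abs_inner summable_abs_inner])
  also have "\<dots> \<le> norm w * norm x + norm (\<Sigma> w) * norm (grad x)"
    by (intro add_mono suminf_abs_inner_le)
  finally show ?thesis .
qed

lemma summable_flip_rate: "v \<in> range \<Sigma> \<Longrightarrow> summable (\<lambda>i. flip_rate e \<gamma> \<Phi> i (x, v))"
proof -
  assume "v \<in> range \<Sigma>"
  then obtain w where v: "v = \<Sigma> w" by auto
  show ?thesis
    unfolding v flip_rate_drift by (rule summable_comparison_test'[of _ 0, OF summable_abs_drift[of x w]]) simp
qed

lemma total_rate_le:
  "total_rate e \<gamma> \<Phi> (x, \<Sigma> w) \<le> norm w * norm x + norm (\<Sigma> w) * norm (grad x)"
proof -
  have "total_rate e \<gamma> \<Phi> (x, \<Sigma> w) \<le> (\<Sum>i. \<bar>drift i x w\<bar>)"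
    unfolding total_rate_def
    by (intro suminf_le summable_abs_drift summable_flip_rate) (auto simp: flip_rate_drift)
  also note suminf_abs_drift_le
  finally show ?thesis .
qed

text \<open>The terms are continuous in \<open>t\<close>, and their series converges uniformly on
  bounded time intervals by the Weierstrass test.\<close>

lemma total_rate_flow_continuous:
  "continuous_on UNIV (\<lambda>t. total_rate e \<gamma> \<Phi> (x + t *\<^sub>R \<Sigma> w, \<Sigma> w))"
proof -
  let ?v = "\<Sigma> w"
  have grad_line: "continuous_on A (\<lambda>t. grad (x + t *\<^sub>R ?v))" for A
    by (rule continuous_on_compose2[OF grad_continuous]) (auto intro!: continuous_intros)
  have "isCont (\<lambda>t. total_rate e \<gamma> \<Phi> (x + t *\<^sub>R ?v, ?v)) s" for s
  proof -
    define N where "N = \<bar>s\<bar> + 1"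
    \<comment> \<open>Bound on the gradient at all positions reached at times of modulus below
      \<open>N\<close>, from its linear growth.\<close>
    define G where "G = grad_const * (1 + (norm x + N * norm ?v))"
    have "continuous_on {-N<..<N} (\<lambda>t. \<Sum>i. flip_rate e \<gamma> \<Phi> i (x + t *\<^sub>R ?v, ?v))"
    proof (rule uniform_limit_theorem[where F = sequentially])
      show "uniform_limit {-N<..<N} (\<lambda>n t. \<Sum>i<n. flip_rate e \<gamma> \<Phi> i (x + t *\<^sub>R ?v, ?v))
          (\<lambda>t. \<Sum>i. flip_rate e \<gamma> \<Phi> i (x + t *\<^sub>R ?v, ?v)) sequentially"
      proof (rule Weierstrass_m_test)
        \<comment> \<open>The first two terms dominate the Gaussian part of the drift, which is
          affine in \<open>t\<close>; the third dominates the gradient part and is summable because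
          the velocity coordinates are.\<close>
        show "summable (\<lambda>i. \<bar>(w \<bullet> e i) * (x \<bullet> e i)\<bar> + N * \<bar>(w \<bullet> e i) * (?v \<bullet> e i)\<bar> + \<bar>?v \<bullet> e i\<bar> * G)"
          by (intro summable_add summable_mult summable_mult2 summable_abs_inner summable_velocity) simp
        fix i t assume t: "t \<in> {-N<..<N}"
        let ?y = "x + t *\<^sub>R ?v"
        have "norm ?y \<le> norm x + N * norm ?v"
        proof -
          have "norm (t *\<^sub>R ?v) \<le> N * norm ?v" using t by (auto intro!: mult_right_mono)
          then show ?thesis using norm_triangle_ineq[of x "t *\<^sub>R ?v"] by linarith
        qed
        then have "norm (grad ?y) \<le> G"
          unfolding G_def using grad_const(2)[of ?y] mult_left_mono[OF _ grad_const(1), of "1 + norm ?y" "1 + (norm x + N * norm ?v)"]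
          by linarith
        moreover have "\<bar>grad ?y \<bullet> e i\<bar> \<le> norm (grad ?y)" using Cauchy_Schwarz_ineq2[of "grad ?y" "e i"] by simp
        ultimately have g: "\<bar>?v \<bullet> e i\<bar> * \<bar>grad ?y \<bullet> e i\<bar> \<le> \<bar>?v \<bullet> e i\<bar> * G"
          by (intro mult_left_mono) auto
        have "(w \<bullet> e i) * (?y \<bullet> e i) = (w \<bullet> e i) * (x \<bullet> e i) + t * ((w \<bullet> e i) * (?v \<bullet> e i))"
          by (simp add: inner_add_left algebra_simps)
        moreover have "\<bar>t * ((w \<bullet> e i) * (?v \<bullet> e i))\<bar> \<le> N * \<bar>(w \<bullet> e i) * (?v \<bullet> e i)\<bar>"
          unfolding abs_mult[of t] using t by (intro mult_right_mono) auto
        ultimately have "\<bar>(w \<bullet> e i) * (?y \<bullet> e i)\<bar> \<le> \<bar>(w \<bullet> e i) * (x \<bullet> e i)\<bar> + N * \<bar>(w \<bullet> e i) * (?v \<bullet> e i)\<bar>"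
          by linarith
        then have d: "\<bar>drift i ?y w\<bar> \<le> \<bar>(w \<bullet> e i) * (x \<bullet> e i)\<bar> + N * \<bar>(w \<bullet> e i) * (?v \<bullet> e i)\<bar> + \<bar>?v \<bullet> e i\<bar> * G"
          using abs_drift_le[of i ?y w] g by (simp add: abs_mult)
        from order_trans[OF abs_ge_zero d] d show "norm (flip_rate e \<gamma> \<Phi> i (?y, ?v)) \<le> \<bar>(w \<bullet> e i) * (x \<bullet> e i)\<bar> + N * \<bar>(w \<bullet> e i) * (?v \<bullet> e i)\<bar> + \<bar>?v \<bullet> e i\<bar> * G"
          by (auto simp: flip_rate_drift dest: abs_le_D1)
      qed
      show "\<forall>\<^sub>F n in sequentially. continuous_on {-N<..<N} (\<lambda>t. \<Sum>i<n. flip_rate e \<gamma> \<Phi> i (x + t *\<^sub>R ?v, ?v))"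
        unfolding flip_rate_drift drift_def
        by (intro always_eventually allI continuous_intros grad_line)
    qed simp
    moreover have "s \<in> {-N<..<N}" by (auto simp: N_def)
    ultimately show ?thesis
      unfolding total_rate_def by (simp add: continuous_on_eq_continuous_at)
  qed
  then show ?thesis by (simp add: continuous_on_eq_continuous_at)
qed

abbreviation jump_map :: "nat \<Rightarrow> 'h \<times> 'h \<Rightarrow> 'h \<times> 'h" where
  "jump_map i \<equiv> (\<lambda>(x, v). (x, flip e i v))"

lemma space_state_space: "space (state_space \<Sigma>) = UNIV \<times> range \<Sigma>"
  by (simp add: state_space_def space_pair_measure)

lemma state_spaceE:
  assumes "z \<in> space (state_space \<Sigma>)" obtains x w where "z = (x, \<Sigma> w)"
  using assms by (auto simp: space_state_space)

lemma position_measurable: "fst \<in> borel_measurable (state_space \<Sigma>)"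
  unfolding state_space_def by measurable

lemma velocity_measurable: "snd \<in> state_space \<Sigma> \<rightarrow>\<^sub>M velocity_borel \<Sigma>"
  unfolding state_space_def by measurable

lemma velocity_measurable': "snd \<in> borel_measurable (state_space \<Sigma>)"
  by (rule measurable_velocity_borelD[OF velocity_measurable])

text \<open>The bound of \<open>total_rate_le\<close> at the largest norm of the position reachable
  by time \<open>t\<close>, with the linear growth bound for the gradient. The velocity enters only
  through two norms that flips preserve.\<close>

definition speed_bound :: "'h \<times> 'h \<Rightarrow> real \<Rightarrow> real" where
  "speed_bound z t = norm (inv \<Sigma> (snd z)) * (norm (fst z) + t * norm (snd z))
     + norm (snd z) * (grad_const * (1 + (norm (fst z) + t * norm (snd z))))"

lemma norm_flow_le:
  assumes "0 \<le> s" shows "norm (x + s *\<^sub>R v) \<le> norm x + s * norm v"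
  using norm_triangle_ineq[of x "s *\<^sub>R v"] assms by simp

lemma pdmp_setup: "pdmp_setup (state_space \<Sigma>) free_flow (flip_rate e \<gamma> \<Phi>) jump_map"
proof unfold_locales
  note [measurable] = position_measurable velocity_measurable'
  show "(\<lambda>(t, z). free_flow t z) \<in> borel \<Otimes>\<^sub>M state_space \<Sigma> \<rightarrow>\<^sub>M state_space \<Sigma>"
  proof -
    have "(\<lambda>p. (fst (snd p) + fst p *\<^sub>R snd (snd p), snd (snd p))) \<in> borel \<Otimes>\<^sub>M state_space \<Sigma> \<rightarrow>\<^sub>M borel \<Otimes>\<^sub>M velocity_borel \<Sigma>"
    proof (rule measurable_Pair)
      show "(\<lambda>p. fst (snd p) + fst p *\<^sub>R snd (snd p)) \<in> borel_measurable (borel \<Otimes>\<^sub>M state_space \<Sigma>)"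
        by measurable
      show "(\<lambda>p. snd (snd p)) \<in> borel \<Otimes>\<^sub>M state_space \<Sigma> \<rightarrow>\<^sub>M velocity_borel \<Sigma>"
        by (rule measurable_compose[OF measurable_snd velocity_measurable])
    qed
    then show ?thesis
      by (simp add: free_flow_def split_beta' flip: state_space_def)
  qed
  show "flip_rate e \<gamma> \<Phi> i \<in> borel_measurable (state_space \<Sigma>)" for i
    unfolding flip_rate_def split_beta' by measurable
  show "jump_map i \<in> state_space \<Sigma> \<rightarrow>\<^sub>M state_space \<Sigma>" for i
  proof -
    have "(\<lambda>z. (fst z, flip e i (snd z))) \<in> state_space \<Sigma> \<rightarrow>\<^sub>M borel \<Otimes>\<^sub>M velocity_borel \<Sigma>"
      by (intro measurable_Pair position_measurable measurable_velocity_borel[OF flip_linear flip_measurable \<Sigma>_flip] velocity_measurable)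
    then show ?thesis by (simp add: split_beta' flip: state_space_def)
  qed
  fix z assume z: "z \<in> space (state_space \<Sigma>)"
  then obtain x w where zw: "z = (x, \<Sigma> w)" by (rule state_spaceE)
  show "free_flow 0 z = z" by (simp add: zw free_flow_def)
  show "free_flow (s + t) z = free_flow t (free_flow s z)" for s t
    by (simp add: zw free_flow_def algebra_simps)
  show "summable (\<lambda>i. flip_rate e \<gamma> \<Phi> i z)"
    unfolding zw by (rule summable_flip_rate) simp
  show "continuous_on UNIV (\<lambda>t. \<Sum>i. flip_rate e \<gamma> \<Phi> i (free_flow t z))"
    using total_rate_flow_continuous[of x w] by (simp add: zw free_flow_def total_rate_def)
qed (auto simp: flip_rate_def)

sublocale pdmp_setup "state_space \<Sigma>" free_flow "flip_rate e \<gamma> \<Phi>" jump_map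
  by (rule pdmp_setup)

lemma rate_eq: "rate = total_rate e \<gamma> \<Phi>"
  by (simp add: fun_eq_iff rate_def total_rate_def)

lemma jump_kernel_eq: "jump_kernel = flip_kernel e \<gamma> \<Phi>"
  by (simp add: fun_eq_iff jump_kernel_def flip_kernel_def rate_eq)

sublocale nonexplosive_pdmp "state_space \<Sigma>" free_flow "flip_rate e \<gamma> \<Phi>" jump_map speed_bound
proof
  fix z assume z: "z \<in> space (state_space \<Sigma>)"
  then obtain x w where zw: "z = (x, \<Sigma> w)" by (rule state_spaceE)
  show "{z} \<in> sets (state_space \<Sigma>)"
  proof -
    have "{x} \<times> {\<Sigma> w} \<in> sets (state_space \<Sigma>)"
      unfolding state_space_def by (intro pair_measureI velocity_singleton) auto
    then show ?thesis by (simp add: zw)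
  qed
  fix s t :: real assume st: "0 \<le> s" "s \<le> t"
  have n: "norm (x + s *\<^sub>R \<Sigma> w) \<le> norm x + t * norm (\<Sigma> w)"
    using norm_flow_le[OF st(1), of x "\<Sigma> w"] mult_right_mono[OF st(2) norm_ge_zero[of "\<Sigma> w"]] by linarith
  have "norm (grad (x + s *\<^sub>R \<Sigma> w)) \<le> grad_const * (1 + (norm x + t * norm (\<Sigma> w)))"
    using grad_const(2)[of "x + s *\<^sub>R \<Sigma> w"] mult_left_mono[OF add_left_mono[OF n, of 1] grad_const(1)] by linarith
  then have "norm w * norm (x + s *\<^sub>R \<Sigma> w) + norm (\<Sigma> w) * norm (grad (x + s *\<^sub>R \<Sigma> w)) \<le> speed_bound z t"
    unfolding speed_bound_def zw using n by (auto intro!: add_mono mult_left_mono)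
  then show "rate (free_flow s z) \<le> speed_bound z t"
    using total_rate_le[of "x + s *\<^sub>R \<Sigma> w" w] by (simp add: zw rate_eq free_flow_def)
  show "speed_bound (jump_map i (free_flow s z)) (t - s) \<le> speed_bound z t" for i
  proof -
    have i: "inv \<Sigma> (flip e i (\<Sigma> w)) = flip e i w" by (simp add: \<Sigma>_flip[symmetric])
    \<comment> \<open>The distance covered up to \<open>s\<close> is traded against the shorter
      remaining time.\<close>
    have "norm (x + s *\<^sub>R \<Sigma> w) + (t - s) * norm (\<Sigma> w) \<le> norm x + t * norm (\<Sigma> w)"
      using norm_flow_le[OF st(1), of x "\<Sigma> w"] by (simp add: algebra_simps)
    then show ?thesis
      using grad_const(1) by (auto simp: zw speed_bound_def free_flow_def i intro!: add_mono mult_left_mono)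
  qed
qed

theorem zigzag_process_exists: "zigzag_process \<Sigma> e \<gamma> \<Phi> path_space path_law process"
  unfolding zigzag_process_def using pdmp_path_law by (simp add: rate_eq jump_kernel_eq)

end

section \<open>Characteristic functions and the Cameron--Martin formula\<close>

lemma Re_Im_char:
  assumes "real_distribution M"
  shows "Re (char M t) = (\<integral>x. cos (t * x) \<partial>M)" "Im (char M t) = (\<integral>x. sin (t * x) \<partial>M)"
proof -
  interpret real_distribution M by fact
  have int: "integrable M (\<lambda>x. iexp (t * x))" by (rule integrable_iexp) simp_all
  show "Re (char M t) = (\<integral>x. cos (t * x) \<partial>M)" "Im (char M t) = (\<integral>x. sin (t * x) \<partial>M)"
    unfolding char_def using integral_Re[OF int] integral_Im[OF int] by (simp_all add: Re_exp Im_exp)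
qed

text \<open>Normalising by the common mass, read off at \<open>t = 0\<close>, reduces this to Levy's
  uniqueness theorem for probability measures; mass zero is treated apart.\<close>

lemma finite_measure_eqI_char:
  fixes M1 M2 :: "real measure"
  assumes fin: "finite_measure M1" "finite_measure M2" and sets [simp]: "sets M1 = sets borel" "sets M2 = sets borel"
    and cos: "\<And>t. (\<integral>x. cos (t * x) \<partial>M1) = (\<integral>x. cos (t * x) \<partial>M2)"
    and sin: "\<And>t. (\<integral>x. sin (t * x) \<partial>M1) = (\<integral>x. sin (t * x) \<partial>M2)"
  shows "M1 = M2"
proof -
  interpret M1: finite_measure M1 by fact
  interpret M2: finite_measure M2 by fact
  have [simp]: "space M1 = UNIV" "space M2 = UNIV"
    using sets_eq_imp_space_eq[OF sets(1)] sets_eq_imp_space_eq[OF sets(2)] by simp_all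
  note [measurable_cong] = sets
  define m where "m = measure M1 UNIV"
  have m2: "m = measure M2 UNIV" using cos[of 0] by (simp add: m_def)
  show ?thesis
  proof (cases "m = 0")
    case True
    then have "emeasure M1 UNIV = 0" "emeasure M2 UNIV = 0"
      using m2 by (simp_all add: m_def M1.emeasure_eq_measure M2.emeasure_eq_measure)
    moreover have "emeasure M1 A \<le> emeasure M1 UNIV" "emeasure M2 A \<le> emeasure M2 UNIV" for A
      by (rule emeasure_mono; simp)+
    ultimately show ?thesis by (intro measure_eqI) simp_all
  next
    case False
    then have m: "0 < m" by (simp add: m_def less_le)
    define N where "N M = density M (\<lambda>_. ennreal (1 / m))" for M :: "real measure"
    have emN: "emeasure (N M) A = ennreal (1 / m) * emeasure M A" if "A \<in> sets M" for M A
      unfolding N_def using that by (rule emeasure_density_const)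
    have rdI: "real_distribution (N M)" if "finite_measure M" and sM: "sets M = sets borel" and mM: "measure M UNIV = m" for M
    proof (intro real_distribution.intro prob_spaceI real_distribution_axioms.intro)
      interpret finite_measure M by fact
      have "emeasure (N M) UNIV = ennreal (1 / m) * ennreal m"
        using emN[of UNIV M] sM mM by (simp add: emeasure_eq_measure)
      also have "\<dots> = 1" using m by (simp add: ennreal_mult[symmetric])
      finally show "emeasure (N M) (space (N M)) = 1"
        using sets_eq_imp_space_eq[OF sM] by (simp add: N_def)
      show "sets (N M) = sets borel" by (simp add: N_def sM)
    qed
    have rd: "real_distribution (N M1)" "real_distribution (N M2)"
      by (rule rdI; use fin sets m_def m2 in simp)+
    have intN: "(\<integral>x. f x \<partial>N M1) = (1 / m) * (\<integral>x. f x \<partial>M1)" "(\<integral>x. f x \<partial>N M2) = (1 / m) * (\<integral>x. f x \<partial>M2)"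
      if [measurable]: "f \<in> borel_measurable borel" for f :: "real \<Rightarrow> real"
      unfolding N_def using m by (subst integral_density; simp)+
    have "char (N M1) = char (N M2)"
    proof
      fix t show "char (N M1) t = char (N M2) t"
        by (rule complex_eqI) (simp_all add: Re_Im_char rd intN cos sin)
    qed
    then have N: "N M1 = N M2" by (rule Levy_uniqueness[OF rd])
    show ?thesis
    proof (rule measure_eqI)
      fix A assume "A \<in> sets M1"
      then have "ennreal (1 / m) * emeasure M1 A = ennreal (1 / m) * emeasure M2 A"
        using emN[of A M1] emN[of A M2] N by simp
      then show "emeasure M1 A = emeasure M2 A"
        using m by (subst (asm) ennreal_mult_cancel_left) auto
    qed simp
  qed
qed

context hilbert_basis
begin

definition cylinder :: "nat \<Rightarrow> (nat \<Rightarrow> real set) \<Rightarrow> 'h set" where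
  "cylinder n B = {x. \<forall>i<n. x \<bullet> e i \<in> B i}"

definition cylinders :: "'h set set" where
  "cylinders = {cylinder n B | n B. \<forall>i. B i \<in> sets borel}"

lemma cylindersI: "(\<And>i. B i \<in> sets borel) \<Longrightarrow> cylinder n B \<in> cylinders"
  unfolding cylinders_def by blast

lemma cylindersE:
  assumes "X \<in> cylinders" obtains n B where "X = cylinder n B" "\<forall>i. B i \<in> sets borel"
  using assms unfolding cylinders_def by blast

lemma cylinder_Int:
  "cylinder n B \<inter> cylinder m C
    = cylinder (max n m) (\<lambda>i. (if i < n then B i else UNIV) \<inter> (if i < m then C i else UNIV))"
proof (intro set_eqI iffI)
  fix x assume "x \<in> cylinder (max n m) (\<lambda>i. (if i < n then B i else UNIV) \<inter> (if i < m then C i else UNIV))"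
  then have *: "x \<bullet> e i \<in> (if i < n then B i else UNIV) \<inter> (if i < m then C i else UNIV)" if "i < max n m" for i
    using that by (simp add: cylinder_def)
  have "x \<bullet> e i \<in> B i" if "i < n" for i using *[of i] that by simp
  moreover have "x \<bullet> e i \<in> C i" if "i < m" for i using *[of i] that by simp
  ultimately show "x \<in> cylinder n B \<inter> cylinder m C" by (simp add: cylinder_def)
qed (simp add: cylinder_def)

lemma Int_stable_cylinders: "Int_stable cylinders"
  apply (rule Int_stableI)
  subgoal for X Y
    apply (rule cylindersE[of X], assumption)
    apply (rule cylindersE[of Y], assumption)
    apply (simp only: cylinder_Int)
    apply (rule cylindersI)
    apply simp
    done
  done

text \<open>The identity is the pointwise limit of the maps \<open>proj n\<close>, which are
  measurable with respect to the coordinates.\<close>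

lemma coordinates_generate_borel: "sets (borel :: 'h measure) = sigma_sets UNIV cylinders"
proof
  define C where "C = sigma UNIV cylinders"
  have spC [simp]: "space C = UNIV" by (simp add: C_def)
  have setsC: "sets C = sigma_sets UNIV cylinders" by (simp add: C_def)
  have coord [measurable]: "(\<lambda>x. x \<bullet> e j) \<in> borel_measurable C" for j
  proof (rule measurableI)
    fix A :: "real set" assume "A \<in> sets borel"
    then have "cylinder (Suc j) (\<lambda>i. if i = j then A else UNIV) \<in> cylinders"
      by (intro cylindersI) auto
    moreover have "cylinder (Suc j) (\<lambda>i. if i = j then A else UNIV) = (\<lambda>x. x \<bullet> e j) -` A \<inter> space C"
      by (auto simp: cylinder_def)
    ultimately show "(\<lambda>x. x \<bullet> e j) -` A \<inter> space C \<in> sets C"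
      unfolding setsC by (intro sigma_sets.Basic) simp
  qed simp
  have [measurable]: "proj n \<in> borel_measurable C" for n
    unfolding proj_def[abs_def] by measurable
  have "(\<lambda>x. x) \<in> borel_measurable C"
    by (rule borel_measurable_LIMSEQ_metric[of proj]) (auto intro: proj_tendsto)
  then have "A \<in> sets C" if "A \<in> sets (borel :: 'h measure)" for A
    using measurable_sets[of "\<lambda>x. x" C borel A] that by simp
  then show "sets (borel :: 'h measure) \<subseteq> sigma_sets UNIV cylinders" by (auto simp: setsC)
  have "cylinders \<subseteq> sets (borel :: 'h measure)"
  proof
    fix X assume "X \<in> cylinders"
    then obtain n B where X: "X = cylinder n B" and B: "\<forall>i. B i \<in> sets borel" by (rule cylindersE)
    have [measurable]: "B i \<in> sets borel" for i using B by simp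
    have "{x \<in> space (borel :: 'h measure). \<forall>i\<in>{..<n}. x \<bullet> e i \<in> B i} \<in> sets borel"
      by (rule sets.sets_Collect_finite_All) measurable
    then show "X \<in> sets (borel :: 'h measure)" by (simp add: X cylinder_def Ball_def)
  qed
  from sets.sigma_sets_subset[OF this] show "sigma_sets UNIV cylinders \<subseteq> sets (borel :: 'h measure)" by simp
qed

text \<open>One-dimensional uniqueness is applied coordinate by coordinate: indicators of
  coordinates are inserted one at a time as factors of a nonnegative weight, until the weight is the
  indicator of a cylinder.\<close>

lemma measure_eqI_char:
  fixes M1 M2 :: "'h measure"
  assumes fin: "finite_measure M1" "finite_measure M2" and sets [simp]: "sets M1 = sets borel" "sets M2 = sets borel"
    and cos: "\<And>h. (\<integral>x. cos (x \<bullet> h) \<partial>M1) = (\<integral>x. cos (x \<bullet> h) \<partial>M2)"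
    and sin: "\<And>h. (\<integral>x. sin (x \<bullet> h) \<partial>M1) = (\<integral>x. sin (x \<bullet> h) \<partial>M2)"
  shows "M1 = M2"
proof -
  interpret M1: finite_measure M1 by fact
  interpret M2: finite_measure M2 by fact
  have [simp]: "space M1 = UNIV" "space M2 = UNIV"
    using sets_eq_imp_space_eq[OF sets(1)] sets_eq_imp_space_eq[OF sets(2)] by simp_all
  note [measurable_cong] = sets
  define same where "same f \<longleftrightarrow> f \<in> borel_measurable borel \<and> (\<exists>c. \<forall>x. \<bar>f x\<bar> \<le> c) \<and> (\<integral>x. f x \<partial>M1) = (\<integral>x. f x \<partial>M2)"
    for f :: "'h \<Rightarrow> real"
  have int: "integrable M1 f" "integrable M2 f" if "same f" for f
  proof -
    obtain c where "\<forall>x. \<bar>f x\<bar> \<le> c" "f \<in> borel_measurable borel" using \<open>same f\<close> by (auto simp: same_def)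
    then show "integrable M1 f" "integrable M2 f"
      by (auto intro!: M1.integrable_const_bound[of _ c] M2.integrable_const_bound[of _ c])
  qed
  have same_add: "same (\<lambda>x. f x + g x)" if f: "same f" and g: "same g" for f g
  proof -
    obtain c d where "\<And>x. \<bar>f x\<bar> \<le> c" "\<And>x. \<bar>g x\<bar> \<le> d" using f g by (auto simp: same_def)
    then have "\<bar>f x + g x\<bar> \<le> c + d" for x
      by (meson abs_triangle_ineq add_mono order_trans)
    then show ?thesis using f g int[OF f] int[OF g] by (auto simp: same_def)
  qed
  have same_mult: "same (\<lambda>x. a * f x)" if f: "same f" for a f
  proof -
    obtain c where "\<And>x. \<bar>f x\<bar> \<le> c" using f by (auto simp: same_def)
    then have "\<bar>a * f x\<bar> \<le> \<bar>a\<bar> * c" for x by (simp add: abs_mult mult_left_mono)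
    then show ?thesis using f by (auto simp: same_def)
  qed
  \<comment> \<open>The two measures weighted by \<open>q\<close> and projected to coordinate
    \<open>n\<close> are finite measures on the line with equal cosine and sine transforms, so they
    also agree on \<open>B\<close>.\<close>
  have step: "same (\<lambda>x. q x * indicator B (x \<bullet> e n))"
    if q: "same q" "\<And>x. 0 \<le> q x" and qc: "\<And>t. same (\<lambda>x. q x * cos (x \<bullet> t *\<^sub>R e n))" and qs: "\<And>t. same (\<lambda>x. q x * sin (x \<bullet> t *\<^sub>R e n))"
      and B [measurable]: "B \<in> sets borel" for q B n
  proof -
    have [measurable]: "q \<in> borel_measurable borel" using q(1) by (simp add: same_def)
    define D where "D M = distr (density M (\<lambda>x. ennreal (q x))) borel (\<lambda>x. x \<bullet> e n)" for M :: "'h measure"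
    have D: "(\<integral>y. f y \<partial>D M) = (\<integral>x. q x * f (x \<bullet> e n) \<partial>M)"
      if [measurable]: "f \<in> borel_measurable borel" and s: "sets M = sets borel" for f :: "real \<Rightarrow> real" and M
    proof -
      note [measurable_cong] = s
      have "(\<integral>y. f y \<partial>D M) = (\<integral>x. f (x \<bullet> e n) \<partial>density M (\<lambda>x. ennreal (q x)))"
        unfolding D_def by (rule integral_distr) simp_all
      also have "\<dots> = (\<integral>x. q x *\<^sub>R f (x \<bullet> e n) \<partial>M)"
        using q(2) by (intro integral_density) auto
      finally show ?thesis by simp
    qed
    have finD: "finite_measure (D M)" if s: "sets M = sets borel" and i: "integrable M q" for M
    proof
      note [measurable_cong] = s
      have "emeasure (D M) (space (D M)) = (\<integral>\<^sup>+x. ennreal (q x) \<partial>M)"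
        unfolding D_def using sets_eq_imp_space_eq[OF s]
        by (subst emeasure_distr) (simp_all add: emeasure_density)
      also have "\<dots> = ennreal (\<integral>x. q x \<partial>M)"
        using q(2) by (intro nn_integral_eq_integral i) auto
      finally show "emeasure (D M) (space (D M)) \<noteq> \<infinity>" by simp
    qed
    have "D M1 = D M2"
    proof (rule finite_measure_eqI_char)
      show "finite_measure (D M1)" "finite_measure (D M2)" by (rule finD; simp add: int[OF q(1)])+
      show "sets (D M1) = sets borel" "sets (D M2) = sets borel" by (simp_all add: D_def)
      fix t
      show "(\<integral>x. cos (t * x) \<partial>D M1) = (\<integral>x. cos (t * x) \<partial>D M2)" using qc[of t] by (simp add: D same_def)
      show "(\<integral>x. sin (t * x) \<partial>D M1) = (\<integral>x. sin (t * x) \<partial>D M2)" using qs[of t] by (simp add: D same_def)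
    qed
    then have "(\<integral>x. q x * indicator B (x \<bullet> e n) \<partial>M1) = (\<integral>x. q x * indicator B (x \<bullet> e n) \<partial>M2)"
      using D[of "indicator B" M1] D[of "indicator B" M2] by simp
    moreover obtain c where c: "\<And>x. \<bar>q x\<bar> \<le> c" using q(1) by (auto simp: same_def)
    then have "\<bar>q x * indicator B (x \<bullet> e n)\<bar> \<le> c" for x
      using c[of x] order_trans[OF abs_ge_zero c[of x]] by (simp add: indicator_def)
    ultimately show ?thesis unfolding same_def by auto
  qed
  \<comment> \<open>The trigonometric factor with arbitrary \<open>h\<close> carries the induction:
    it supplies the transforms needed in the next coordinate.\<close>
  have claim: "same (\<lambda>x. (\<Prod>i<n. indicator (B i) (x \<bullet> e i)) * cos (x \<bullet> h)) \<and> same (\<lambda>x. (\<Prod>i<n. indicator (B i) (x \<bullet> e i)) * sin (x \<bullet> h))"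
    if B: "\<And>i. B i \<in> sets borel" for n h and B :: "nat \<Rightarrow> real set"
  proof (induction n arbitrary: h)
    case 0
    show ?case using cos sin by (auto simp: same_def intro!: exI[of _ 1])
  next
    case (Suc n)
    define p where "p x = (\<Prod>i<n. indicat_real (B i) (x \<bullet> e i))" for x
    have p0: "0 \<le> p x" for x unfolding p_def by (intro prod_nonneg) auto
    have C: "same (\<lambda>x. p x * cos (x \<bullet> h))" and S: "same (\<lambda>x. p x * sin (x \<bullet> h))" for h
      using Suc.IH by (auto simp: p_def)
    have P: "same p" using C[of 0] by simp
    have Bn: "B n \<in> sets borel" by (rule B)
    have prod: "p x * cos (x \<bullet> h) * cos (x \<bullet> k) = (1/2) * (p x * cos (x \<bullet> (h - k))) + (1/2) * (p x * cos (x \<bullet> (h + k)))"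
      "p x * cos (x \<bullet> h) * sin (x \<bullet> k) = (1/2) * (p x * sin (x \<bullet> (h + k))) + (-1/2) * (p x * sin (x \<bullet> (h - k)))"
      "p x * sin (x \<bullet> h) * cos (x \<bullet> k) = (1/2) * (p x * sin (x \<bullet> (h + k))) + (1/2) * (p x * sin (x \<bullet> (h - k)))"
      "p x * sin (x \<bullet> h) * sin (x \<bullet> k) = (1/2) * (p x * cos (x \<bullet> (h - k))) + (-1/2) * (p x * cos (x \<bullet> (h + k)))" for x h k
      by (simp_all add: inner_add_right inner_diff_right cos_add cos_diff sin_add sin_diff algebra_simps)
    have CC: "same (\<lambda>x. p x * cos (x \<bullet> h) * cos (x \<bullet> k))" "same (\<lambda>x. p x * cos (x \<bullet> h) * sin (x \<bullet> k))"
      "same (\<lambda>x. p x * sin (x \<bullet> h) * cos (x \<bullet> k))" "same (\<lambda>x. p x * sin (x \<bullet> h) * sin (x \<bullet> k))" for h k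
      unfolding prod by (intro same_add same_mult C S)+
    have q1: "same (\<lambda>x. p x * indicator (B n) (x \<bullet> e n))"
      by (rule step[OF P p0 C S Bn])
    \<comment> \<open>Adding \<open>p\<close> makes the oscillating weight nonnegative, as
      \<open>step\<close> requires.\<close>
    have q2: "same (\<lambda>x. (p x + p x * cos (x \<bullet> h)) * indicator (B n) (x \<bullet> e n))" for h
    proof (rule step[OF _ _ _ _ Bn])
      show "same (\<lambda>x. p x + p x * cos (x \<bullet> h))" by (intro same_add P C)
      show "0 \<le> p x + p x * cos (x \<bullet> h)" for x
        using mult_left_mono[OF cos_ge_minus_one[of "x \<bullet> h"] p0[of x]] by simp
      show "same (\<lambda>x. (p x + p x * cos (x \<bullet> h)) * cos (x \<bullet> t *\<^sub>R e n))" "same (\<lambda>x. (p x + p x * cos (x \<bullet> h)) * sin (x \<bullet> t *\<^sub>R e n))" for t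
        unfolding distrib_right by (intro same_add C S CC)+
    qed
    have q3: "same (\<lambda>x. (p x + p x * sin (x \<bullet> h)) * indicator (B n) (x \<bullet> e n))" for h
    proof (rule step[OF _ _ _ _ Bn])
      show "same (\<lambda>x. p x + p x * sin (x \<bullet> h))" by (intro same_add P S)
      show "0 \<le> p x + p x * sin (x \<bullet> h)" for x
        using mult_left_mono[OF sin_ge_minus_one[of "x \<bullet> h"] p0[of x]] by simp
      show "same (\<lambda>x. (p x + p x * sin (x \<bullet> h)) * cos (x \<bullet> t *\<^sub>R e n))" "same (\<lambda>x. (p x + p x * sin (x \<bullet> h)) * sin (x \<bullet> t *\<^sub>R e n))" for t
        unfolding distrib_right by (intro same_add C S CC)+
    qed
    \<comment> \<open>The added \<open>p\<close> is subtracted again with the help of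
      \<open>q1\<close>.\<close>
    have eq: "(\<Prod>i<Suc n. indicat_real (B i) (x \<bullet> e i)) * a = (p x + p x * a) * indicator (B n) (x \<bullet> e n) + (-1) * (p x * indicator (B n) (x \<bullet> e n))" for x a
      by (simp add: p_def algebra_simps)
    show ?case
      unfolding eq using same_add[OF q2 same_mult[OF q1]] same_add[OF q3 same_mult[OF q1]] by blast
  qed
  show ?thesis
  proof (rule measure_eqI_generator_eq)
    show "Int_stable cylinders" by (rule Int_stable_cylinders)
    show "cylinders \<subseteq> Pow UNIV" by simp
    show "sets M1 = sigma_sets UNIV cylinders" "sets M2 = sigma_sets UNIV cylinders"
      by (simp_all add: coordinates_generate_borel)
    have "cylinder 0 (\<lambda>_. UNIV) \<in> cylinders" by (rule cylindersI) simp
    then show "range (\<lambda>_::nat. UNIV) \<subseteq> cylinders" by (auto simp: cylinder_def)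
    show "(\<Union>i::nat. UNIV) = (UNIV :: 'h set)" by simp
    show "emeasure M1 UNIV \<noteq> \<infinity>" for i :: nat by simp
    fix X assume X: "X \<in> cylinders"
    then obtain n B where XB: "X = cylinder n B" and B': "\<forall>i. B i \<in> sets borel" by (rule cylindersE)
    have B: "B i \<in> sets borel" for i using B' by simp
    have "X \<in> sets borel" using X coordinates_generate_borel by (auto intro: sigma_sets.Basic)
    then have XM [measurable]: "X \<in> sets M1" "X \<in> sets M2" by simp_all
    have "(\<Prod>i<n. indicat_real (B i) (x \<bullet> e i)) = indicator X x" for x
      unfolding XB cylinder_def by (auto simp: indicator_def split: if_splits)
    then have ind: "(\<lambda>x. (\<Prod>i<n. indicat_real (B i) (x \<bullet> e i)) * cos (x \<bullet> 0)) = indicator X"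
      by (intro ext) (simp only: inner_zero_right cos_zero mult_1_right)
    have "same (\<lambda>x. (\<Prod>i<n. indicat_real (B i) (x \<bullet> e i)) * cos (x \<bullet> 0))"
      using claim[where B = B and n = n and h = 0] B by blast
    then have "same (indicator X)" unfolding ind .
    then show "emeasure M1 X = emeasure M2 X"
      by (simp add: same_def M1.emeasure_eq_measure M2.emeasure_eq_measure XM)
  qed
qed

end

section \<open>Gaussian characteristic functions, resampling and shifts\<close>

lemma normal_char:
  assumes "0 < s"
  shows "(\<integral>y. cos y \<partial>density lborel (normal_density 0 s)) = exp (- s\<^sup>2 / 2)"
    and "(\<integral>y. sin y \<partial>density lborel (normal_density 0 s)) = 0"
proof -
  have scale: "(\<integral>y. f y \<partial>density lborel (normal_density 0 s)) = (\<integral>x. f (s * x) \<partial>std_normal_distribution)"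
    if [measurable]: "f \<in> borel_measurable borel" for f :: "real \<Rightarrow> real"
  proof -
    have nd: "normal_density 0 s (s * x) = std_normal_density x / s" for x
      using assms by (simp add: normal_density_def power_mult_distrib real_sqrt_mult)
    have "(\<integral>y. f y \<partial>density lborel (normal_density 0 s)) = (\<integral>y. normal_density 0 s y * f y \<partial>lborel)"
      by (subst integral_density) auto
    also have "\<dots> = \<bar>s\<bar> *\<^sub>R (\<integral>x. normal_density 0 s (0 + s * x) * f (0 + s * x) \<partial>lborel)"
      using assms by (intro lborel_integral_real_affine) simp
    also have "\<dots> = (\<integral>x. std_normal_density x * f (s * x) \<partial>lborel)"
      using assms by (simp add: nd)
    also have "\<dots> = (\<integral>x. f (s * x) \<partial>std_normal_distribution)"
      by (subst integral_density) auto
    finally show ?thesis .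
  qed
  have char: "char std_normal_distribution s = complex_of_real (exp (- s\<^sup>2 / 2))"
    by (simp add: char_std_normal_distribution exp_of_real[symmetric])
  show "(\<integral>y. cos y \<partial>density lborel (normal_density 0 s)) = exp (- s\<^sup>2 / 2)"
    using Re_Im_char(1)[OF real_dist_normal_dist, of s] by (simp add: scale char del: of_real_exp exp_of_real)
  show "(\<integral>y. sin y \<partial>density lborel (normal_density 0 s)) = 0"
    using Re_Im_char(2)[OF real_dist_normal_dist, of s] by (simp add: scale char del: of_real_exp exp_of_real)
qed

lemma std_normal_char:
  "(\<integral>y. cos (c * y) \<partial>std_normal_distribution) = exp (- c\<^sup>2 / 2)"
  "(\<integral>y. sin (c * y) \<partial>std_normal_distribution) = 0"
proof -
  have char: "char std_normal_distribution c = complex_of_real (exp (- c\<^sup>2 / 2))"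
    by (simp add: char_std_normal_distribution exp_of_real[symmetric])
  show "(\<integral>y. cos (c * y) \<partial>std_normal_distribution) = exp (- c\<^sup>2 / 2)"
    "(\<integral>y. sin (c * y) \<partial>std_normal_distribution) = 0"
    using Re_Im_char[OF real_dist_normal_dist, of c] by (simp_all add: char del: of_real_exp exp_of_real)
qed

locale gaussian_setting = zigzag_setting e \<Sigma> \<gamma> \<Phi>
  for e :: "nat \<Rightarrow> 'h::{real_inner, polish_space}" and \<Sigma> \<gamma> \<Phi> +
  fixes \<pi>\<^sub>0 :: "'h measure"
  assumes gauss: "gaussian_law \<Sigma> \<pi>\<^sub>0"
begin

sublocale \<pi>: prob_space \<pi>\<^sub>0
  using gauss by (simp add: gaussian_law_def)

lemma sets_\<pi> [simp, measurable_cong]: "sets \<pi>\<^sub>0 = sets borel"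
  using gauss by (simp add: gaussian_law_def)

lemma space_\<pi> [simp]: "space \<pi>\<^sub>0 = UNIV"
  using sets_eq_imp_space_eq[OF sets_\<pi>] by simp

lemma gauss_char:
  "(\<integral>x. cos (x \<bullet> h) \<partial>\<pi>\<^sub>0) = exp (- (\<Sigma> h \<bullet> h) / 2)"
  "(\<integral>x. sin (x \<bullet> h) \<partial>\<pi>\<^sub>0) = 0"
proof -
  have "(\<integral>x. cos (x \<bullet> h) \<partial>\<pi>\<^sub>0) = exp (- (\<Sigma> h \<bullet> h) / 2) \<and> (\<integral>x. sin (x \<bullet> h) \<partial>\<pi>\<^sub>0) = 0"
  proof (cases "h = 0")
    case True
    then show ?thesis using \<pi>.prob_space by (simp add: linear_0[OF \<Sigma>_linear])
  next
    case False
    define s where "s = sqrt (\<Sigma> h \<bullet> h)"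
    have s: "0 < s" "s\<^sup>2 = \<Sigma> h \<bullet> h" using \<Sigma>_pos[OF False] by (simp_all add: s_def)
    have "distributed \<pi>\<^sub>0 lborel (\<lambda>x. x \<bullet> h) (\<lambda>r. ennreal (normal_density 0 s r))"
      using gauss False by (simp add: gaussian_law_def s_def)
    then have D: "distr \<pi>\<^sub>0 lborel (\<lambda>x. x \<bullet> h) = density lborel (normal_density 0 s)"
      by (simp add: distributed_def)
    have "(\<integral>x. f (x \<bullet> h) \<partial>\<pi>\<^sub>0) = (\<integral>y. f y \<partial>density lborel (normal_density 0 s))"
      if [measurable]: "f \<in> borel_measurable borel" for f :: "real \<Rightarrow> real"
      unfolding D[symmetric] by (rule integral_distr[symmetric]) measurable
    then show ?thesis by (simp add: normal_char s)
  qed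
  then show "(\<integral>x. cos (x \<bullet> h) \<partial>\<pi>\<^sub>0) = exp (- (\<Sigma> h \<bullet> h) / 2)" "(\<integral>x. sin (x \<bullet> h) \<partial>\<pi>\<^sub>0) = 0" by auto
qed

text \<open>\<open>x \<bullet> w\<close> is uncorrelated with \<open>x - ((x \<bullet> w) / s\<^sup>2) *\<^sub>R \<Sigma> w\<close>, so it may be resampled independently.\<close>

lemma gauss_resample:
  assumes w: "w \<noteq> 0"
  defines "s \<equiv> sqrt (\<Sigma> w \<bullet> w)"
  shows "distr (\<pi>\<^sub>0 \<Otimes>\<^sub>M std_normal_distribution) borel (\<lambda>(x, r). x + ((s * r - x \<bullet> w) / s\<^sup>2) *\<^sub>R \<Sigma> w) = \<pi>\<^sub>0"
proof (rule measure_eqI_char)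
  interpret N: real_distribution std_normal_distribution by (rule real_dist_normal_dist)
  interpret P: pair_prob_space \<pi>\<^sub>0 std_normal_distribution ..
  have s: "0 < s" "s\<^sup>2 = \<Sigma> w \<bullet> w" using \<Sigma>_pos[OF w] by (simp_all add: s_def)
  let ?T = "\<lambda>(x, r). x + ((s * r - x \<bullet> w) / s\<^sup>2) *\<^sub>R \<Sigma> w"
  let ?D = "distr (\<pi>\<^sub>0 \<Otimes>\<^sub>M std_normal_distribution) borel ?T"
  have T [measurable]: "?T \<in> borel_measurable (\<pi>\<^sub>0 \<Otimes>\<^sub>M std_normal_distribution)" by measurable
  show "finite_measure ?D" by (rule P.finite_measure_distr[OF T])
  show "finite_measure \<pi>\<^sub>0" by unfold_locales
  show "sets ?D = sets borel" "sets \<pi>\<^sub>0 = sets borel" by simp_all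
  fix h
  \<comment> \<open>\<open>c\<close> is the regression coefficient of \<open>x \<bullet> h\<close>
    on \<open>x \<bullet> w\<close>, so that \<open>x \<bullet> k\<close> is uncorrelated with
    \<open>x \<bullet> w\<close>; hence the variances add up in \<open>var\<close>.\<close>
  define c where "c = (\<Sigma> w \<bullet> h) / s\<^sup>2"
  define k where "k = h - c *\<^sub>R w"
  have T_inner: "?T (x, r) \<bullet> h = x \<bullet> k + c * s * r" for x r
    by (simp add: k_def c_def inner_add_left inner_diff_right inner_commute diff_divide_distrib algebra_simps)
  have T_inner': "?T p \<bullet> h = fst p \<bullet> k + c * s * snd p" for p
    by (cases p) (simp only: T_inner fst_conv snd_conv)
  have c_eq: "\<Sigma> w \<bullet> h = c * s\<^sup>2" using s(1) by (simp add: c_def)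
  have "\<Sigma> h \<bullet> w = \<Sigma> w \<bullet> h" by (metis \<Sigma>_symmetric inner_commute)
  then have var: "\<Sigma> k \<bullet> k + (c * s)\<^sup>2 = \<Sigma> h \<bullet> h"
    using c_eq s(2)[symmetric]
    by (simp add: k_def linear_diff[OF \<Sigma>_linear] linear_scale[OF \<Sigma>_linear] inner_diff_left inner_diff_right power2_eq_square algebra_simps)
  have bd: "integrable (\<pi>\<^sub>0 \<Otimes>\<^sub>M std_normal_distribution) f" if "f \<in> borel_measurable (\<pi>\<^sub>0 \<Otimes>\<^sub>M std_normal_distribution)" "\<And>p. \<bar>f p\<bar> \<le> 1" for f :: "'h \<times> real \<Rightarrow> real"
    using that by (intro P.integrable_const_bound[of _ 1]) auto
  have le1: "\<bar>a * b\<bar> \<le> 1" if "\<bar>a\<bar> \<le> 1" "\<bar>b\<bar> \<le> 1" for a b :: real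
    using mult_mono[OF that] by (simp add: abs_mult)
  have prod: "(\<integral>p. f (fst p) * g (snd p) \<partial>(\<pi>\<^sub>0 \<Otimes>\<^sub>M std_normal_distribution)) = (\<integral>x. f x \<partial>\<pi>\<^sub>0) * (\<integral>r. g r \<partial>std_normal_distribution)"
    if [measurable]: "f \<in> borel_measurable borel" "g \<in> borel_measurable borel" and b: "\<And>x. \<bar>f x\<bar> \<le> 1" "\<And>x. \<bar>g x\<bar> \<le> 1"
    for f :: "'h \<Rightarrow> real" and g :: "real \<Rightarrow> real"
  proof -
    have "integrable (\<pi>\<^sub>0 \<Otimes>\<^sub>M std_normal_distribution) (\<lambda>p. f (fst p) * g (snd p))"
      by (rule bd) (auto intro!: le1 b)
    from P.integral_fst'[OF this] show ?thesis by simp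
  qed
  have i: "integrable (\<pi>\<^sub>0 \<Otimes>\<^sub>M std_normal_distribution) (\<lambda>p. f (fst p \<bullet> k) * g (c * s * snd p))"
    if "f \<in> {cos, sin}" "g \<in> {cos, sin}" for f g :: "real \<Rightarrow> real"
    using that by (intro bd) (auto intro!: le1)
  have "(\<integral>x. cos (x \<bullet> h) \<partial>?D) = (\<integral>p. cos (?T p \<bullet> h) \<partial>(\<pi>\<^sub>0 \<Otimes>\<^sub>M std_normal_distribution))"
    by (rule integral_distr[OF T]) measurable
  also have "\<dots> = (\<integral>p. cos (fst p \<bullet> k) * cos (c * s * snd p) - sin (fst p \<bullet> k) * sin (c * s * snd p) \<partial>(\<pi>\<^sub>0 \<Otimes>\<^sub>M std_normal_distribution))"
    by (intro Bochner_Integration.integral_cong refl) (simp only: T_inner' cos_add)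
  also have "\<dots> = exp (- (\<Sigma> k \<bullet> k) / 2) * exp (- (c * s)\<^sup>2 / 2)"
    using i[of cos cos] i[of sin sin]
    by (simp add: prod[of "\<lambda>x. cos (x \<bullet> k)" "\<lambda>r. cos (c * s * r)"] prod[of "\<lambda>x. sin (x \<bullet> k)" "\<lambda>r. sin (c * s * r)"] gauss_char std_normal_char)
  also have "\<dots> = (\<integral>x. cos (x \<bullet> h) \<partial>\<pi>\<^sub>0)"
    by (simp add: gauss_char exp_add[symmetric] var[symmetric] add_divide_distrib)
  finally show "(\<integral>x. cos (x \<bullet> h) \<partial>?D) = (\<integral>x. cos (x \<bullet> h) \<partial>\<pi>\<^sub>0)" .
  have "(\<integral>x. sin (x \<bullet> h) \<partial>?D) = (\<integral>p. sin (?T p \<bullet> h) \<partial>(\<pi>\<^sub>0 \<Otimes>\<^sub>M std_normal_distribution))"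
    by (rule integral_distr[OF T]) measurable
  also have "\<dots> = (\<integral>p. sin (fst p \<bullet> k) * cos (c * s * snd p) + cos (fst p \<bullet> k) * sin (c * s * snd p) \<partial>(\<pi>\<^sub>0 \<Otimes>\<^sub>M std_normal_distribution))"
    by (intro Bochner_Integration.integral_cong refl) (simp only: T_inner' sin_add)
  also have "\<dots> = 0"
    using i[of sin cos] i[of cos sin]
    by (simp add: prod[of "\<lambda>x. sin (x \<bullet> k)" "\<lambda>r. cos (c * s * r)"] prod[of "\<lambda>x. cos (x \<bullet> k)" "\<lambda>r. sin (c * s * r)"] gauss_char std_normal_char)
  finally show "(\<integral>x. sin (x \<bullet> h) \<partial>?D) = (\<integral>x. sin (x \<bullet> h) \<partial>\<pi>\<^sub>0)" by (simp add: gauss_char)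
qed

text \<open>In the resampled picture a shift by \<open>\<Sigma> w\<close> moves only the
  one-dimensional normal variable, by \<open>s\<close>. The density is then the quotient of two
  normal densities on the line.\<close>

lemma cameron_martin:
  assumes [measurable]: "f \<in> borel_measurable borel"
  shows "(\<integral>\<^sup>+x. f (x + \<Sigma> w) \<partial>\<pi>\<^sub>0) = (\<integral>\<^sup>+x. f x * ennreal (exp (x \<bullet> w - (\<Sigma> w \<bullet> w) / 2)) \<partial>\<pi>\<^sub>0)"
proof (cases "w = 0")
  case True
  then show ?thesis by (simp add: linear_0[OF \<Sigma>_linear])
next
  case False
  interpret N: real_distribution std_normal_distribution by (rule real_dist_normal_dist)
  define s where "s = sqrt (\<Sigma> w \<bullet> w)"
  have s: "0 < s" "s\<^sup>2 = \<Sigma> w \<bullet> w" using \<Sigma>_pos[OF False] by (simp_all add: s_def)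
  define T where "T x r = x + ((s * r - x \<bullet> w) / s\<^sup>2) *\<^sub>R \<Sigma> w" for x r
  have [measurable]: "(\<lambda>p. T (fst p) (snd p)) \<in> borel_measurable (\<pi>\<^sub>0 \<Otimes>\<^sub>M std_normal_distribution)"
    "T x \<in> borel_measurable borel" for x
    unfolding T_def by measurable
  have resample: "(\<integral>\<^sup>+x. g x \<partial>\<pi>\<^sub>0) = (\<integral>\<^sup>+x. \<integral>\<^sup>+r. g (T x r) \<partial>std_normal_distribution \<partial>\<pi>\<^sub>0)"
    if [measurable]: "g \<in> borel_measurable borel" for g
  proof -
    have "(\<integral>\<^sup>+x. g x \<partial>\<pi>\<^sub>0) = (\<integral>\<^sup>+x. g x \<partial>distr (\<pi>\<^sub>0 \<Otimes>\<^sub>M std_normal_distribution) borel (\<lambda>p. T (fst p) (snd p)))"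
      using gauss_resample[OF False] by (simp add: T_def s_def split_beta')
    also have "\<dots> = (\<integral>\<^sup>+p. g (T (fst p) (snd p)) \<partial>(\<pi>\<^sub>0 \<Otimes>\<^sub>M std_normal_distribution))"
      by (rule nn_integral_distr) measurable
    also have "\<dots> = (\<integral>\<^sup>+x. \<integral>\<^sup>+r. g (T x r) \<partial>std_normal_distribution \<partial>\<pi>\<^sub>0)"
      by (subst N.nn_integral_fst[symmetric]) simp_all
    finally show ?thesis .
  qed
  have shift: "T x r + \<Sigma> w = T x (s + 1 * r)" for x r
  proof -
    have "(s * (s + 1 * r) - x \<bullet> w) / s\<^sup>2 = (s * r - x \<bullet> w) / s\<^sup>2 + 1"
      using s(1) by (simp add: field_simps power2_eq_square)
    then show ?thesis unfolding T_def by (simp add: scaleR_add_left)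
  qed
  \<comment> \<open>The normal variable can be read off from the resampled point, so the
    one-dimensional density is a function of that point alone.\<close>
  have inner: "T x r \<bullet> w = s * r" for x r
    using s \<Sigma>_pos[OF False] by (simp add: T_def inner_add_left)
  have dens: "std_normal_density (r - s) = std_normal_density r * exp (s * r - s\<^sup>2 / 2)" for r
    unfolding std_normal_density_def mult.assoc exp_add[symmetric]
    by (simp add: power2_eq_square field_simps)
  have "(\<integral>\<^sup>+x. f (x + \<Sigma> w) \<partial>\<pi>\<^sub>0) = (\<integral>\<^sup>+x. \<integral>\<^sup>+r. f (T x (s + 1 * r)) \<partial>std_normal_distribution \<partial>\<pi>\<^sub>0)"
    unfolding shift[symmetric] by (rule resample) measurable
  also have "\<dots> = (\<integral>\<^sup>+x. \<integral>\<^sup>+r. f (T x r) * ennreal (exp (T x r \<bullet> w - (\<Sigma> w \<bullet> w) / 2)) \<partial>std_normal_distribution \<partial>\<pi>\<^sub>0)"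
  proof (rule nn_integral_cong)
    fix x
    have "(\<integral>\<^sup>+r. f (T x (s + 1 * r)) \<partial>std_normal_distribution) = (\<integral>\<^sup>+r. ennreal (std_normal_density (s + 1 * r - s)) * f (T x (s + 1 * r)) \<partial>lborel)"
      by (subst nn_integral_density) simp_all
    also have "\<dots> = (\<integral>\<^sup>+r. ennreal (std_normal_density (r - s)) * f (T x r) \<partial>lborel)"
      by (subst (2) nn_integral_real_affine[where c = 1 and t = s]) simp_all
    also have "\<dots> = (\<integral>\<^sup>+r. ennreal (std_normal_density r) * (f (T x r) * ennreal (exp (T x r \<bullet> w - (\<Sigma> w \<bullet> w) / 2))) \<partial>lborel)"
      unfolding inner s(2)[symmetric] dens by (intro nn_integral_cong) (simp add: ennreal_mult ac_simps)
    also have "\<dots> = (\<integral>\<^sup>+r. f (T x r) * ennreal (exp (T x r \<bullet> w - (\<Sigma> w \<bullet> w) / 2)) \<partial>std_normal_distribution)"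
      by (rule nn_integral_density[symmetric]) simp_all
    finally show "(\<integral>\<^sup>+r. f (T x (s + 1 * r)) \<partial>std_normal_distribution)
      = (\<integral>\<^sup>+r. f (T x r) * ennreal (exp (T x r \<bullet> w - (\<Sigma> w \<bullet> w) / 2)) \<partial>std_normal_distribution)" .
  qed
  also have "\<dots> = (\<integral>\<^sup>+x. f x * ennreal (exp (x \<bullet> w - (\<Sigma> w \<bullet> w) / 2)) \<partial>\<pi>\<^sub>0)"
    by (rule resample[symmetric]) measurable
  finally show ?thesis .
qed

end

section \<open>Reversibility of the zigzag process\<close>

abbreviation signs :: "(nat \<Rightarrow> bool) measure" where
  "signs \<equiv> \<Pi>\<^sub>M i\<in>UNIV. measure_pmf (bernoulli_pmf (1/2))"

interpretation signs: product_prob_space "\<lambda>_::nat. measure_pmf (bernoulli_pmf (1/2))" UNIV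
  by unfold_locales

lemma sign_measurable [measurable]: "Measurable.pred signs (\<lambda>b. b i)"
proof -
  have "(\<lambda>b. b i) \<in> signs \<rightarrow>\<^sub>M measure_pmf (bernoulli_pmf (1/2))"
    by (rule measurable_component_singleton) simp
  then show ?thesis by simp
qed

lemma flip_sign_measurable [measurable]: "(\<lambda>b. b(i := \<not> b i)) \<in> signs \<rightarrow>\<^sub>M signs"
proof (rule measurable_PiM_single')
  show "(\<lambda>b. (b(i := \<not> b i)) j) \<in> signs \<rightarrow>\<^sub>M measure_pmf (bernoulli_pmf (1/2))" for j
    by (cases "j = i") simp_all
qed (simp add: space_PiM)

text \<open>A fair coin is invariant under negation; the product measures are compared on boxes in
  finitely many coordinates.\<close>

lemma distr_flip_sign: "distr signs signs (\<lambda>b. b(i := \<not> b i)) = signs"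
proof (rule signs.PiM_eq)
  fix J :: "nat set" and X :: "nat \<Rightarrow> bool set" assume J: "finite J" "J \<subseteq> UNIV"
  let ?P = "\<lambda>X :: nat \<Rightarrow> bool set. prod_emb UNIV (\<lambda>_. measure_pmf (bernoulli_pmf (1/2))) J (\<Pi>\<^sub>E j\<in>J. X j)"
  define X' where "X' j = (if j = i then Not -` X j else X j)" for j
  have half: "emeasure (measure_pmf (bernoulli_pmf (1/2))) (Not -` A) = emeasure (measure_pmf (bernoulli_pmf (1/2))) A" for A
  proof -
    have "map_pmf Not (bernoulli_pmf (1/2)) = bernoulli_pmf (1/2)"
    proof (rule pmf_eqI)
      fix i
      have "pmf (map_pmf Not (bernoulli_pmf (1/2))) (\<not> \<not> i) = pmf (bernoulli_pmf (1/2)) (\<not> i)"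
        by (rule pmf_map_inj') (auto simp: inj_def)
      then show "pmf (map_pmf Not (bernoulli_pmf (1/2))) i = pmf (bernoulli_pmf (1/2)) i"
        by (cases i) simp_all
    qed
    then show ?thesis by (metis emeasure_map_pmf)
  qed
  have "(\<lambda>b. b(i := \<not> b i)) -` ?P X \<inter> space signs = ?P X'"
    by (auto simp: prod_emb_def space_PiM X'_def PiE_iff split: if_splits)
  then have "emeasure (distr signs signs (\<lambda>b. b(i := \<not> b i))) (?P X) = emeasure signs (?P X')"
    using J by (subst emeasure_distr) (auto intro!: sets_PiM_I)
  also have "\<dots> = (\<Prod>j\<in>J. emeasure (measure_pmf (bernoulli_pmf (1/2))) (X' j))"
    using J by (intro signs.emeasure_PiM_emb) auto
  also have "\<dots> = (\<Prod>j\<in>J. emeasure (measure_pmf (bernoulli_pmf (1/2))) (X j))"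
    by (intro prod.cong) (auto simp: X'_def half)
  finally show "emeasure (distr signs signs (\<lambda>b. b(i := \<not> b i))) (?P X) = (\<Prod>j\<in>J. emeasure (measure_pmf (bernoulli_pmf (1/2))) (X j))" .
qed simp

context hilbert_basis
begin

definition signed_proj :: "nat \<Rightarrow> 'h \<Rightarrow> (nat \<Rightarrow> bool) \<Rightarrow> 'h" where
  "signed_proj n u b = (\<Sum>i<n. (if b i then u \<bullet> e i else - (u \<bullet> e i)) *\<^sub>R e i)"

definition signed :: "'h \<Rightarrow> (nat \<Rightarrow> bool) \<Rightarrow> 'h" where
  "signed u b = lim (\<lambda>n. signed_proj n u b)"

text \<open>Signs do not change the norm of a finite block of an orthogonal expansion, so the signed
  partial sums are as far apart as the unsigned ones and inherit their Cauchy property.\<close>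

lemma signed_proj_tendsto: "(\<lambda>n. signed_proj n u b) \<longlonglongrightarrow> signed u b"
proof -
  define c where "c i = (if b i then u \<bullet> e i else - (u \<bullet> e i))" for i
  have le: "norm (signed_proj n u b - signed_proj m u b) = norm (proj n u - proj m u)" if "m \<le> n" for m n
  proof -
    have sq: "(norm (\<Sum>i\<in>{m..<n}. d i *\<^sub>R e i))\<^sup>2 = (\<Sum>i\<in>{m..<n}. (d i)\<^sup>2)" for d :: "nat \<Rightarrow> real"
      by (subst norm_sum_Pythagorean) (auto simp: pairwise_def orthogonal_def inner_basis power_mult_distrib)
    have diff: "(\<Sum>i<n. f i) - (\<Sum>i<m. f i) = (\<Sum>i\<in>{m..<n}. f i)" for f :: "nat \<Rightarrow> 'h"
      using sum_diff_nat_ivl[of 0 m n f] that by (simp add: lessThan_atLeast0)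
    have "(norm (signed_proj n u b - signed_proj m u b))\<^sup>2 = (norm (proj n u - proj m u))\<^sup>2"
      unfolding signed_proj_def proj_def diff sq by (intro sum.cong) auto
    then show ?thesis by (simp add: power2_eq_iff_nonneg)
  qed
  have "dist (signed_proj n u b) (signed_proj m u b) = dist (proj n u) (proj m u)" for m n
    using le[of m n] le[of n m] by (cases "m \<le> n") (auto simp: dist_norm norm_minus_commute)
  then have "Cauchy (\<lambda>n. signed_proj n u b)"
    using LIMSEQ_imp_Cauchy[OF proj_tendsto[of u]] by (simp add: Cauchy_def)
  then show ?thesis
    unfolding signed_def by (simp add: Cauchy_convergent_iff convergent_LIMSEQ_iff)
qed

lemma signed_inner: "signed u b \<bullet> e j = (if b j then u \<bullet> e j else - (u \<bullet> e j))"
proof (rule LIMSEQ_unique)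
  show "(\<lambda>n. signed_proj n u b \<bullet> e j) \<longlonglongrightarrow> signed u b \<bullet> e j"
    by (intro tendsto_inner signed_proj_tendsto tendsto_const)
  have "signed_proj n u b \<bullet> e j = (if b j then u \<bullet> e j else - (u \<bullet> e j))" if "j < n" for n
  proof -
    have "signed_proj n u b \<bullet> e j = (\<Sum>i<n. if i = j then (if b j then u \<bullet> e j else - (u \<bullet> e j)) else 0)"
      unfolding signed_proj_def inner_sum_left by (intro sum.cong) (auto simp: inner_basis)
    then show ?thesis using that by simp
  qed
  then show "(\<lambda>n. signed_proj n u b \<bullet> e j) \<longlonglongrightarrow> (if b j then u \<bullet> e j else - (u \<bullet> e j))"
    by (intro tendsto_eventually eventually_sequentiallyI[of "Suc j"]) simp
qed

lemma signed_flip: "signed u (b(i := \<not> b i)) = flip e i (signed u b)"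
  by (rule inner_basis_eqI) (auto simp: signed_inner flip_inner)

lemma signed_measurable [measurable]: "signed u \<in> borel_measurable signs"
proof (rule borel_measurable_LIMSEQ_metric[OF _ signed_proj_tendsto])
  show "signed_proj n u \<in> borel_measurable signs" for n
    unfolding signed_proj_def by measurable
qed

end

context zigzag_setting
begin

text \<open>As \<open>\<Sigma>\<close> is diagonal in the basis, the signs can be put inside it. The
  random series thus has its values in the velocity space, with measurability inherited from
  \<open>signed\<close>.\<close>

lemma velocity_law_eq:
  "velocity_law \<Sigma> e (\<Sigma> u) = distr signs (velocity_borel \<Sigma>) (\<lambda>b. \<Sigma> (signed u b))"
proof -
  have "(\<lambda>i. (if b i then \<Sigma> u \<bullet> e i else - (\<Sigma> u \<bullet> e i)) *\<^sub>R e i) sums \<Sigma> (signed u b)" for b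
  proof -
    have "(\<lambda>n. \<Sigma> (signed_proj n u b)) \<longlonglongrightarrow> \<Sigma> (signed u b)"
      by (rule bounded_linear.tendsto[OF \<Sigma>_bounded_linear signed_proj_tendsto])
    moreover have "\<Sigma> (signed_proj n u b) = (\<Sum>i<n. (if b i then \<Sigma> u \<bullet> e i else - (\<Sigma> u \<bullet> e i)) *\<^sub>R e i)" for n
      unfolding signed_proj_def linear_sum[OF \<Sigma>_linear] linear_scale[OF \<Sigma>_linear] \<Sigma>_basis
      by (intro sum.cong) (auto simp: \<Sigma>_inner_basis)
    ultimately show ?thesis by (simp add: sums_def)
  qed
  then have "(\<Sum>i. (if b i then \<Sigma> u \<bullet> e i else - (\<Sigma> u \<bullet> e i)) *\<^sub>R e i) = \<Sigma> (signed u b)" for b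
    by (rule sums_unique[symmetric])
  then show ?thesis by (simp add: velocity_law_def)
qed

lemma signed_velocity_measurable [measurable]: "(\<lambda>b. \<Sigma> (signed u b)) \<in> signs \<rightarrow>\<^sub>M velocity_borel \<Sigma>"
  by (intro measurable_velocity_borelI) measurable

lemma prob_space_velocity_law: "prob_space (velocity_law \<Sigma> e (\<Sigma> u))"
  unfolding velocity_law_eq by (rule signs.P.prob_space_distr) measurable

lemma sets_velocity_law: "sets (velocity_law \<Sigma> e (\<Sigma> u)) = sets (velocity_borel \<Sigma>)"
  by (simp add: velocity_law_eq)

lemma nn_integral_velocity_flip:
  assumes [measurable]: "f \<in> borel_measurable (velocity_borel \<Sigma>)"
  shows "(\<integral>\<^sup>+v. f (flip e i v) \<partial>velocity_law \<Sigma> e (\<Sigma> u)) = (\<integral>\<^sup>+v. f v \<partial>velocity_law \<Sigma> e (\<Sigma> u))"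
proof -
  have [measurable]: "flip e i \<in> velocity_borel \<Sigma> \<rightarrow>\<^sub>M velocity_borel \<Sigma>"
    using measurable_velocity_borel[OF flip_linear flip_measurable \<Sigma>_flip, of "\<lambda>v. v"] by simp
  have "(\<integral>\<^sup>+v. f (flip e i v) \<partial>velocity_law \<Sigma> e (\<Sigma> u)) = (\<integral>\<^sup>+b. f (flip e i (\<Sigma> (signed u b))) \<partial>signs)"
    unfolding velocity_law_eq by (rule nn_integral_distr) measurable
  also have "\<dots> = (\<integral>\<^sup>+b. f (\<Sigma> (signed u (b(i := \<not> b i)))) \<partial>signs)"
    by (simp add: signed_flip \<Sigma>_flip)
  also have "\<dots> = (\<integral>\<^sup>+b. f (\<Sigma> (signed u b)) \<partial>distr signs signs (\<lambda>b. b(i := \<not> b i)))"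
    by (rule nn_integral_distr[symmetric]) measurable
  also have "\<dots> = (\<integral>\<^sup>+v. f v \<partial>velocity_law \<Sigma> e (\<Sigma> u))"
    unfolding distr_flip_sign velocity_law_eq by (rule nn_integral_distr[symmetric]) measurable
  finally show ?thesis .
qed

section \<open>Time reversal of the integrated rate\<close>

lemma integral_reflect_interval:
  fixes f :: "real \<Rightarrow> real"
  shows "integral {0..s} (\<lambda>r. f (s - r)) = integral {0..s} f"
  using integral_shift_real_ivl[of "- s" "- s" 0 "\<lambda>r. f (- r)"] Henstock_Kurzweil_Integration.integral_reflect_real[where f = f and a = 0 and b = s]
  by simp

text \<open>Along the flow the rates of \<open>v\<close> and \<open>- v\<close> differ by the derivative of the logarithm of the target
  density, because \<open>max a 0 - max (- a) 0 = a\<close>.\<close>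

lemma total_rate_diff:
  "total_rate e \<gamma> \<Phi> (x, \<Sigma> w) - total_rate e \<gamma> \<Phi> (x, - \<Sigma> w) = w \<bullet> x + \<Sigma> w \<bullet> grad x"
proof -
  have m: "- \<Sigma> w = \<Sigma> (- w)" by (simp add: linear_neg[OF \<Sigma>_linear])
  have d: "drift i x (- w) = - drift i x w" for i
    by (simp add: drift_def m[symmetric])
  have "total_rate e \<gamma> \<Phi> (x, \<Sigma> w) - total_rate e \<gamma> \<Phi> (x, - \<Sigma> w)
    = (\<Sum>i. flip_rate e \<gamma> \<Phi> i (x, \<Sigma> w) - flip_rate e \<gamma> \<Phi> i (x, - \<Sigma> w))"
    unfolding total_rate_def m by (rule suminf_diff; rule summable_flip_rate; simp)
  also have "\<dots> = (\<Sum>i. drift i x w)"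
    unfolding m flip_rate_drift d by (intro suminf_cong) (simp add: max_def)
  also have "\<dots> = w \<bullet> x + \<Sigma> w \<bullet> grad x" by (rule sums_unique[symmetric, OF drift_sums])
  finally show ?thesis .
qed

text \<open>From \<open>(y, - \<Sigma> w)\<close> the flow runs back over the segment that ends in
  \<open>y\<close>. Integrating \<open>total_rate_diff\<close> along it leaves the increments of the
  potential and of the Gaussian exponent.\<close>

lemma Lam_reversal:
  assumes s: "0 \<le> s"
  shows "Lam s (y - s *\<^sub>R \<Sigma> w, \<Sigma> w) - Lam s (y, - \<Sigma> w)
    = s * (y \<bullet> w) - s\<^sup>2 / 2 * (\<Sigma> w \<bullet> w) + \<Phi> y - \<Phi> (y - s *\<^sub>R \<Sigma> w)"
proof -
  define x where "x = y - s *\<^sub>R \<Sigma> w"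
  have m: "- \<Sigma> w = \<Sigma> (- w)" by (simp add: linear_neg[OF \<Sigma>_linear])
  let ?f = "\<lambda>r. total_rate e \<gamma> \<Phi> (x + r *\<^sub>R \<Sigma> w, \<Sigma> w)" and ?g = "\<lambda>r. total_rate e \<gamma> \<Phi> (x + r *\<^sub>R \<Sigma> w, - \<Sigma> w)"
  have L1: "Lam s (x, \<Sigma> w) = integral {0..s} ?f"
    by (simp add: Lam_def rate_eq free_flow_def)
  \<comment> \<open>The backward trajectory visits the same points in reversed order, hence the
    argument \<open>s - r\<close>.\<close>
  have "Lam s (y, - \<Sigma> w) = integral {0..s} (\<lambda>r. ?g (s - r))"
    by (simp add: Lam_def rate_eq free_flow_def x_def algebra_simps)
  then have L2: "Lam s (y, - \<Sigma> w) = integral {0..s} ?g"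
    using integral_reflect_interval[where f = ?g and s = s] by simp
  have cf: "continuous_on {0..s} ?f"
    by (rule continuous_on_subset[OF total_rate_flow_continuous]) simp
  have cg: "continuous_on {0..s} ?g"
  proof -
    have "continuous_on UNIV (\<lambda>r. total_rate e \<gamma> \<Phi> (x + r *\<^sub>R \<Sigma> (- w), \<Sigma> (- w)))"
      by (rule total_rate_flow_continuous)
    then have "continuous_on UNIV (\<lambda>r. total_rate e \<gamma> \<Phi> (x + (- r) *\<^sub>R \<Sigma> (- w), \<Sigma> (- w)))"
      by (rule continuous_on_compose2) (auto intro!: continuous_intros)
    then show ?thesis
      unfolding m[symmetric] by (auto intro: continuous_on_subset)
  qed
  \<comment> \<open>Antiderivative of the difference of the rates: the increment of the Gaussian
    exponent, quadratic in \<open>r\<close>, plus the potential.\<close>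
  let ?H = "\<lambda>r. r * (w \<bullet> x) + r\<^sup>2 / 2 * (w \<bullet> \<Sigma> w) + \<Phi> (x + r *\<^sub>R \<Sigma> w)"
  have "((\<lambda>r. ?f r - ?g r) has_integral ?H s - ?H 0) {0..s}"
  proof (rule fundamental_theorem_of_calculus[OF s])
    fix r assume "r \<in> {0..s}"
    have "((\<lambda>r. \<Phi> (x + r *\<^sub>R \<Sigma> w)) has_derivative (\<lambda>t. (t *\<^sub>R \<Sigma> w) \<bullet> grad (x + r *\<^sub>R \<Sigma> w))) (at r within {0..s})"
      by (rule has_derivative_compose[OF _ grad]) (auto intro!: derivative_eq_intros)
    then have "((\<lambda>r. \<Phi> (x + r *\<^sub>R \<Sigma> w)) has_real_derivative (\<Sigma> w \<bullet> grad (x + r *\<^sub>R \<Sigma> w))) (at r within {0..s})"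
      unfolding has_field_derivative_def
      by (rule has_derivative_eq_rhs) (simp add: fun_eq_iff mult.commute)
    then have "(?H has_real_derivative (w \<bullet> x + r * (w \<bullet> \<Sigma> w) + \<Sigma> w \<bullet> grad (x + r *\<^sub>R \<Sigma> w))) (at r within {0..s})"
      by (auto intro!: derivative_eq_intros)
    moreover have "w \<bullet> x + r * (w \<bullet> \<Sigma> w) + \<Sigma> w \<bullet> grad (x + r *\<^sub>R \<Sigma> w) = ?f r - ?g r"
      unfolding total_rate_diff by (simp add: inner_add_right)
    ultimately show "(?H has_vector_derivative ?f r - ?g r) (at r within {0..s})"
      by (simp add: has_real_derivative_iff_has_vector_derivative)
  qed
  then have "integral {0..s} (\<lambda>r. ?f r - ?g r) = ?H s - ?H 0" by (rule integral_unique)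
  moreover have "integral {0..s} (\<lambda>r. ?f r - ?g r) = integral {0..s} ?f - integral {0..s} ?g"
    by (intro Henstock_Kurzweil_Integration.integral_diff integrable_continuous_interval cf cg)
  ultimately have "Lam s (x, \<Sigma> w) - Lam s (y, - \<Sigma> w) = ?H s - ?H 0"
    by (simp add: L1 L2)
  also have "\<dots> = s * (y \<bullet> w) - s\<^sup>2 / 2 * (\<Sigma> w \<bullet> w) + \<Phi> y - \<Phi> x"
    by (simp add: x_def inner_diff_right inner_commute power2_eq_square algebra_simps)
  finally show ?thesis by (simp add: x_def)
qed

end

section \<open>The Gibbs measure and its dualities\<close>

locale gibbs_setting = gaussian_setting e \<Sigma> \<gamma> \<Phi> \<pi>\<^sub>0
  for e :: "nat \<Rightarrow> 'h::{real_inner, polish_space}" and \<Sigma> \<gamma> \<Phi> and \<pi>\<^sub>0 :: "'h measure" +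
  fixes u :: 'h
begin

abbreviation "\<nu> \<equiv> velocity_law \<Sigma> e (\<Sigma> u)"
abbreviation "\<mu> \<equiv> gibbs_measure \<Sigma> e \<pi>\<^sub>0 (\<Sigma> u) \<Phi>"

sublocale \<nu>: prob_space \<nu> by (rule prob_space_velocity_law)

declare sets_velocity_law [measurable_cong, simp]

sublocale \<pi>\<nu>: pair_prob_space \<pi>\<^sub>0 \<nu> ..

lemma sets_\<pi>\<nu>: "sets (\<pi>\<^sub>0 \<Otimes>\<^sub>M \<nu>) = sets (state_space \<Sigma>)"
  unfolding state_space_def by (intro sets_pair_measure_cong) simp_all

lemma \<pi>\<nu>_measurable: "f \<in> state_space \<Sigma> \<rightarrow>\<^sub>M M \<Longrightarrow> f \<in> \<pi>\<^sub>0 \<Otimes>\<^sub>M \<nu> \<rightarrow>\<^sub>M M"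
  using measurable_cong_sets[OF sets_\<pi>\<nu> refl] by blast

definition Zc :: real where "Zc = (\<integral>(x, v). exp (- \<Phi> x) \<partial>(\<pi>\<^sub>0 \<Otimes>\<^sub>M \<nu>))"

lemma weight_integrable: "integrable (\<pi>\<^sub>0 \<Otimes>\<^sub>M \<nu>) (\<lambda>(x, v). exp (- \<Phi> x))"
proof (rule \<pi>\<nu>.integrable_const_bound[of _ 1])
  note [measurable] = position_measurable
  have "(\<lambda>p. exp (- \<Phi> (fst p))) \<in> borel_measurable (state_space \<Sigma>)" by measurable
  then show "(\<lambda>(x, v). exp (- \<Phi> x)) \<in> borel_measurable (\<pi>\<^sub>0 \<Otimes>\<^sub>M \<nu>)"
    by (intro \<pi>\<nu>_measurable) (simp add: split_beta')
qed (auto simp: \<Phi>_nonneg)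

lemma Zc_pos: "0 < Zc"
proof -
  have "Zc \<noteq> 0"
  proof
    assume "Zc = 0"
    then have "AE p in \<pi>\<^sub>0 \<Otimes>\<^sub>M \<nu>. (case p of (x, v) \<Rightarrow> exp (- \<Phi> x)) = 0"
      unfolding Zc_def by (subst (asm) integral_nonneg_eq_0_iff_AE[OF weight_integrable]) (auto split: prod.splits)
    then have "AE p in \<pi>\<^sub>0 \<Otimes>\<^sub>M \<nu>. False" by eventually_elim (auto split: prod.splits)
    then show False using \<pi>\<nu>.AE_False by simp
  qed
  moreover have "0 \<le> Zc" unfolding Zc_def by (intro integral_nonneg_AE) (auto split: prod.splits)
  ultimately show ?thesis by simp
qed

definition weight :: "'h \<Rightarrow> ennreal" where "weight x = ennreal (exp (- \<Phi> x) / Zc)"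

lemma weight_measurable [measurable]: "weight \<in> borel_measurable borel"
  unfolding weight_def by measurable

lemma weight_fst_measurable: "(\<lambda>p. weight (fst p)) \<in> borel_measurable (state_space \<Sigma>)"
  by (rule measurable_compose[OF position_measurable weight_measurable])

lemma gibbs_eq: "\<mu> = density (\<pi>\<^sub>0 \<Otimes>\<^sub>M \<nu>) (\<lambda>p. weight (fst p))"
  by (simp add: gibbs_measure_def Let_def weight_def Zc_def split_beta')

lemma sets_gibbs [measurable_cong, simp]: "sets \<mu> = sets (state_space \<Sigma>)"
  unfolding gibbs_eq sets_density by (rule sets_\<pi>\<nu>)

text \<open>Both orders are used: velocity innermost for flips at a fixed position, position
  innermost for shifts at a fixed velocity.\<close>

lemma nn_integral_gibbs:
  assumes f: "f \<in> borel_measurable (state_space \<Sigma>)"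
  shows "(\<integral>\<^sup>+z. f z \<partial>\<mu>) = (\<integral>\<^sup>+x. \<integral>\<^sup>+v. weight x * f (x, v) \<partial>\<nu> \<partial>\<pi>\<^sub>0)"
    and "(\<integral>\<^sup>+z. f z \<partial>\<mu>) = (\<integral>\<^sup>+v. \<integral>\<^sup>+x. weight x * f (x, v) \<partial>\<pi>\<^sub>0 \<partial>\<nu>)"
proof -
  have m: "(\<lambda>p. weight (fst p) * f p) \<in> borel_measurable (\<pi>\<^sub>0 \<Otimes>\<^sub>M \<nu>)"
    by (intro \<pi>\<nu>_measurable borel_measurable_times_ennreal weight_fst_measurable f)
  have "(\<integral>\<^sup>+z. f z \<partial>\<mu>) = (\<integral>\<^sup>+p. weight (fst p) * f p \<partial>(\<pi>\<^sub>0 \<Otimes>\<^sub>M \<nu>))"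
    unfolding gibbs_eq by (rule nn_integral_density[OF \<pi>\<nu>_measurable[OF weight_fst_measurable] \<pi>\<nu>_measurable[OF f]])
  then show "(\<integral>\<^sup>+z. f z \<partial>\<mu>) = (\<integral>\<^sup>+x. \<integral>\<^sup>+v. weight x * f (x, v) \<partial>\<nu> \<partial>\<pi>\<^sub>0)"
    "(\<integral>\<^sup>+z. f z \<partial>\<mu>) = (\<integral>\<^sup>+v. \<integral>\<^sup>+x. weight x * f (x, v) \<partial>\<pi>\<^sub>0 \<partial>\<nu>)"
    using \<nu>.nn_integral_fst[OF m] \<pi>\<nu>.nn_integral_snd[OF m]
    by (simp_all add: split_beta')
qed

lemma prob_space_gibbs: "prob_space \<mu>"
proof
  have "emeasure \<mu> (space \<mu>) = (\<integral>\<^sup>+p. ennreal ((case p of (x, v) \<Rightarrow> exp (- \<Phi> x)) / Zc) \<partial>(\<pi>\<^sub>0 \<Otimes>\<^sub>M \<nu>))"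
    unfolding gibbs_eq space_density
    by (subst emeasure_density[OF \<pi>\<nu>_measurable[OF weight_fst_measurable] sets.top])
      (auto intro!: nn_integral_cong simp: weight_def split_beta')
  also have "\<dots> = ennreal (\<integral>p. (case p of (x, v) \<Rightarrow> exp (- \<Phi> x)) / Zc \<partial>(\<pi>\<^sub>0 \<Otimes>\<^sub>M \<nu>))"
    using Zc_pos by (intro nn_integral_eq_integral integrable_divide weight_integrable) (auto split: prod.splits)
  also have "\<dots> = 1"
    using Zc_pos by (simp add: Zc_def)
  finally show "emeasure \<mu> (space \<mu>) = 1" .
qed

abbreviation reverse :: "'h \<times> 'h \<Rightarrow> 'h \<times> 'h" where
  "reverse \<equiv> (\<lambda>(x, v). (x, - v))"

lemma reverse_measurable [measurable]: "reverse \<in> state_space \<Sigma> \<rightarrow>\<^sub>M state_space \<Sigma>"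
proof -
  have "(\<lambda>z. - snd z) \<in> state_space \<Sigma> \<rightarrow>\<^sub>M velocity_borel \<Sigma>"
    by (rule measurable_velocity_borel[OF _ _ _ velocity_measurable])
      (simp_all add: linear_neg[OF \<Sigma>_linear] module_hom_uminus linear_uminus)
  then have "(\<lambda>z. (fst z, - snd z)) \<in> state_space \<Sigma> \<rightarrow>\<^sub>M borel \<Otimes>\<^sub>M velocity_borel \<Sigma>"
    by (intro measurable_Pair position_measurable)
  then show ?thesis by (simp add: split_beta' flip: state_space_def)
qed

lemma state_space_section:
  assumes "f \<in> state_space \<Sigma> \<rightarrow>\<^sub>M M" "v \<in> range \<Sigma>"
  shows "(\<lambda>x. f (x, v)) \<in> borel \<rightarrow>\<^sub>M M"
proof -
  have "(\<lambda>x. (x, v)) \<in> borel \<rightarrow>\<^sub>M state_space \<Sigma>"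
    unfolding state_space_def using assms(2) by (intro measurable_Pair) auto
  then show ?thesis by (rule measurable_compose[OF _ assms(1)])
qed

text \<open>Passing to the end point \<open>y = x + s v\<close> brings in the Cameron-Martin
  density. By \<open>Lam_reversal\<close> it converts the weight and survival probability at
  \<open>x\<close> with velocity \<open>v\<close> into those at \<open>y\<close> with velocity
  \<open>- v\<close>.\<close>

lemma killed_flow_reversal:
  assumes s: "0 \<le> s" and f [measurable]: "f \<in> borel_measurable (state_space \<Sigma>)" and g [measurable]: "g \<in> borel_measurable (state_space \<Sigma>)"
  shows "(\<integral>\<^sup>+x. weight x * (g (x, \<Sigma> w) * killed_flow f s (x, \<Sigma> w)) \<partial>\<pi>\<^sub>0)
    = (\<integral>\<^sup>+x. weight x * (killed_flow (\<lambda>z. g (reverse z)) s (reverse (x, \<Sigma> w)) * f (x, \<Sigma> w)) \<partial>\<pi>\<^sub>0)"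
proof -
  let ?v = "\<Sigma> w"
  \<comment> \<open>The integrand as a function of the end point, so that the original integral is
    one of a shifted function.\<close>
  define G where "G y = weight (y - s *\<^sub>R ?v) * (g (y - s *\<^sub>R ?v, ?v) * (ennreal (exp (- Lam s (y - s *\<^sub>R ?v, ?v))) * f (y, ?v)))" for y
  have [measurable]: "(\<lambda>y. f (y, ?v)) \<in> borel_measurable borel" "(\<lambda>y. g (y, ?v)) \<in> borel_measurable borel"
    "(\<lambda>y. Lam s (y, ?v)) \<in> borel_measurable borel"
    by (rule state_space_section; measurable)+
  have [measurable]: "(\<lambda>y. g (y - s *\<^sub>R ?v, ?v)) \<in> borel_measurable borel" "(\<lambda>y. Lam s (y - s *\<^sub>R ?v, ?v)) \<in> borel_measurable borel"
    by (rule measurable_compose[of "\<lambda>y. y - s *\<^sub>R ?v" borel borel]; measurable)+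
  have G [measurable]: "G \<in> borel_measurable borel" unfolding G_def by measurable
  have "(\<integral>\<^sup>+x. weight x * (g (x, ?v) * killed_flow f s (x, ?v)) \<partial>\<pi>\<^sub>0) = (\<integral>\<^sup>+x. G (x + \<Sigma> (s *\<^sub>R w)) \<partial>\<pi>\<^sub>0)"
    by (intro nn_integral_cong) (simp add: G_def killed_flow_def free_flow_def linear_scale[OF \<Sigma>_linear])
  also have "\<dots> = (\<integral>\<^sup>+x. G x * ennreal (exp (x \<bullet> (s *\<^sub>R w) - (\<Sigma> (s *\<^sub>R w) \<bullet> (s *\<^sub>R w)) / 2)) \<partial>\<pi>\<^sub>0)"
    by (rule cameron_martin[OF G])
  also have "\<dots> = (\<integral>\<^sup>+x. weight x * (killed_flow (\<lambda>z. g (reverse z)) s (reverse (x, ?v)) * f (x, ?v)) \<partial>\<pi>\<^sub>0)"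
  proof (rule nn_integral_cong)
    fix y
    let ?x = "y - s *\<^sub>R ?v"
    have e: "y \<bullet> (s *\<^sub>R w) - (\<Sigma> (s *\<^sub>R w) \<bullet> (s *\<^sub>R w)) / 2 = s * (y \<bullet> w) - s\<^sup>2 / 2 * (\<Sigma> w \<bullet> w)"
      by (simp add: linear_scale[OF \<Sigma>_linear] power2_eq_square)
    have "exp (- \<Phi> ?x) / Zc * exp (- Lam s (?x, ?v)) * exp (s * (y \<bullet> w) - s\<^sup>2 / 2 * (\<Sigma> w \<bullet> w))
      = exp (- \<Phi> y) / Zc * exp (- Lam s (y, - ?v))"
      using Lam_reversal[OF s, of y w] by (simp add: exp_add[symmetric] algebra_simps)
    then have "weight ?x * ennreal (exp (- Lam s (?x, ?v))) * ennreal (exp (s * (y \<bullet> w) - s\<^sup>2 / 2 * (\<Sigma> w \<bullet> w)))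
      = weight y * ennreal (exp (- Lam s (y, - ?v)))"
      unfolding weight_def using Zc_pos by (simp add: ennreal_mult[symmetric])
    then have "weight y * ennreal (exp (- Lam s (y, - ?v))) * (g (?x, ?v) * f (y, ?v))
      = weight ?x * ennreal (exp (- Lam s (?x, ?v))) * ennreal (exp (s * (y \<bullet> w) - s\<^sup>2 / 2 * (\<Sigma> w \<bullet> w))) * (g (?x, ?v) * f (y, ?v))"
      by simp
    then show "G y * ennreal (exp (y \<bullet> (s *\<^sub>R w) - (\<Sigma> (s *\<^sub>R w) \<bullet> (s *\<^sub>R w)) / 2))
      = weight y * (killed_flow (\<lambda>z. g (reverse z)) s (reverse (y, ?v)) * f (y, ?v))"
      unfolding e G_def by (simp add: killed_flow_def free_flow_def ac_simps)
  qed
  finally show ?thesis .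
qed

lemma reversible: "reversible_pdmp (state_space \<Sigma>) free_flow (flip_rate e \<gamma> \<Phi>) jump_map \<mu> reverse"
proof (intro reversible_pdmp.intro pdmp_setup reversible_pdmp_axioms.intro prob_space_gibbs)
  show "sets \<mu> = sets (state_space \<Sigma>)" by simp
  show "reverse \<in> state_space \<Sigma> \<rightarrow>\<^sub>M state_space \<Sigma>" by measurable
  show "reverse (reverse z) = z" for z by (cases z) simp
  show "jump_map i (reverse z) = reverse (jump_map i z)" for i z
    by (cases z) (simp add: flip_def)
next
  fix s :: real and f g :: "'h \<times> 'h \<Rightarrow> ennreal" assume s: "0 \<le> s"
    and f [measurable]: "f \<in> borel_measurable (state_space \<Sigma>)" and g [measurable]: "g \<in> borel_measurable (state_space \<Sigma>)"
  have "(\<integral>\<^sup>+z. g z * killed_flow f s z \<partial>\<mu>) = (\<integral>\<^sup>+v. \<integral>\<^sup>+x. weight x * (g (x, v) * killed_flow f s (x, v)) \<partial>\<pi>\<^sub>0 \<partial>\<nu>)"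
    by (rule nn_integral_gibbs(2)) measurable
  also have "\<dots> = (\<integral>\<^sup>+v. \<integral>\<^sup>+x. weight x * (killed_flow (\<lambda>z. g (reverse z)) s (reverse (x, v)) * f (x, v)) \<partial>\<pi>\<^sub>0 \<partial>\<nu>)"
  proof (rule nn_integral_cong)
    fix v assume "v \<in> space \<nu>"
    then have "v \<in> range \<Sigma>" using sets_eq_imp_space_eq[OF sets_velocity_law[of u]] by simp
    then obtain w where "v = \<Sigma> w" by auto
    then show "(\<integral>\<^sup>+x. weight x * (g (x, v) * killed_flow f s (x, v)) \<partial>\<pi>\<^sub>0)
      = (\<integral>\<^sup>+x. weight x * (killed_flow (\<lambda>z. g (reverse z)) s (reverse (x, v)) * f (x, v)) \<partial>\<pi>\<^sub>0)"
      using killed_flow_reversal[OF s f g] by simp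
  qed
  also have "\<dots> = (\<integral>\<^sup>+z. killed_flow (\<lambda>z. g (reverse z)) s (reverse z) * f z \<partial>\<mu>)"
    by (rule nn_integral_gibbs(2)[symmetric]) measurable
  finally show "(\<integral>\<^sup>+z. g z * killed_flow f s z \<partial>\<mu>) = (\<integral>\<^sup>+z. killed_flow (\<lambda>z. g (reverse z)) s (reverse z) * f z \<partial>\<mu>)" .
next
  fix f g :: "'h \<times> 'h \<Rightarrow> ennreal" and i assume f [measurable]: "f \<in> borel_measurable (state_space \<Sigma>)" and g [measurable]: "g \<in> borel_measurable (state_space \<Sigma>)"
  let ?r = "flip_rate e \<gamma> \<Phi> i"
  let ?h = "\<lambda>z. (ennreal (?r (reverse z)) * g (jump_map i z)) * f z"
  have flip2: "flip e i (flip e i v) = v" for v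
    by (rule inner_basis_eqI) (simp add: flip_inner)
  \<comment> \<open>Flipping coordinate \<open>i\<close> and then reversing the velocity restores
    that coordinate, the only one of the velocity on which rate \<open>i\<close> depends.\<close>
  have rate_flip: "?r (x, - flip e i v) = ?r (x, v)" for x v
    by (simp add: flip_rate_def flip_inner)
  have "(\<integral>\<^sup>+z. g z * (ennreal (?r z) * f (jump_map i z)) \<partial>\<mu>)
    = (\<integral>\<^sup>+x. \<integral>\<^sup>+v. weight x * (g (x, v) * (ennreal (?r (x, v)) * f (jump_map i (x, v)))) \<partial>\<nu> \<partial>\<pi>\<^sub>0)"
    by (rule nn_integral_gibbs(1)) measurable
  also have "\<dots> = (\<integral>\<^sup>+x. \<integral>\<^sup>+v. weight x * ?h (x, flip e i v) \<partial>\<nu> \<partial>\<pi>\<^sub>0)"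
    by (simp add: flip2 rate_flip ac_simps)
  also have "\<dots> = (\<integral>\<^sup>+x. \<integral>\<^sup>+v. weight x * ?h (x, v) \<partial>\<nu> \<partial>\<pi>\<^sub>0)"
  proof (rule nn_integral_cong)
    fix x
    have h: "?h \<in> borel_measurable (state_space \<Sigma>)" by measurable
    have "(\<lambda>v. (x, v)) \<in> velocity_borel \<Sigma> \<rightarrow>\<^sub>M state_space \<Sigma>" unfolding state_space_def by simp
    from measurable_compose[OF this h] have "(\<lambda>v. weight x * ?h (x, v)) \<in> borel_measurable (velocity_borel \<Sigma>)"
      by (rule borel_measurable_times_ennreal[OF borel_measurable_const])
    then show "(\<integral>\<^sup>+v. weight x * ?h (x, flip e i v) \<partial>\<nu>) = (\<integral>\<^sup>+v. weight x * ?h (x, v) \<partial>\<nu>)"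
      by (rule nn_integral_velocity_flip)
  qed
  also have "\<dots> = (\<integral>\<^sup>+z. ?h z \<partial>\<mu>)"
    by (rule nn_integral_gibbs(1)[symmetric]) measurable
  finally show "(\<integral>\<^sup>+z. g z * (ennreal (?r z) * f (jump_map i z)) \<partial>\<mu>) = (\<integral>\<^sup>+z. ?h z \<partial>\<mu>)" .
qed

end

theorem theorem4p3:
  fixes \<Sigma> :: "'h::{real_inner, polish_space} \<Rightarrow> 'h"
    and e :: "nat \<Rightarrow> 'h" and \<gamma> :: "nat \<Rightarrow> real" and \<Phi> :: "'h \<Rightarrow> real"
  assumes "covariance_operator \<Sigma> e \<gamma>"
    and "assumption_G \<Phi>"
  shows "(\<exists>(N :: (nat \<Rightarrow> ereal \<times> 'h \<times> 'h) measure) P Z. zigzag_process \<Sigma> e \<gamma> \<Phi> N P Z) \<and>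
    (\<forall>(N :: 'w measure) P Z \<pi>\<^sub>0 a.
       zigzag_process \<Sigma> e \<gamma> \<Phi> N P Z \<and> gaussian_law \<Sigma> \<pi>\<^sub>0 \<and> a \<in> velocities \<Sigma> \<longrightarrow>
       invariant_prob (state_space \<Sigma>) P Z (gibbs_measure \<Sigma> e \<pi>\<^sub>0 a \<Phi>))"
proof -
  have "orthonormal_basis e" using assms(1) unfolding covariance_operator_def by blast
  then interpret zigzag_setting e \<Sigma> \<gamma> \<Phi>
    using assms by unfold_locales
  show ?thesis
  proof (intro conjI allI impI)
    show "\<exists>(N :: (nat \<Rightarrow> ereal \<times> 'h \<times> 'h) measure) P Z. zigzag_process \<Sigma> e \<gamma> \<Phi> N P Z"
      using zigzag_process_exists by blast
    fix N :: "'w measure" and P Z \<pi>\<^sub>0 a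
    assume *: "zigzag_process \<Sigma> e \<gamma> \<Phi> N P Z \<and> gaussian_law \<Sigma> \<pi>\<^sub>0 \<and> a \<in> velocities \<Sigma>"
    then obtain u where a: "a = \<Sigma> u" by (auto simp: velocities_def)
    interpret gibbs_setting e \<Sigma> \<gamma> \<Phi> \<pi>\<^sub>0 u
      using * by unfold_locales simp
    interpret R: reversible_pdmp "state_space \<Sigma>" free_flow "flip_rate e \<gamma> \<Phi>" jump_map \<mu> reverse
      by (rule reversible)
    show "invariant_prob (state_space \<Sigma>) P Z (gibbs_measure \<Sigma> e \<pi>\<^sub>0 a \<Phi>)"
      unfolding a by (rule R.invariant_probI[where N = N]) (use * in \<open>simp add: zigzag_process_def rate_eq jump_kernel_eq\<close>)
  qed
qed

end
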